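(* Let $\beta>0$, $\varepsilon\in(0,1/2)$, $p=\tfrac12+\varepsilon$, and let $(G_n)_{n\ge0}$ be the DRGVR with parameters $\beta,\varepsilon$. For $v\in V_n$ let $d_n^-(v)$ be the number of neighbours $u$ of $v$ in $G_n$ with $u<v$, let $d_n^+(v)$ be the number of neighbours $u$ of $v$ in $G_n$ with $u>v$, and let $d_n^s(v)=d_n^+(v)+d_n^-(v)$. Then, for $\square\in\{s,+\}$, $$\frac{(\log\log n)^2}{\log n}\max_{v\in V_n}d_n^\square(v)-\log\log n-\log\log\log n\ \overset{\mathbb P}{\longrightarrow}\ 1+\log\Big(\frac{\beta p}{1-p}\Big),$$ and $$\frac{(\log\log n)^2}{\log n}\max_{v\in V_n}d_n^-(v)-\log\log n-\log\log\log n\ \overset{\mathbb P}{\longrightarrow}\ 1+\log\beta.$$ Finally, for $\square\in\{s,+,-\}$ let $\mathcal I_n^\square=\{u\in V_n: d_n^\square(u)=\max_{v\in V_n}d_n^\square(v)\}$. Then, for $\square\in\{s,+\}$ and any fixed $\delta\in(0,1)$, $$\frac{\log\min\mathcal I_n^\square}{\log n}\overset{\mathbb P}{\longrightarrow}1,\qquad \mathbb P\big(\max\mathcal I_n^\square\le\delta n\big)=1-o(1),\qquad\text{and}\qquad \frac{\min\mathcal I_n^-}{n}\overset{\mathbb P}{\longrightarrow}1.$$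
   Context: **DRGVR (Dynamic Random Graph with Vertex Removal).** Let $\beta>0$, $\varepsilon\in(0,1/2]$, $p=\tfrac12+\varepsilon$, and let $(\xi_n)_{n\ge1}$ be i.i.d. Bernoulli($p$). $G_0$ is the empty graph. For $n\ge1$, $G_n=(V_n,E_n)$ is built from $G_{n-1}=(V_{n-1},E_{n-1})$: if $\xi_n=1$, then $V_n=V_{n-1}\cup\{n\}$ and $E_n$ is obtained from $E_{n-1}$ by adding each edge $\{i,n\}$, $i\in V_{n-1}$, independently with probability $\min\{\beta/|V_{n-1}|,1\}$ (no edge is added if $V_{n-1}=\emptyset$); if $\xi_n=0$, a uniformly random vertex of $V_{n-1}$ (if any) is removed together with all its incident edges. Thus vertices are labelled by the step at which they were born, $V_n\subseteq\{1,\dots,n\}$. $\overset{\mathbb P}{\longrightarrow}$ denotes convergence in probability as $n\to\infty$. *)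

theory Defs
  imports "HOL-Probability.Probability"
begin

text \<open>A graph on natural-number vertices: vertex set and set of edges \<open>{u, v}\<close>.\<close>

type_synonym ngraph = "nat set \<times> nat set set"

abbreviation verts :: "ngraph \<Rightarrow> nat set" where "verts g \<equiv> fst g"
abbreviation edges :: "ngraph \<Rightarrow> nat set set" where "edges g \<equiv> snd g"

definition empty_graph :: ngraph where
  "empty_graph = ({}, {})"

definition add_vertex :: "nat \<Rightarrow> nat set \<Rightarrow> ngraph \<Rightarrow> ngraph" where
  "add_vertex n N g = (insert n (verts g), edges g \<union> (\<lambda>i. {i, n}) ` N)"

definition remove_vertex :: "nat \<Rightarrow> ngraph \<Rightarrow> ngraph" where
  "remove_vertex v g = (verts g - {v}, {e \<in> edges g. v \<notin> e})"

definition random_subset :: "nat set \<Rightarrow> real \<Rightarrow> nat set pmf" where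
  "random_subset A q =
     map_pmf (\<lambda>b. {i \<in> A. b i}) (Pi_pmf A False (\<lambda>_. bernoulli_pmf q))"

text \<open>The law of \<open>G\<^sub>n\<close> given \<open>G\<^sub>n\<^sub>-\<^sub>1 = g\<close> and \<open>\<xi>\<^sub>n = b\<close>. For the empty vertex set the random
  subset is empty, so no edge is added.\<close>

definition drgvr_step :: "real \<Rightarrow> nat \<Rightarrow> bool \<Rightarrow> ngraph \<Rightarrow> ngraph pmf" where
  "drgvr_step \<beta> n b g =
     (if b then
        map_pmf (\<lambda>N. add_vertex n N g)
          (random_subset (verts g) (min (\<beta> / real (card (verts g))) 1))
      else if verts g = {} then return_pmf g
      else map_pmf (\<lambda>v. remove_vertex v g) (pmf_of_set (verts g)))"

text \<open>A DRGVR on an arbitrary probability space, described by its law. The assumption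
  \<open>transition\<close> says that, for each possible past \<open>G\<^sub>0, \<dots>, G\<^sub>n\<^sub>-\<^sub>1, \<xi>\<^sub>1, \<dots>, \<xi>\<^sub>n\<^sub>-\<^sub>1\<close>, the variable \<open>\<xi>\<^sub>n\<close> is
  independent of the past, and the conditional law of \<open>G\<^sub>n\<close> given the past and \<open>\<xi>\<^sub>n\<close> is
  \<open>drgvr_step\<close>; it is written as a product so as not to divide by the probability of an
  impossible past.\<close>

locale DRGVR = prob_space M for M :: "'a measure" +
  fixes \<beta> \<epsilon> :: real
    and \<xi> :: "nat \<Rightarrow> 'a \<Rightarrow> bool"
    and G :: "nat \<Rightarrow> 'a \<Rightarrow> ngraph"
  assumes beta_pos: "\<beta> > 0"
    and eps_pos: "0 < \<epsilon>"
    and eps_le: "\<epsilon> \<le> 1 / 2"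
    and xi_indep: "indep_vars (\<lambda>_. count_space UNIV) \<xi> {1..}"
    and xi_law: "\<And>n. n \<ge> 1 \<Longrightarrow>
      distr M (count_space UNIV) (\<xi> n) = measure_pmf (bernoulli_pmf (1 / 2 + \<epsilon>))"
    and G_measurable: "\<And>n. G n \<in> M \<rightarrow>\<^sub>M count_space UNIV"
    and G_0: "\<And>\<omega>. \<omega> \<in> space M \<Longrightarrow> G 0 \<omega> = empty_graph"
    and transition: "\<And>n (h :: nat \<Rightarrow> ngraph) (y :: nat \<Rightarrow> bool). n \<ge> 1 \<Longrightarrow>
      prob {\<omega> \<in> space M. (\<forall>i<n. G i \<omega> = h i) \<and> (\<forall>i\<in>{1..<n}. \<xi> i \<omega> = y i) \<and>
                         \<xi> n \<omega> = y n \<and> G n \<omega> = h n}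
      = prob {\<omega> \<in> space M. (\<forall>i<n. G i \<omega> = h i) \<and> (\<forall>i\<in>{1..<n}. \<xi> i \<omega> = y i)}
        * pmf (bernoulli_pmf (1 / 2 + \<epsilon>)) (y n)
        * pmf (drgvr_step \<beta> n (y n) (h (n - 1))) (h n)"

definition neighbours :: "ngraph \<Rightarrow> nat \<Rightarrow> nat set" where
  "neighbours g v = {u \<in> verts g. {u, v} \<in> edges g}"

definition deg_minus :: "ngraph \<Rightarrow> nat \<Rightarrow> nat" where
  "deg_minus g v = card {u \<in> neighbours g v. u < v}"

definition deg_plus :: "ngraph \<Rightarrow> nat \<Rightarrow> nat" where
  "deg_plus g v = card {u \<in> neighbours g v. u > v}"

definition deg_sum :: "ngraph \<Rightarrow> nat \<Rightarrow> nat" where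
  "deg_sum g v = deg_plus g v + deg_minus g v"

text \<open>For a graph without vertices the following maximum has an unspecified value; since
  \<open>\<epsilon> > 0\<close>, the probability that \<open>G\<^sub>n\<close> is empty tends to \<open>0\<close>, so this does not affect the limits.\<close>

definition max_deg :: "(ngraph \<Rightarrow> nat \<Rightarrow> nat) \<Rightarrow> ngraph \<Rightarrow> nat" where
  "max_deg d g = Max (d g ` verts g)"

definition maximizers :: "(ngraph \<Rightarrow> nat \<Rightarrow> nat) \<Rightarrow> ngraph \<Rightarrow> nat set" where
  "maximizers d g = {u \<in> verts g. d g u = max_deg d g}"

definition tendsto_in_prob :: "'a measure \<Rightarrow> (nat \<Rightarrow> 'a \<Rightarrow> real) \<Rightarrow> real \<Rightarrow> bool" where
  "tendsto_in_prob M X c \<longleftrightarrow>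
     (\<forall>n. X n \<in> borel_measurable M) \<and>
     (\<forall>e>0. (\<lambda>n. measure M {\<omega> \<in> space M. \<bar>X n \<omega> - c\<bar> > e}) \<longlonglongrightarrow> 0)"

end

theory Submission
  imports Defs "HOL-Real_Asymp.Real_Asymp"
begin

text \<open>
  The process of vertex sets is autonomous, and given its whole path the edges between surviving
  vertices are independent, the pair \<open>u < w\<close> being joined with probability \<open>min (\<beta> / N) 1\<close>, where
  \<open>N\<close> is the number of vertices just before step \<open>w\<close>. So the in-degrees of distinct vertices are
  independent sums of Bernoulli variables, and so are the out-degrees (towards later vertices).

  A second moment computation shows that \<open>N\<close> is close to \<open>(2 p - 1) j\<close> at step \<open>j\<close>, and that of the
  vertices alive at step \<open>m\<close> about a fraction \<open>(m / n)\<^bsup>\<gamma>\<^esup>\<close> with \<open>\<gamma> = (1 - p) / (2 p - 1)\<close> survives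
  until \<open>n\<close>. Hence a vertex born at \<open>x n\<close> has mean in-degree \<open>\<beta> x\<^bsup>\<gamma>\<^esup>\<close> and mean out-degree
  \<open>c (1 - x\<^bsup>\<gamma>\<^esup>)\<close> with \<open>c = \<beta> p / (1 - p) > \<beta>\<close>. The maximum of order \<open>n\<close> independent
  Poisson-like variables of mean \<open>\<mu>\<close> sits at \<open>ln n / (ln ln n)\<^sup>2 * (ln ln n + ln ln ln n + 1 + ln \<mu>)\<close>,
  so the maximum is governed by the supremum of the means: old vertices win for the out-degree and
  the degree, young ones for the in-degree. The vertices born before \<open>n\<^bsup>\<alpha>\<^esup>\<close> with \<open>\<alpha> < 1\<close> are too few
  to contribute.
\<close>


section \<open>The law of the graph\<close>

text \<open>Origin of \<open>c\<close>: survivors born near \<open>w\<close> have density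
  \<open>p * (w / n) powr \<gamma>\<close> and each is joined to an older vertex with probability
  about \<open>\<beta> / (d * w)\<close>, where \<open>d = 2 * p - 1\<close>; summing over later
  \<open>w\<close> gives \<open>\<beta> * p / (d * \<gamma>)\<close> in front, and
  \<open>d * \<gamma> = 1 - p\<close>. The obstacle is uniformity in time: mean degrees involve
  survivor counts at all times, while only second moments at single times are at hand, of order
  \<open>n powr (3 / 2)\<close> for survivors. Counts move by bounded steps, so a deviation at one
  time persists over a window and is caught by a weighted sum of squares. For survivors this works
  only at times of order \<open>n\<close>. Earlier survivors are handled by the crude removal
  probability \<open>(1 - p) / card V \<ge> (1 - p) / j\<close> after step \<open>j\<close>, which
  makes the sum of \<open>1 / w\<close> over them small. Constant factors in the number of vertices
  do not matter: changing the mean from \<open>\<mu>\<close> to \<open>\<mu>'\<close> changes the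
  exponent of the tail at the critical level by order \<open>ln n / ln (ln n)\<close>. So linearly
  many vertices with mean near the supremum suffice for the lower bound, while having only
  \<open>n powr \<alpha>\<close> vertices costs \<open>(1 - \<alpha>) * ln n\<close>.\<close>

primrec drgvr_law :: "real \<Rightarrow> real \<Rightarrow> nat \<Rightarrow> ngraph pmf" where
  "drgvr_law \<beta> p 0 = return_pmf empty_graph"
| "drgvr_law \<beta> p (Suc n) =
     drgvr_law \<beta> p n \<bind> (\<lambda>g. bernoulli_pmf p \<bind> (\<lambda>b. drgvr_step \<beta> (Suc n) b g))"

text \<open>Histories list the newest step first and omit time 0, so the empty history stands for
  \<open>empty_graph\<close>.\<close>

fun current_graph :: "(bool \<times> ngraph) list \<Rightarrow> ngraph" where
  "current_graph [] = empty_graph"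
| "current_graph (x # xs) = snd x"

primrec history_pmf :: "real \<Rightarrow> real \<Rightarrow> nat \<Rightarrow> (bool \<times> ngraph) list pmf" where
  "history_pmf \<beta> p 0 = return_pmf []"
| "history_pmf \<beta> p (Suc n) =
     history_pmf \<beta> p n \<bind> (\<lambda>hs. map_pmf (\<lambda>bg. bg # hs)
       (bernoulli_pmf p \<bind> (\<lambda>b. map_pmf (Pair b) (drgvr_step \<beta> (Suc n) b (current_graph hs)))))"

abbreviation "drgvr_prob \<beta> p n \<equiv> measure_pmf.prob (drgvr_law \<beta> p n)"

lemma drgvr_law_eq_history:
  "drgvr_law \<beta> p n = map_pmf current_graph (history_pmf \<beta> p n)"
  by (induction n)
     (simp_all add: map_bind_pmf bind_map_pmf pmf.map_comp o_def map_pmf_def[symmetric])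

lemma length_history: "hs \<in> set_pmf (history_pmf \<beta> p n) \<Longrightarrow> length hs = n"
  by (induction n arbitrary: hs) auto

lemma pmf_bind_map_Pair:
  "pmf (p \<bind> (\<lambda>x. map_pmf (Pair x) (f x))) (a, b) = pmf p a * pmf (f a) b"
proof -
  have *: "pmf (map_pmf (Pair x) (f x)) (a, b) = indicator {a} x * pmf (f a) b" for x
  proof (cases "x = a")
    case True
    then show ?thesis by (simp add: pmf_map_inj' inj_def)
  next
    case False
    then show ?thesis by (auto simp: pmf_eq_0_set_pmf)
  qed
  show ?thesis
    unfolding pmf_bind * by (simp add: measure_pmf_single)
qed

lemma pmf_history_Cons:
  "pmf (history_pmf \<beta> p (Suc n)) ((b, g) # hs) =
     pmf (history_pmf \<beta> p n) hs * pmf (bernoulli_pmf p) b *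
     pmf (drgvr_step \<beta> (Suc n) b (current_graph hs)) g"
proof -
  have eq: "history_pmf \<beta> p (Suc n) = map_pmf (\<lambda>(hs, bg). bg # hs)
     (history_pmf \<beta> p n \<bind> (\<lambda>hs. map_pmf (Pair hs)
        (bernoulli_pmf p \<bind> (\<lambda>b. map_pmf (Pair b) (drgvr_step \<beta> (Suc n) b (current_graph hs))))))"
    by (simp add: map_bind_pmf pmf.map_comp o_def)
  have inj: "inj (\<lambda>(hs :: (bool \<times> ngraph) list, bg). bg # hs)"
    by (auto simp: inj_def)
  show ?thesis
    unfolding eq using pmf_map_inj'[OF inj, of _ "(hs, (b, g))"]
    by (simp only: prod.case pmf_bind_map_Pair mult.assoc)
qed

text \<open>It suffices to bound the point mass of each history by the probability that the process
  follows it. Summing over the countably many histories gives one inequality for every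
  \<open>Q\<close>; the same inequality for \<open>- Q\<close> turns it into an equality, since both
  sides have total mass 1.\<close>

lemma (in DRGVR) distr_G:
  "prob {\<omega> \<in> space M. G n \<omega> \<in> Q} = drgvr_prob \<beta> (1 / 2 + \<epsilon>) n Q"
proof -
  define p where "p = 1 / 2 + \<epsilon>"
  \<comment> \<open>\<open>rev\<close> because histories store the newest step first: entry
    \<open>i\<close> of \<open>rev hs\<close> is to be compared with
    \<open>(\<xi> (Suc i), G (Suc i))\<close>.\<close>
  define ev where "ev hs = {\<omega> \<in> space M. G 0 \<omega> = empty_graph \<and>
     (\<forall>i<length hs. (\<xi> (Suc i) \<omega>, G (Suc i) \<omega>) = rev hs ! i)}" for hs :: "(bool \<times> ngraph) list"
  have xi_meas: "\<xi> n \<in> M \<rightarrow>\<^sub>M count_space UNIV" if "n \<ge> 1" for n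
    using xi_indep that unfolding indep_vars_def by auto
  have xi_ev: "{\<omega> \<in> space M. \<xi> (Suc i) \<omega> = b} \<in> events" for i b
  proof -
    have "{\<omega> \<in> space M. \<xi> (Suc i) \<omega> = b} = \<xi> (Suc i) -` {b} \<inter> space M" by auto
    then show ?thesis using measurable_sets[OF xi_meas, of "Suc i" "{b}"] by simp
  qed
  have G_ev: "{\<omega> \<in> space M. G i \<omega> = g} \<in> events" for i g
  proof -
    have "{\<omega> \<in> space M. G i \<omega> = g} = G i -` {g} \<inter> space M" by auto
    then show ?thesis using measurable_sets[OF G_measurable, of "{g}" i] by simp
  qed
  have Q_ev: "{\<omega> \<in> space M. G n \<omega> \<in> Q} \<in> events" for Q
  proof -
    have "{\<omega> \<in> space M. G n \<omega> \<in> Q} = G n -` Q \<inter> space M" by auto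
    then show ?thesis using measurable_sets[OF G_measurable, of Q n] by simp
  qed
  have ev_meas: "ev hs \<in> events" for hs
  proof -
    have "ev hs = {\<omega> \<in> space M. G 0 \<omega> = empty_graph} \<inter>
       {\<omega> \<in> space M. \<forall>i\<in>{..<length hs}. (\<xi> (Suc i) \<omega>, G (Suc i) \<omega>) = rev hs ! i}"
      by (auto simp: ev_def)
    moreover have "{\<omega> \<in> space M. (\<xi> (Suc i) \<omega>, G (Suc i) \<omega>) = bg} =
       {\<omega> \<in> space M. \<xi> (Suc i) \<omega> = fst bg} \<inter> {\<omega> \<in> space M. G (Suc i) \<omega> = snd bg}" for i bg
      by (cases bg) auto
    ultimately show ?thesis
      using xi_ev G_ev by (simp only:) (intro sets.Int sets.sets_Collect_finite_All; simp)
  qed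
  have mono: "pmf (history_pmf \<beta> p (length hs)) hs \<le> prob (ev hs)" for hs
  proof (induction hs)
    case Nil
    have "ev [] = space M" using G_0 by (auto simp: ev_def)
    then show ?case by (simp add: prob_space)
  next
    case (Cons bg hs)
    obtain b g where bg: "bg = (b, g)" by (cases bg)
    define n where "n = length hs"
    \<comment> \<open>The history rewritten as functions of time, the form in which
      \<open>transition\<close> is stated; \<open>y 0\<close> is a dummy, since the coins start at
      time 1.\<close>
    define h where "h i = (case i of 0 \<Rightarrow> empty_graph | Suc j \<Rightarrow> snd (rev (bg # hs) ! j))" for i
    define y where "y i = fst (rev (bg # hs) ! (i - 1))" for i
    have hn: "h n = current_graph hs"
    proof (cases hs)
      case (Cons a list)
      then show ?thesis by (simp add: h_def n_def nth_append split: nat.split)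
    qed (simp add: h_def n_def)
    have hSn: "h (Suc n) = g" "y (Suc n) = b"
      by (simp_all add: h_def y_def n_def bg nth_append)
    have past: "(\<forall>i<Suc n. G i \<omega> = h i) \<and> (\<forall>i\<in>{1..<Suc n}. \<xi> i \<omega> = y i) \<longleftrightarrow>
       G 0 \<omega> = empty_graph \<and> (\<forall>i<n. (\<xi> (Suc i) \<omega>, G (Suc i) \<omega>) = rev hs ! i)" for \<omega>
    proof -
      have 1: "(\<forall>i<Suc n. G i \<omega> = h i) \<longleftrightarrow> G 0 \<omega> = empty_graph \<and> (\<forall>i<n. G (Suc i) \<omega> = snd (rev hs ! i))"
        by (auto simp: All_less_Suc2 h_def n_def nth_append)
      have "{1..<Suc n} = Suc ` {..<n}" by (auto simp: image_iff Suc_le_eq gr0_conv_Suc)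
      then have 2: "(\<forall>i\<in>{1..<Suc n}. \<xi> i \<omega> = y i) \<longleftrightarrow> (\<forall>i<n. \<xi> (Suc i) \<omega> = fst (rev hs ! i))"
        by (auto simp: y_def n_def nth_append)
      show ?thesis unfolding 1 2 by (auto simp: prod_eq_iff)
    qed
    have "ev (bg # hs) = {\<omega> \<in> space M. (\<forall>i<Suc n. G i \<omega> = h i) \<and> (\<forall>i\<in>{1..<Suc n}. \<xi> i \<omega> = y i) \<and>
                         \<xi> (Suc n) \<omega> = y (Suc n) \<and> G (Suc n) \<omega> = h (Suc n)}"
    proof -
      have "\<omega> \<in> ev (bg # hs) \<longleftrightarrow> \<omega> \<in> ev hs \<and> \<xi> (Suc n) \<omega> = b \<and> G (Suc n) \<omega> = g" for \<omega>
        unfolding ev_def bg n_def by (auto simp: All_less_Suc nth_append)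
      moreover have "\<omega> \<in> ev hs \<longleftrightarrow> \<omega> \<in> space M \<and> (\<forall>i<Suc n. G i \<omega> = h i) \<and> (\<forall>i\<in>{1..<Suc n}. \<xi> i \<omega> = y i)" for \<omega>
        using past[of \<omega>] by (simp add: ev_def n_def)
      ultimately show ?thesis unfolding hSn by blast
    qed
    moreover have "ev hs = {\<omega> \<in> space M. (\<forall>i<Suc n. G i \<omega> = h i) \<and> (\<forall>i\<in>{1..<Suc n}. \<xi> i \<omega> = y i)}"
      using past by (simp add: ev_def n_def)
    ultimately have "prob (ev (bg # hs)) = prob (ev hs) * pmf (bernoulli_pmf p) b
        * pmf (drgvr_step \<beta> (Suc n) b (current_graph hs)) g"
      using transition[of "Suc n" h y] by (simp add: hn hSn p_def)
    moreover have "pmf (history_pmf \<beta> p (length (bg # hs))) (bg # hs) = 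
       pmf (history_pmf \<beta> p n) hs * pmf (bernoulli_pmf p) b
        * pmf (drgvr_step \<beta> (Suc n) b (current_graph hs)) g"
      unfolding bg n_def list.size by (simp only: pmf_history_Cons add_0_right add_Suc_right)
    ultimately show ?case
      using Cons.IH by (auto simp: n_def intro!: mult_right_mono)
  qed
  have le: "drgvr_prob \<beta> p n Q \<le> prob {\<omega> \<in> space M. G n \<omega> \<in> Q}" for Q
  proof -
    define S where "S = set_pmf (history_pmf \<beta> p n) \<inter> current_graph -` Q"
    have S: "countable S" unfolding S_def by (intro countable_Int1) simp
    have len: "length hs = n" if "hs \<in> S" for hs using that length_history by (auto simp: S_def)
    have disj: "disjoint_family_on ev S"
      unfolding disjoint_family_on_def
    proof (intro ballI impI)
      fix hs hs' assume *: "hs \<in> S" "hs' \<in> S" "hs \<noteq> hs'"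
      then have "rev hs \<noteq> rev hs'" by simp
      then obtain i where "i < n" "rev hs ! i \<noteq> rev hs' ! i"
        using len[OF *(1)] len[OF *(2)] by (metis length_rev nth_equalityI)
      then show "ev hs \<inter> ev hs' = {}" using len[OF *(1)] len[OF *(2)] by (auto simp: ev_def)
    qed
    have sub: "(\<Union>hs\<in>S. ev hs) \<subseteq> {\<omega> \<in> space M. G n \<omega> \<in> Q}"
    proof safe
      fix hs \<omega> assume *: "hs \<in> S" "\<omega> \<in> ev hs"
      then show "\<omega> \<in> space M" by (simp add: ev_def)
      have "G n \<omega> = current_graph hs"
      proof (cases hs)
        case (Cons a xs)
        then show ?thesis using *(2) len[OF *(1)] by (force simp: ev_def nth_append prod_eq_iff)
      qed (use * len[OF *(1)] in \<open>auto simp: ev_def\<close>)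
      then show "G n \<omega> \<in> Q" using * by (simp add: S_def)
    qed
    have "emeasure (measure_pmf (drgvr_law \<beta> p n)) Q =
        emeasure (measure_pmf (history_pmf \<beta> p n)) (current_graph -` Q)"
      by (simp add: drgvr_law_eq_history)
    \<comment> \<open>On the countable support the probabilities of the disjoint events
      \<open>ev hs\<close> can be added up.\<close>
    also have "\<dots> = emeasure (measure_pmf (history_pmf \<beta> p n)) S"
      unfolding S_def by (intro emeasure_eq_AE) (auto simp: AE_measure_pmf_iff)
    also have "\<dots> = (\<integral>\<^sup>+hs. pmf (history_pmf \<beta> p n) hs \<partial>count_space S)"
      by (simp add: nn_integral_pmf)
    also have "\<dots> \<le> (\<integral>\<^sup>+hs. emeasure M (ev hs) \<partial>count_space S)"
      using mono len by (intro nn_integral_mono) (auto simp: emeasure_eq_measure)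
    also have "\<dots> = emeasure M (\<Union>hs\<in>S. ev hs)"
      using S disj ev_meas by (intro emeasure_UN_countable[symmetric]) auto
    also have "\<dots> \<le> emeasure M {\<omega> \<in> space M. G n \<omega> \<in> Q}"
      using sub Q_ev by (rule emeasure_mono)
    finally show ?thesis
      by (simp add: emeasure_eq_measure measure_pmf.emeasure_eq_measure)
  qed
  have "prob {\<omega> \<in> space M. G n \<omega> \<in> - Q} = 1 - prob {\<omega> \<in> space M. G n \<omega> \<in> Q}"
  proof -
    have "{\<omega> \<in> space M. G n \<omega> \<in> - Q} = space M - {\<omega> \<in> space M. G n \<omega> \<in> Q}" by auto
    then show ?thesis using Q_ev[of Q] by (simp add: prob_compl)
  qed
  moreover have "drgvr_prob \<beta> p n (- Q) = 1 - drgvr_prob \<beta> p n Q"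
    using measure_pmf.prob_compl[of Q "drgvr_law \<beta> p n"] by (simp add: Compl_eq_Diff_UNIV)
  ultimately show ?thesis using le[of Q] le[of "- Q"] by (simp add: p_def)
qed


section \<open>The vertex process and the conditional law of the edges\<close>

definition vertex_step :: "nat \<Rightarrow> bool \<Rightarrow> nat set \<Rightarrow> nat set pmf" where
  "vertex_step n b V =
     (if b then return_pmf (insert n V)
      else if V = {} then return_pmf V
      else map_pmf (\<lambda>v. V - {v}) (pmf_of_set V))"

text \<open>The second component records the sizes \<open>h j = |V\<^sub>j|\<close> of the past vertex sets, which determine
  the attachment probabilities.\<close>

primrec vertex_chain :: "real \<Rightarrow> nat \<Rightarrow> (nat set \<times> (nat \<Rightarrow> nat)) pmf" where
  "vertex_chain p 0 = return_pmf ({}, \<lambda>_. 0)"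
| "vertex_chain p (Suc n) =
     vertex_chain p n \<bind> (\<lambda>(V, h). bernoulli_pmf p \<bind> (\<lambda>b.
       map_pmf (\<lambda>V'. (V', h(Suc n := card V'))) (vertex_step (Suc n) b V)))"

text \<open>If \<open>h (w - 1) = 0\<close>, division by zero yields probability 0; there is then no
  older vertex to join.\<close>

definition attach_prob :: "real \<Rightarrow> (nat \<Rightarrow> nat) \<Rightarrow> nat \<Rightarrow> real" where
  "attach_prob \<beta> h w = min (\<beta> / real (h (w - 1))) 1"

definition ordered_pairs :: "nat set \<Rightarrow> (nat \<times> nat) set" where
  "ordered_pairs V = {(u, w). u \<in> V \<and> w \<in> V \<and> u < w}"

definition graph_of :: "nat set \<Rightarrow> (nat \<times> nat \<Rightarrow> bool) \<Rightarrow> ngraph" where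
  "graph_of V b = (V, {{u, w} |u w. u \<in> V \<and> w \<in> V \<and> u < w \<and> b (u, w)})"

text \<open>Coins sit on pairs with the older vertex first. Their probability depends only on the
  younger end, at whose birth the edge was decided.\<close>

definition edge_pmf :: "nat set \<Rightarrow> (nat \<Rightarrow> real) \<Rightarrow> (nat \<times> nat \<Rightarrow> bool) pmf" where
  "edge_pmf V q = Pi_pmf (ordered_pairs V) False (\<lambda>e. bernoulli_pmf (q (snd e)))"

definition independent_graph :: "nat set \<Rightarrow> (nat \<Rightarrow> real) \<Rightarrow> ngraph pmf" where
  "independent_graph V q = map_pmf (graph_of V) (edge_pmf V q)"

lemma finite_ordered_pairs [simp]: "finite V \<Longrightarrow> finite (ordered_pairs V)"
  by (rule finite_subset[of _ "V \<times> V"]) (auto simp: ordered_pairs_def)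

lemma verts_independent_graph: "g \<in> set_pmf (independent_graph V q) \<Longrightarrow> verts g = V"
  by (auto simp: independent_graph_def graph_of_def)

lemma independent_graph_cong:
  "finite V \<Longrightarrow> (\<And>w. w \<in> V \<Longrightarrow> q w = q' w) \<Longrightarrow> independent_graph V q = independent_graph V q'"
  unfolding independent_graph_def edge_pmf_def
  by (intro arg_cong[where f = "map_pmf _"] Pi_pmf_cong) (auto simp: ordered_pairs_def)

lemma remove_vertex_graph_of: "remove_vertex v (graph_of V b) = graph_of (V - {v}) b"
  by (auto simp: remove_vertex_def graph_of_def)

lemma graph_of_cong:
  assumes "\<And>e. e \<in> ordered_pairs V \<Longrightarrow> b e = b' e"
  shows "graph_of V b = graph_of V b'"
proof -
  have "(u \<in> V \<and> w \<in> V \<and> u < w \<and> b (u, w)) = (u \<in> V \<and> w \<in> V \<and> u < w \<and> b' (u, w))" for u w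
    using assms[of "(u, w)"] by (auto simp: ordered_pairs_def)
  then show ?thesis by (simp add: graph_of_def)
qed

text \<open>The coins on pairs avoiding \<open>v\<close> are a marginal of the product law, so the
  remaining edges stay independent with unchanged probabilities.\<close>

lemma map_remove_vertex_independent_graph:
  assumes "finite V"
  shows "map_pmf (remove_vertex v) (independent_graph V q) = independent_graph (V - {v}) q"
proof -
  have "edge_pmf (V - {v}) q =
      map_pmf (\<lambda>f x. if x \<in> ordered_pairs (V - {v}) then f x else False) (edge_pmf V q)"
    unfolding edge_pmf_def
    by (rule Pi_pmf_subset[OF finite_ordered_pairs[OF assms]]) (auto simp: ordered_pairs_def)
  then have "independent_graph (V - {v}) q = map_pmf (\<lambda>b. graph_of (V - {v}) b) (edge_pmf V q)"
    unfolding independent_graph_def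
    by (simp only: pmf.map_comp o_def) (rule map_pmf_cong[OF refl], rule graph_of_cong, simp)
  also have "\<dots> = map_pmf (remove_vertex v) (independent_graph V q)"
    unfolding independent_graph_def by (simp add: pmf.map_comp o_def remove_vertex_graph_of)
  finally show ?thesis ..
qed

lemma add_vertex_graph_of:
  assumes "\<And>v. v \<in> V \<Longrightarrow> v < n"
  shows "add_vertex n {i \<in> V. g (i, n)} (graph_of V b) =
    graph_of (insert n V) (\<lambda>x. if x \<in> ordered_pairs V then b x else g x)"
proof -
  have "n \<notin> V" using assms by blast
  have "{{u, w} |u w. u \<in> V \<and> w \<in> V \<and> u < w \<and> b (u, w)} \<union> (\<lambda>i. {i, n}) ` {i \<in> V. g (i, n)} =
    {{u, w} |u w. u \<in> insert n V \<and> w \<in> insert n V \<and> u < w \<and>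
       (if (u, w) \<in> ordered_pairs V then b (u, w) else g (u, w))}" (is "?A \<union> ?B = ?C")
  proof (intro equalityI subsetI)
    fix e assume "e \<in> ?A \<union> ?B"
    then show "e \<in> ?C"
    proof
      assume "e \<in> ?A"
      then obtain u w where "e = {u, w}" "u \<in> V" "w \<in> V" "u < w" "b (u, w)" by blast
      then show ?thesis
        by (intro CollectI exI[of _ u] exI[of _ w]) (auto simp: ordered_pairs_def)
    next
      assume "e \<in> ?B"
      then obtain u where "e = {u, n}" "u \<in> V" "g (u, n)" by blast
      then show ?thesis
        using assms \<open>n \<notin> V\<close>
        by (intro CollectI exI[of _ u] exI[of _ n]) (auto simp: ordered_pairs_def)
    qed
  next
    fix e assume "e \<in> ?C"
    then obtain u w where *: "e = {u, w}" "u \<in> insert n V" "w \<in> insert n V" "u < w"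
      "if (u, w) \<in> ordered_pairs V then b (u, w) else g (u, w)" by blast
    have u: "u \<in> V" using *(2-4) assms by force
    show "e \<in> ?A \<union> ?B"
    proof (cases "w = n")
      case True
      with * u \<open>n \<notin> V\<close> show ?thesis by (auto simp: ordered_pairs_def)
    next
      case False
      with * u show ?thesis by (auto simp: ordered_pairs_def)
    qed
  qed
  then show ?thesis by (simp add: add_vertex_def graph_of_def)
qed

text \<open>The pairs ending in \<open>n\<close> form a block of coins disjoint from the old pairs,
  so the product law merely gains independent factors.\<close>

lemma independent_graph_add_vertex:
  assumes "finite V" "\<And>v. v \<in> V \<Longrightarrow> v < n"
  shows "independent_graph V q \<bind> (\<lambda>g. map_pmf (\<lambda>N. add_vertex n N g) (random_subset V (q n))) =
    independent_graph (insert n V) q"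
proof -
  define B where "B = V \<times> {n}"
  have pairs: "ordered_pairs (insert n V) = ordered_pairs V \<union> B"
    using assms(2) by (force simp: ordered_pairs_def B_def)
  have disj: "ordered_pairs V \<inter> B = {}"
    using assms(2) by (force simp: ordered_pairs_def B_def)
  have "Pi_pmf V False (\<lambda>_. bernoulli_pmf (q n)) =
      map_pmf (\<lambda>g. g \<circ> (\<lambda>v. (v, n))) (Pi_pmf B False (\<lambda>_. bernoulli_pmf (q n)))"
    by (rule Pi_pmf_bij_betw) (use assms in \<open>auto simp: B_def bij_betw_def inj_on_def\<close>)
  also have "Pi_pmf B False (\<lambda>_. bernoulli_pmf (q n)) =
      Pi_pmf B False (\<lambda>e. bernoulli_pmf (q (snd e)))"
    by (rule Pi_pmf_cong) (auto simp: B_def)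
  finally have rs: "random_subset V (q n) =
      map_pmf (\<lambda>g. {i \<in> V. g (i, n)}) (Pi_pmf B False (\<lambda>e. bernoulli_pmf (q (snd e))))"
    by (simp add: random_subset_def pmf.map_comp o_def)
  have "independent_graph (insert n V) q = map_pmf (graph_of (insert n V))
     (map_pmf (\<lambda>(f, g) x. if x \<in> ordered_pairs V then f x else g x)
       (pair_pmf (edge_pmf V q) (Pi_pmf B False (\<lambda>e. bernoulli_pmf (q (snd e))))))"
    unfolding independent_graph_def edge_pmf_def pairs
    by (subst Pi_pmf_union) (use assms disj in \<open>auto simp: B_def\<close>)
  also have "\<dots> = map_pmf (\<lambda>(f, g). add_vertex n {i \<in> V. g (i, n)} (graph_of V f))
       (pair_pmf (edge_pmf V q) (Pi_pmf B False (\<lambda>e. bernoulli_pmf (q (snd e)))))"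
    by (simp add: pmf.map_comp o_def case_prod_unfold add_vertex_graph_of[OF assms(2)])
  also have "\<dots> = independent_graph V q \<bind>
      (\<lambda>g. map_pmf (\<lambda>N. add_vertex n N g) (random_subset V (q n)))"
    unfolding independent_graph_def rs pair_pmf_def
    by (simp add: map_bind_pmf bind_map_pmf pmf.map_comp o_def map_pmf_def[symmetric])
  finally show ?thesis ..
qed

text \<open>Induction step for the conditional product law: the removed vertex is chosen without
  looking at the edges, so this choice commutes with sampling them.\<close>

lemma drgvr_step_independent_graph:
  assumes "finite V" "V \<subseteq> {1..n}" "h n = card V"
  shows "independent_graph V (attach_prob \<beta> h) \<bind> drgvr_step \<beta> (Suc n) b =
    vertex_step (Suc n) b V \<bind> (\<lambda>V'. independent_graph V' (attach_prob \<beta> (h(Suc n := x V'))))"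
proof -
  \<comment> \<open>\<open>attach_prob\<close> at \<open>w\<close> reads index \<open>w - 1\<close>,
    which is at most \<open>n\<close> for a vertex \<open>w\<close> up to \<open>Suc n\<close>, so
    the new entry at \<open>Suc n\<close> is invisible.\<close>
  have q_eq: "independent_graph V' (attach_prob \<beta> (h(Suc n := y))) = independent_graph V' (attach_prob \<beta> h)"
    if "V' \<subseteq> {1..Suc n}" for V' y
  proof (rule independent_graph_cong)
    show "finite V'" using that by (rule finite_subset) simp
    fix w assume "w \<in> V'"
    then have "w - 1 \<noteq> Suc n" using that by fastforce
    then show "attach_prob \<beta> (h(Suc n := y)) w = attach_prob \<beta> h w" by (simp add: attach_prob_def)
  qed
  show ?thesis
  proof (cases b)
    case True
    have "independent_graph V (attach_prob \<beta> h) \<bind> drgvr_step \<beta> (Suc n) b =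
      independent_graph V (attach_prob \<beta> h) \<bind> (\<lambda>g. map_pmf (\<lambda>N. add_vertex (Suc n) N g)
        (random_subset V (attach_prob \<beta> h (Suc n))))"
      by (rule bind_pmf_cong[OF refl])
         (auto simp: drgvr_step_def True attach_prob_def assms dest: verts_independent_graph)
    also have "\<dots> = independent_graph (insert (Suc n) V) (attach_prob \<beta> h)"
      by (rule independent_graph_add_vertex) (use assms in auto)
    also have "\<dots> = independent_graph (insert (Suc n) V) (attach_prob \<beta> (h(Suc n := x (insert (Suc n) V))))"
      by (rule q_eq[symmetric]) (use assms in auto)
    finally show ?thesis by (simp add: vertex_step_def True bind_return_pmf)
  next
    case False
    show ?thesis
    proof (cases "V = {}")
      case True
      have "independent_graph V (attach_prob \<beta> h) \<bind> drgvr_step \<beta> (Suc n) b =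
        independent_graph V (attach_prob \<beta> h) \<bind> return_pmf"
        by (rule bind_pmf_cong[OF refl])
           (auto simp: drgvr_step_def True False dest: verts_independent_graph)
      then show ?thesis using True q_eq[of "{}"]
        by (simp add: vertex_step_def False bind_return_pmf bind_return_pmf')
    next
      case nonempty: False
      have "independent_graph V (attach_prob \<beta> h) \<bind> drgvr_step \<beta> (Suc n) b =
        independent_graph V (attach_prob \<beta> h) \<bind> (\<lambda>g. pmf_of_set V \<bind> (\<lambda>v. return_pmf (remove_vertex v g)))"
        by (rule bind_pmf_cong[OF refl])
           (auto simp: drgvr_step_def False nonempty map_pmf_def dest: verts_independent_graph)
      also have "\<dots> = pmf_of_set V \<bind> (\<lambda>v. map_pmf (remove_vertex v) (independent_graph V (attach_prob \<beta> h)))"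
        unfolding map_pmf_def by (rule bind_commute_pmf)
      also have "\<dots> = pmf_of_set V \<bind> (\<lambda>v. independent_graph (V - {v}) (attach_prob \<beta> (h(Suc n := x (V - {v})))))"
        by (rule bind_pmf_cong[OF refl], subst q_eq)
           (use assms in \<open>auto simp: map_remove_vertex_independent_graph\<close>)
      finally show ?thesis
        by (simp add: vertex_step_def False nonempty bind_map_pmf)
    qed
  qed
qed

text \<open>\<open>card (V \<inter> {..j}) \<le> h j\<close> holds because every survivor born by
  time \<open>j\<close> was already present at time \<open>j\<close>. The last conjunct, that sizes
  move by at most one, feeds the argument that is uniform in time.\<close>

lemma vertex_chain_support:
  assumes "(V, h) \<in> set_pmf (vertex_chain p n)"
  shows "V \<subseteq> {1..n} \<and> h n = card V \<and> (\<forall>j\<le>n. h j \<le> j \<and> card (V \<inter> {..j}) \<le> h j) \<and>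
    (\<forall>j<n. h (Suc j) \<le> Suc (h j) \<and> h j \<le> Suc (h (Suc j)))"
  using assms
proof (induction n arbitrary: V h)
  case (Suc n)
  then obtain V0 h0 b where *: "(V0, h0) \<in> set_pmf (vertex_chain p n)"
    "V \<in> set_pmf (vertex_step (Suc n) b V0)" "h = h0(Suc n := card V)"
    by auto
  note IH = Suc.IH[OF *(1)]
  have fin: "finite V0" using IH by (auto intro: finite_subset)
  have sub: "V0 \<inter> {..n} = V0" "Suc n \<notin> V0" using IH by auto
  consider (add) "V = insert (Suc n) V0" | (same) "V = V0" "V0 = {}" | (rem) v where "v \<in> V0" "V = V0 - {v}"
    using *(2) fin by (auto simp: vertex_step_def split: if_splits)
  then show ?case
  proof cases
    case add
    have "V \<inter> {..j} = V0 \<inter> {..j}" if "j \<le> n" for j using add that by auto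
    moreover have "V \<inter> {..Suc n} = V" using add IH by auto
    ultimately show ?thesis using IH fin sub *(3) add by (auto simp: le_Suc_eq less_Suc_eq Int_absorb2)
  next
    case same
    then show ?thesis using IH *(3) by (auto simp: le_Suc_eq less_Suc_eq)
  next
    case rem
    have "card (V \<inter> {..j}) \<le> h0 j" if "j \<le> n" for j
    proof -
      have "card (V \<inter> {..j}) \<le> card (V0 \<inter> {..j})"
        using rem fin by (intro card_mono) auto
      with IH that show ?thesis by (meson order_trans)
    qed
    moreover have "card V0 = Suc (card V)" using rem fin by (metis card.remove)
    moreover have "V \<inter> {..Suc n} = V" using rem IH by auto
    ultimately show ?thesis using IH fin sub *(3) rem
      by (auto simp: le_Suc_eq less_Suc_eq intro: order_trans)
  qed
qed auto

text \<open>Allows \<open>(V, h)\<close> to be frozen, so that degrees become sums of independent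
  coins with explicit probabilities.\<close>

lemma drgvr_law_eq_vertex_chain:
  "drgvr_law \<beta> p n = vertex_chain p n \<bind> (\<lambda>(V, h). independent_graph V (attach_prob \<beta> h))"
proof (induction n)
  case 0
  have "independent_graph {} q = return_pmf empty_graph" for q
    by (simp add: independent_graph_def edge_pmf_def ordered_pairs_def graph_of_def empty_graph_def)
  then show ?case by (simp add: bind_return_pmf)
next
  case (Suc n)
  have "drgvr_law \<beta> p (Suc n) = vertex_chain p n \<bind> (\<lambda>(V, h). 
      independent_graph V (attach_prob \<beta> h) \<bind> (\<lambda>g. bernoulli_pmf p \<bind> (\<lambda>b. drgvr_step \<beta> (Suc n) b g)))"
    by (simp add: Suc.IH bind_assoc_pmf case_prod_unfold)
  also have "\<dots> = vertex_chain p n \<bind> (\<lambda>(V, h). 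
      bernoulli_pmf p \<bind> (\<lambda>b. independent_graph V (attach_prob \<beta> h) \<bind> drgvr_step \<beta> (Suc n) b))"
    by (rule bind_pmf_cong[OF refl], clarify, rule bind_commute_pmf)
  also have "\<dots> = vertex_chain p n \<bind> (\<lambda>(V, h). bernoulli_pmf p \<bind> (\<lambda>b. 
      vertex_step (Suc n) b V \<bind> (\<lambda>V'. independent_graph V' (attach_prob \<beta> (h(Suc n := card V'))))))"
  proof (rule bind_pmf_cong[OF refl], clarify)
    fix V h assume "(V, h) \<in> set_pmf (vertex_chain p n)"
    note supp = vertex_chain_support[OF this]
    show "bernoulli_pmf p \<bind> (\<lambda>b. independent_graph V (attach_prob \<beta> h) \<bind> drgvr_step \<beta> (Suc n) b) =
      bernoulli_pmf p \<bind> (\<lambda>b. 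
      vertex_step (Suc n) b V \<bind> (\<lambda>V'. independent_graph V' (attach_prob \<beta> (h(Suc n := card V')))))"
      by (rule bind_pmf_cong[OF refl], rule drgvr_step_independent_graph[where x = card])
         (use supp finite_subset[of V "{1..n}"] in auto)
  qed
  also have "\<dots> = vertex_chain p (Suc n) \<bind> (\<lambda>(V, h). independent_graph V (attach_prob \<beta> h))"
    by (simp add: bind_assoc_pmf bind_map_pmf case_prod_unfold)
  finally show ?case .
qed


section \<open>Sums of independent Bernoulli variables\<close>

lemma prob_Pi_pmf_subset:
  assumes "finite A" "A' \<subseteq> A" "\<And>b b'. (\<And>x. x \<in> A' \<Longrightarrow> b x = b' x) \<Longrightarrow> P b = P b'"
  shows "measure_pmf.prob (Pi_pmf A d p) {b. P b} = measure_pmf.prob (Pi_pmf A' d p) {b. P b}"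
proof -
  have "P (\<lambda>x. if x \<in> A' then f x else d) = P f" for f
    by (rule assms(3)) simp
  then show ?thesis
    unfolding Pi_pmf_subset[OF assms(1,2)] measure_map_pmf by (simp add: vimage_def)
qed

lemma prob_pair_pmf_Times:
  "measure_pmf.prob (pair_pmf M N) (A \<times> B) = measure_pmf.prob M A * measure_pmf.prob N B"
proof -
  have "measure_pmf.prob (pair_pmf M N) (A \<times> B) =
      measure_pmf.prob (pair_pmf M N) ((A \<inter> set_pmf M) \<times> (B \<inter> set_pmf N))"
    by (subst measure_Int_set_pmf[symmetric]) (simp add: Times_Int_Times)
  also have "\<dots> = measure_pmf.prob M (A \<inter> set_pmf M) * measure_pmf.prob N (B \<inter> set_pmf N)"
    by (rule measure_pmf_prob_product) (auto intro: countable_Int2)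
  finally show ?thesis by (simp add: measure_Int_set_pmf)
qed

lemma prob_Pi_pmf_union:
  assumes "finite A" "finite B" "A \<inter> B = {}"
    and "\<And>b b'. (\<And>x. x \<in> A \<Longrightarrow> b x = b' x) \<Longrightarrow> P b = P b'"
    and "\<And>b b'. (\<And>x. x \<in> B \<Longrightarrow> b x = b' x) \<Longrightarrow> Q b = Q b'"
  shows "measure_pmf.prob (Pi_pmf (A \<union> B) d p) {b. P b \<and> Q b} =
    measure_pmf.prob (Pi_pmf A d p) {b. P b} * measure_pmf.prob (Pi_pmf B d p) {b. Q b}"
proof -
  have P: "P (\<lambda>x. if x \<in> A then f x else g x) = P f" for f g
    by (rule assms(4)) simp
  have Q: "Q (\<lambda>x. if x \<in> A then f x else g x) = Q g" for f g
    by (rule assms(5)) (use assms(3) in auto)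
  have "(\<lambda>(f, g) x. if x \<in> A then f x else g x) -` {b. P b \<and> Q b} = {b. P b} \<times> {b. Q b}"
    by (auto simp: P Q)
  then show ?thesis
    unfolding Pi_pmf_union[OF assms(1-3)] measure_map_pmf by (simp only: prob_pair_pmf_Times)
qed

lemma prob_Pi_pmf_Ball_disjoint:
  assumes "finite B" "\<And>v. v \<in> B \<Longrightarrow> finite (I v)" "disjoint_family_on I B"
    and "\<And>v b b'. v \<in> B \<Longrightarrow> (\<And>x. x \<in> I v \<Longrightarrow> b x = b' x) \<Longrightarrow> P v b = P v b'"
  shows "measure_pmf.prob (Pi_pmf (\<Union>v\<in>B. I v) d p) {b. \<forall>v\<in>B. P v b} =
    (\<Prod>v\<in>B. measure_pmf.prob (Pi_pmf (I v) d p) {b. P v b})"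
  using assms
proof (induction B rule: finite_induct)
  case (insert v B)
  have disj: "I v \<inter> (\<Union>v\<in>B. I v) = {}"
  proof -
    have "I v \<inter> I w = {}" if "w \<in> B" for w
      using insert.prems(2) by (rule disjoint_family_onD) (use that insert.hyps in auto)
    then show ?thesis by blast
  qed
  have 1: "P v b = P v b'" if "\<And>x. x \<in> I v \<Longrightarrow> b x = b' x" for b b'
    by (rule insert.prems(3)) (simp_all add: that)
  have 2: "(\<forall>v\<in>B. P v b) = (\<forall>v\<in>B. P v b')" if *: "\<And>x. x \<in> (\<Union>v\<in>B. I v) \<Longrightarrow> b x = b' x" for b b'
  proof (rule ball_cong[OF refl])
    fix w assume "w \<in> B"
    show "P w b = P w b'"
    proof (rule insert.prems(3))
      fix x assume "x \<in> I w"
      with \<open>w \<in> B\<close> show "b x = b' x" by (intro *) blast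
    qed (simp add: \<open>w \<in> B\<close>)
  qed
  have IH: "measure_pmf.prob (Pi_pmf (\<Union>v\<in>B. I v) d p) {b. \<forall>v\<in>B. P v b} =
    (\<Prod>v\<in>B. measure_pmf.prob (Pi_pmf (I v) d p) {b. P v b})"
  proof (rule insert.IH)
    show "disjoint_family_on I B"
      by (rule disjoint_family_on_mono[OF _ insert.prems(2)]) blast
    show "finite (I w)" if "w \<in> B" for w
      by (rule insert.prems(1)) (use that in simp)
    show "P w b = P w b'" if "w \<in> B" and "\<And>x. x \<in> I w \<Longrightarrow> b x = b' x" for w b b'
      by (rule insert.prems(3)) (simp_all add: that)
  qed
  have "finite (I v)" "finite (\<Union>v\<in>B. I v)" using insert.hyps(1) insert.prems(1) by simp_all
  then have "measure_pmf.prob (Pi_pmf (I v \<union> (\<Union>v\<in>B. I v)) d p) {b. P v b \<and> (\<forall>v\<in>B. P v b)} =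
      measure_pmf.prob (Pi_pmf (I v) d p) {b. P v b} *
      measure_pmf.prob (Pi_pmf (\<Union>v\<in>B. I v) d p) {b. \<forall>v\<in>B. P v b}"
    using disj 1 2 by (rule prob_Pi_pmf_union[where P = "P v" and Q = "\<lambda>b. \<forall>v\<in>B. P v b"])
  then show ?case using insert.hyps IH by simp
qed simp

lemma finite_set_Pi_pmf_bool: "finite A \<Longrightarrow> finite (set_pmf (Pi_pmf A False (p :: _ \<Rightarrow> bool pmf)))"
  by (simp add: set_Pi_pmf finite_PiE_dflt)

text \<open>Chernoff bound: the mean of \<open>z ^ card {x \<in> I. b x}\<close> is at most
  \<open>exp (\<mu> * (z - 1))\<close> by \<open>1 + x \<le> exp x\<close>. The factor
  \<open>exp (- \<mu>)\<close> is dropped at the end.\<close>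

lemma prob_bernoulli_count_ge:
  fixes q :: "'a \<Rightarrow> real"
  assumes "finite A" "I \<subseteq> A" "\<And>x. x \<in> A \<Longrightarrow> 0 \<le> q x \<and> q x \<le> 1"
    and "(\<Sum>x\<in>I. q x) \<le> \<mu>" "0 < \<mu>" "\<mu> \<le> real k"
  shows "measure_pmf.prob (Pi_pmf A False (\<lambda>x. bernoulli_pmf (q x))) {b. k \<le> card {x \<in> I. b x}}
    \<le> (exp 1 * \<mu> / real k) ^ k"
proof -
  define P where "P = Pi_pmf A False (\<lambda>x. bernoulli_pmf (q x))"
  \<comment> \<open>The minimiser of \<open>exp (\<mu> * (z - 1)) / z ^ k\<close>; it is at least 1
    because \<open>\<mu> \<le> k\<close>.\<close>
  define z where "z = real k / \<mu>"
  have k: "0 < real k" using assms by linarith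
  have z: "z \<ge> 1" using assms by (simp add: z_def)
  have int: "integrable (measure_pmf P) f" for f :: "_ \<Rightarrow> real"
    unfolding P_def by (rule integrable_measure_pmf_finite) (use assms finite_set_Pi_pmf_bool in auto)
  have fin: "finite I" using assms finite_subset by auto
  have pow: "(\<Prod>x\<in>A. if x \<in> I \<and> b x then z else 1) = z ^ card {x \<in> I. b x}" for b
  proof -
    have "(\<Prod>x\<in>A. if x \<in> I \<and> b x then z else 1) = (\<Prod>x\<in>{x\<in>A. x \<in> I \<and> b x}. z)"
      using assms(1) by (rule prod.inter_filter[symmetric])
    also have "{x\<in>A. x \<in> I \<and> b x} = {x\<in>I. b x}" using assms(2) by auto
    finally show ?thesis by simp
  qed
  have "measure_pmf.prob P {b. k \<le> card {x \<in> I. b x}} =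
      measure_pmf.expectation P (indicator {b. k \<le> card {x \<in> I. b x}})" by simp
  also have "\<dots> \<le> measure_pmf.expectation P (\<lambda>b. (\<Prod>x\<in>A. if x \<in> I \<and> b x then z else 1) / z ^ k)"
  proof (rule integral_mono[OF int int])
    fix b show "indicator {b. k \<le> card {x \<in> I. b x}} b \<le> (\<Prod>x\<in>A. if x \<in> I \<and> b x then z else 1) / z ^ k"
      unfolding pow using z by (auto simp: indicator_def power_increasing field_simps)
  qed
  also have "\<dots> = measure_pmf.expectation P (\<lambda>b. \<Prod>x\<in>A. if x \<in> I \<and> b x then z else 1) / z ^ k"
    by simp
  also have "measure_pmf.expectation P (\<lambda>b. \<Prod>x\<in>A. if x \<in> I \<and> b x then z else 1) =
     (\<Prod>x\<in>A. measure_pmf.expectation (bernoulli_pmf (q x)) (\<lambda>y. if x \<in> I \<and> y then z else 1))"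
    unfolding P_def
    by (rule expectation_prod_Pi_pmf[where f = "\<lambda>x y. if x \<in> I \<and> y then z else 1"])
       (use assms z in \<open>auto intro!: integrable_measure_pmf_finite\<close>)
  also have "\<dots> = (\<Prod>x\<in>A. if x \<in> I then 1 + q x * (z - 1) else 1)"
    by (rule prod.cong) (use assms in \<open>auto simp: algebra_simps\<close>)
  also have "\<dots> = (\<Prod>x\<in>I. 1 + q x * (z - 1))"
    using assms(1,2) by (simp add: prod.inter_restrict[symmetric] Int_absorb1)
  also have "\<dots> \<le> (\<Prod>x\<in>I. exp (q x * (z - 1)))"
    by (rule prod_mono) (use assms z in \<open>auto intro!: add_nonneg_nonneg mult_nonneg_nonneg\<close>)
  also have "\<dots> = exp ((\<Sum>x\<in>I. q x) * (z - 1))"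
    using fin by (simp add: exp_sum sum_distrib_right)
  also have "\<dots> \<le> exp (\<mu> * (z - 1))"
    using assms z by (simp add: mult_right_mono)
  also have "\<mu> * (z - 1) = real k - \<mu>" using assms by (simp add: z_def field_simps)
  also have "exp (real k - \<mu>) \<le> exp 1 ^ k"
    using assms by (simp add: exp_of_nat_mult[symmetric])
  also have "exp 1 ^ k / z ^ k = (exp 1 * \<mu> / real k) ^ k"
    by (simp add: z_def power_divide power_mult_distrib)
  finally show ?thesis using z by (simp add: P_def divide_right_mono)
qed

definition bernoulli_count :: "'a set \<Rightarrow> ('a \<Rightarrow> real) \<Rightarrow> nat pmf" where
  "bernoulli_count I q = map_pmf (\<lambda>b. card {x \<in> I. b x}) (Pi_pmf I False (\<lambda>x. bernoulli_pmf (q x)))"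

lemma bernoulli_count_insert:
  assumes "finite I" "x \<notin> I"
  shows "bernoulli_count (insert x I) q =
    bernoulli_pmf (q x) \<bind> (\<lambda>y. map_pmf (\<lambda>c. if y then Suc c else c) (bernoulli_count I q))"
proof -
  have "card {z \<in> insert x I. (f(x := y)) z} = (if y then Suc (card {z \<in> I. f z}) else card {z \<in> I. f z})" for f y
  proof -
    have "{z \<in> insert x I. (f(x := y)) z} = (if y then insert x {z \<in> I. f z} else {z \<in> I. f z})"
      using assms by auto
    then show ?thesis using assms by auto
  qed
  then show ?thesis
    unfolding bernoulli_count_def
    by (subst Pi_pmf_insert'[OF assms])
       (simp add: map_bind_pmf pmf.map_comp o_def map_pmf_def[symmetric])
qed

text \<open>Mean value estimate for powers; it controls the increment of
  \<open>y ^ k / fact k\<close> in the induction that follows.\<close>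

lemma power_diff_le:
  fixes x y :: real
  assumes "0 \<le> y" "y \<le> x"
  shows "x ^ Suc j - y ^ Suc j \<le> real (Suc j) * (x - y) * x ^ j"
proof -
  have "x ^ Suc j - y ^ Suc j = (x - y) * (\<Sum>p<Suc j. x ^ p * y ^ (j - p))"
    using power_diff_sumr2[of x "Suc j" y] by (simp only: diff_Suc_Suc mult.commute[of "y ^ _"])
  also have "\<dots> \<le> (x - y) * (\<Sum>p<Suc j. x ^ j)"
  proof (intro mult_left_mono sum_mono)
    fix p assume "p \<in> {..<Suc j}"
    then have "x ^ p * y ^ (j - p) \<le> x ^ p * x ^ (j - p)"
      using assms by (intro mult_left_mono power_mono) auto
    also have "\<dots> = x ^ j" using \<open>p \<in> _\<close> by (simp add: power_add[symmetric])
    finally show "x ^ p * y ^ (j - p) \<le> x ^ j" .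
  qed (use assms in auto)
  finally show ?thesis by (simp add: algebra_simps)
qed

text \<open>Poisson-type lower bound for exactly \<open>k\<close> successes. Choosing
  \<open>k\<close> distinct indices in order, each choice is barred from mass at most
  \<open>k * s\<close>, which leaves \<open>(m - k * s) ^ k / fact k\<close> with \<open>m\<close>
  the total mass; the failures contribute a factor of at least \<open>(1 - s) ^ card I\<close>. The
  proof is by induction on \<open>I\<close>, conditioning on the new coin, and the truncation at 0
  keeps the bound valid for small \<open>m\<close>.\<close>

lemma pmf_bernoulli_count_ge:
  fixes q :: "'a \<Rightarrow> real"
  assumes "finite I" "\<And>x. x \<in> I \<Longrightarrow> 0 \<le> q x \<and> q x \<le> s" "0 \<le> s" "s \<le> 1"
  shows "(1 - s) ^ card I * max 0 ((\<Sum>x\<in>I. q x) - real k * s) ^ k / fact k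
    \<le> pmf (bernoulli_count I q) k"
  using assms
proof (induction I arbitrary: k rule: finite_induct)
  case empty
  have "max 0 (- (real k * s)) = 0" using assms by simp
  then show ?case by (cases k) (simp_all add: bernoulli_count_def)
next
  case (insert x I)
  define m where "m = (\<Sum>x\<in>I. q x)"
  have qx: "0 \<le> q x" "q x \<le> s" "q x \<le> 1"
    using insert.prems(1)[of x] insert.prems(3) by auto
  have IH: "(1 - s) ^ card I * max 0 (m - real k * s) ^ k / fact k \<le> pmf (bernoulli_count I q) k" for k
    unfolding m_def by (rule insert.IH) (use insert.prems in auto)
  have sum: "(\<Sum>x\<in>insert x I. q x) = m + q x" using insert.hyps by (simp add: m_def)
  have rec: "pmf (bernoulli_count (insert x I) q) k =
      q x * pmf (map_pmf Suc (bernoulli_count I q)) k + (1 - q x) * pmf (bernoulli_count I q) k" for k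
    using qx by (simp add: bernoulli_count_insert[OF insert.hyps(1,2)] pmf_bind)
  have pos: "0 \<le> (1 - s) ^ card I" using insert.prems by simp
  show ?case
  proof (cases k)
    case 0
    have "(1 - s) * (1 - s) ^ card I \<le> (1 - q x) * pmf (bernoulli_count I q) 0"
      using IH[of 0] qx insert.prems pos by (intro mult_mono) auto
    moreover have "0 \<le> q x * pmf (map_pmf Suc (bernoulli_count I q)) 0" using qx by simp
    ultimately show ?thesis unfolding 0 rec using insert.hyps by simp
  next
    case (Suc j)
    \<comment> \<open>Truncated bases for the enlarged set at \<open>k\<close>, the old set at
      \<open>k\<close> and the old set at \<open>k - 1\<close>. One success fewer frees the mass
      \<open>s\<close>, which pays for \<open>q x \<le> s\<close>; hence
      \<open>u \<le> w\<close>.\<close>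
    define u where "u = max 0 (m + q x - real k * s)"
    define v where "v = max 0 (m - real k * s)"
    define w where "w = max 0 (m - real j * s)"
    have uvw: "0 \<le> v" "v \<le> u" "u \<le> w" "u - v \<le> q x"
      using qx by (auto simp: u_def v_def w_def Suc algebra_simps max_def)
    have "u ^ k - v ^ k \<le> real k * (u - v) * u ^ j"
      unfolding Suc by (rule power_diff_le) (use uvw in auto)
    also have "\<dots> \<le> real k * q x * w ^ j"
      using uvw qx by (intro mult_mono power_mono) auto
    finally have "u ^ k / fact k \<le> (v ^ k + real k * q x * w ^ j) / fact k"
      by (intro divide_right_mono) auto
    also have "\<dots> = v ^ k / fact k + q x * (w ^ j / fact j)"
      unfolding Suc by (simp add: field_simps del: of_nat_Suc)
    finally have key: "u ^ k / fact k \<le> v ^ k / fact k + q x * (w ^ j / fact j)" .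
    have "(1 - s) ^ card (insert x I) * u ^ k / fact k = (1 - s) * (1 - s) ^ card I * (u ^ k / fact k)"
      using insert.hyps by simp
    also have "\<dots> \<le> (1 - s) * (1 - s) ^ card I * (v ^ k / fact k + q x * (w ^ j / fact j))"
      using key insert.prems pos by (intro mult_left_mono) auto
    also have "\<dots> = (1 - s) * ((1 - s) ^ card I * v ^ k / fact k)
        + (1 - s) * (q x * ((1 - s) ^ card I * w ^ j / fact j))"
      by (simp add: distrib_left mult_ac)
    also have "\<dots> \<le> (1 - q x) * pmf (bernoulli_count I q) k + 1 * (q x * pmf (bernoulli_count I q) j)"
      using IH[of k] IH[of j] qx insert.prems pos uvw unfolding v_def w_def
      by (intro add_mono mult_mono mult_nonneg_nonneg divide_nonneg_nonneg) auto
    also have "\<dots> = pmf (bernoulli_count (insert x I) q) k"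
      unfolding rec Suc by (simp add: pmf_map_inj')
    finally show ?thesis unfolding sum u_def by simp
  qed
qed

text \<open>Disjoint index sets make the counts independent, and each is below \<open>k\<close> with
  probability at most \<open>1 - \<rho> \<le> exp (- \<rho>)\<close>.\<close>

lemma prob_all_bernoulli_count_less:
  fixes q :: "'a \<Rightarrow> real"
  assumes "finite A" "finite B" "\<And>v. v \<in> B \<Longrightarrow> I v \<subseteq> A" "disjoint_family_on I B"
    and "\<And>v. v \<in> B \<Longrightarrow> \<rho> \<le> pmf (bernoulli_count (I v) q) k"
  shows "measure_pmf.prob (Pi_pmf A False (\<lambda>x. bernoulli_pmf (q x)))
      {b. \<forall>v\<in>B. card {x \<in> I v. b x} < k} \<le> exp (- \<rho> * real (card B))"
proof -
  have fin: "finite (I v)" if "v \<in> B" for v using assms(1,3) that finite_subset by blast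
  have dep: "(card {x \<in> I v. b x} < k) = (card {x \<in> I v. b' x} < k)" 
    if "\<And>x. x \<in> I v \<Longrightarrow> b x = b' x" for v b b'
    using that by (auto cong: conj_cong)
  have "measure_pmf.prob (Pi_pmf A False (\<lambda>x. bernoulli_pmf (q x)))
      {b. \<forall>v\<in>B. card {x \<in> I v. b x} < k} =
    measure_pmf.prob (Pi_pmf (\<Union>v\<in>B. I v) False (\<lambda>x. bernoulli_pmf (q x)))
      {b. \<forall>v\<in>B. card {x \<in> I v. b x} < k}"
    by (rule prob_Pi_pmf_subset[OF assms(1)])
       (use assms(3) in \<open>auto intro!: ball_cong[OF refl] dep\<close>)
  also have "\<dots> = (\<Prod>v\<in>B. measure_pmf.prob (Pi_pmf (I v) False (\<lambda>x. bernoulli_pmf (q x))) {b. card {x \<in> I v. b x} < k})"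
    by (rule prob_Pi_pmf_Ball_disjoint[OF assms(2) fin assms(4)]) (assumption, rule dep, simp)
  also have "\<dots> \<le> (\<Prod>v\<in>B. exp (- \<rho>))"
  proof (rule prod_mono, intro conjI)
    fix v assume v: "v \<in> B"
    let ?P = "bernoulli_count (I v) q"
    have "measure_pmf.prob (Pi_pmf (I v) False (\<lambda>x. bernoulli_pmf (q x))) {b. card {x \<in> I v. b x} < k} =
       measure_pmf.prob ?P {..<k}"
      by (simp add: bernoulli_count_def vimage_def)
    also have "\<dots> \<le> measure_pmf.prob ?P (- {k})"
      by (rule measure_pmf.finite_measure_mono) auto
    also have "\<dots> = 1 - pmf ?P k"
      using measure_pmf.prob_compl[of "{k}" ?P] by (simp add: Compl_eq_Diff_UNIV measure_pmf_single)
    also have "\<dots> \<le> 1 - \<rho>" using assms(5)[OF v] by simp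
    also have "\<dots> \<le> exp (- \<rho>)" using exp_ge_add_one_self[of "- \<rho>"] by simp
    finally show "measure_pmf.prob (Pi_pmf (I v) False (\<lambda>x. bernoulli_pmf (q x))) {b. card {x \<in> I v. b x} < k} \<le> exp (- \<rho>)" .
  qed simp
  also have "\<dots> = exp (- \<rho> * real (card B))" by (simp add: exp_of_nat_mult[symmetric] mult.commute)
  finally show ?thesis .
qed


section \<open>Moments of the vertex process\<close>

abbreviation "chain_prob p n \<equiv> measure_pmf.prob (vertex_chain p n)"
abbreviation "chain_expectation p n \<equiv> measure_pmf.expectation (vertex_chain p n)"

lemma finite_set_vertex_chain: "finite (set_pmf (vertex_chain p n))"
proof (induction n)
  case (Suc n)
  have "finite (set_pmf (vertex_step (Suc n) b V))" if "(V, h) \<in> set_pmf (vertex_chain p n)" for V h b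
  proof -
    have "finite V" using vertex_chain_support[OF that] by (auto intro: finite_subset)
    then show ?thesis by (auto simp: vertex_step_def)
  qed
  moreover have "finite (set_pmf (bernoulli_pmf p))" by (rule finite)
  ultimately show ?case using Suc.IH by auto
qed simp

lemma integrable_vertex_chain [simp]: "integrable (measure_pmf (vertex_chain p n)) (f :: _ \<Rightarrow> real)"
  by (rule integrable_measure_pmf_finite[OF finite_set_vertex_chain])

lemma expectation_vertex_chain_mono:
  fixes f g :: "_ \<Rightarrow> real"
  assumes "\<And>V h. (V, h) \<in> set_pmf (vertex_chain p n) \<Longrightarrow> f (V, h) \<le> g (V, h)"
  shows "chain_expectation p n f \<le> chain_expectation p n g"
  by (rule integral_mono_AE) (use assms in \<open>auto simp: AE_measure_pmf_iff\<close>)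

lemma expectation_vertex_chain_cong:
  fixes f g :: "_ \<Rightarrow> real"
  assumes "\<And>V h. (V, h) \<in> set_pmf (vertex_chain p n) \<Longrightarrow> f (V, h) = g (V, h)"
  shows "chain_expectation p n f = chain_expectation p n g"
  by (rule integral_cong_AE) (use assms in \<open>auto simp: AE_measure_pmf_iff\<close>)

lemma expectation_bind_pmf_finite:
  fixes h :: "'b \<Rightarrow> real"
  assumes "finite (set_pmf p)" "\<And>x. x \<in> set_pmf p \<Longrightarrow> finite (set_pmf (f x))"
  shows "measure_pmf.expectation (p \<bind> f) h =
    measure_pmf.expectation p (\<lambda>x. measure_pmf.expectation (f x) h)"
proof -
  have "measure_pmf.expectation (p \<bind> f) h =
      (\<Sum>a\<in>set_pmf p. pmf p a *\<^sub>R measure_pmf.expectation (f a) h)"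
    by (rule pmf_expectation_bind) (use assms in auto)
  also have "\<dots> = measure_pmf.expectation p (\<lambda>x. measure_pmf.expectation (f x) h)"
    using assms(1) by (subst integral_measure_pmf[where A = "set_pmf p"]) auto
  finally show ?thesis .
qed

lemma expectation_vertex_chain_Suc:
  fixes f :: "_ \<Rightarrow> real"
  assumes "0 \<le> p" "p \<le> 1"
  shows "chain_expectation p (Suc n) f =
    chain_expectation p n (\<lambda>(V, h).
      p * f (insert (Suc n) V, h(Suc n := card (insert (Suc n) V))) +
      (1 - p) * (if V = {} then f ({}, h(Suc n := 0))
        else (\<Sum>v\<in>V. f (V - {v}, h(Suc n := card (V - {v})))) / real (card V)))"
    (is "_ = measure_pmf.expectation _ ?g")
proof -
  have fin: "finite V" if "(V, h) \<in> set_pmf (vertex_chain p n)" for V h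
    using vertex_chain_support[OF that] by (auto intro: finite_subset)
  have fin': "finite (set_pmf (vertex_step (Suc n) b V))" if "finite V" for V b
    using that by (auto simp: vertex_step_def)
  have "chain_expectation p (Suc n) f =
    chain_expectation p n (\<lambda>x. measure_pmf.expectation (case x of (V, h) \<Rightarrow>
      bernoulli_pmf p \<bind> (\<lambda>b. map_pmf (\<lambda>V'. (V', h(Suc n := card V'))) (vertex_step (Suc n) b V))) f)"
    unfolding vertex_chain.simps
    by (rule expectation_bind_pmf_finite) (use finite_set_vertex_chain fin fin' in auto)
  also have "\<dots> = chain_expectation p n ?g"
  proof (rule expectation_vertex_chain_cong)
    fix V h assume "(V, h) \<in> set_pmf (vertex_chain p n)"
    then have V: "finite V" by (rule fin)
    have "measure_pmf.expectation (bernoulli_pmf p \<bind> (\<lambda>b. map_pmf (\<lambda>V'. (V', h(Suc n := card V'))) (vertex_step (Suc n) b V))) f =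
      measure_pmf.expectation (bernoulli_pmf p) (\<lambda>b. measure_pmf.expectation (vertex_step (Suc n) b V) (\<lambda>V'. f (V', h(Suc n := card V'))))"
      by (subst expectation_bind_pmf_finite) (use fin'[OF V] in auto)
    also have "\<dots> = ?g (V, h)"
      using assms V by (auto simp: vertex_step_def integral_pmf_of_set)
    finally show "measure_pmf.expectation (case (V, h) of (V, h) \<Rightarrow>
      bernoulli_pmf p \<bind> (\<lambda>b. map_pmf (\<lambda>V'. (V', h(Suc n := card V'))) (vertex_step (Suc n) b V))) f = ?g (V, h)"
      by simp
  qed
  finally show ?thesis .
qed

text \<open>After step \<open>j\<close> the entry \<open>h j\<close> is never overwritten, so its
  law is that of \<open>card V\<close> at time \<open>j\<close>.\<close>

lemma expectation_vertex_chain_past: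
  fixes g :: "nat \<Rightarrow> real"
  assumes "0 \<le> p" "p \<le> 1" "j \<le> n"
  shows "chain_expectation p n (\<lambda>(V, h). g (h j)) =
    chain_expectation p j (\<lambda>(V, h). g (card V))"
  using assms(3)
proof (induction n)
  case 0
  then show ?case by simp
next
  case (Suc n)
  show ?case
  proof (cases "j = Suc n")
    case True
    show ?thesis unfolding True
      by (rule expectation_vertex_chain_cong) (use vertex_chain_support in \<open>auto simp del: vertex_chain.simps\<close>)
  next
    case False
    have "chain_expectation p (Suc n) (\<lambda>(V, h). g (h j)) =
        chain_expectation p n (\<lambda>(V, h). g (h j))"
      unfolding expectation_vertex_chain_Suc[OF assms(1,2)]
    proof (rule expectation_vertex_chain_cong)
      fix V h assume "(V, h) \<in> set_pmf (vertex_chain p n)"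
      then have "finite V" using vertex_chain_support by (metis finite_atLeastAtMost finite_subset)
      then show "(case (V, h) of (V, h) \<Rightarrow>
        p * (case (insert (Suc n) V, h(Suc n := card (insert (Suc n) V))) of (V, h) \<Rightarrow> g (h j)) +
        (1 - p) * (if V = {} then case ({}, h(Suc n := 0)) of (V, h) \<Rightarrow> g (h j)
         else (\<Sum>v\<in>V. case (V - {v}, h(Suc n := card (V - {v}))) of (V, h) \<Rightarrow> g (h j)) / real (card V))) =
         (case (V, h) of (V, h) \<Rightarrow> g (h j))"
        using False by (auto simp: algebra_simps)
    qed
    then show ?thesis using Suc False by simp
  qed
qed

text \<open>Replaces conditional expectations: a one-step estimate for every admissible
  \<open>V\<close> becomes a recursive inequality between expectations.\<close>

lemma expectation_vertex_chain_Suc_le: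
  fixes f g :: "nat set \<Rightarrow> real"
  assumes p: "0 \<le> p" "p \<le> 1"
    and step: "\<And>V. V \<subseteq> {1..n} \<Longrightarrow> finite V \<Longrightarrow> Suc n \<notin> V \<Longrightarrow> p * f (insert (Suc n) V) +
      (1 - p) * (if V = {} then f V else (\<Sum>v\<in>V. f (V - {v})) / real (card V)) \<le> g V"
  shows "chain_expectation p (Suc n) (\<lambda>s. f (fst s)) \<le>
    chain_expectation p n (\<lambda>s. g (fst s))"
  unfolding expectation_vertex_chain_Suc[OF p]
proof (rule expectation_vertex_chain_mono)
  fix V h assume "(V, h) \<in> set_pmf (vertex_chain p n)"
  then have V: "V \<subseteq> {1..n}" using vertex_chain_support by blast
  then have "finite V" "Suc n \<notin> V" by (auto intro: finite_subset)
  then show "(case (V, h) of (V, h) \<Rightarrow>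
      p * f (fst (insert (Suc n) V, h(Suc n := card (insert (Suc n) V)))) +
      (1 - p) * (if V = {} then f (fst ({}, h(Suc n := 0)))
        else (\<Sum>v\<in>V. f (fst (V - {v}, h(Suc n := card (V - {v}))))) / real (card V)))
      \<le> g (fst (V, h))"
    using step[OF V] by (cases "V = {}") auto
qed

text \<open>The number of vertices is a random walk with drift \<open>d = 2 * p - 1\<close>,
  reflected at 0. The mean of its centred square grows by at most 4 per step, since the cross term
  is zero or favourable.\<close>

lemma expectation_card_sq:
  assumes "1 / 2 < p" "p \<le> 1"
  shows "chain_expectation p n
    (\<lambda>s. (real (card (fst s)) - (2 * p - 1) * real n)\<^sup>2) \<le> 4 * real n"
proof (induction n)
  case (Suc n)
  define d where "d = 2 * p - 1"
  have d: "0 < d" "d \<le> 1" using assms by (auto simp: d_def)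
  have p: "0 \<le> p" using assms by simp
  have var: "p * (1 - d)\<^sup>2 + (1 - p) * (1 + d)\<^sup>2 \<le> 4" "p * (1 - d)\<^sup>2 + (1 - p) * d\<^sup>2 \<le> 4"
  proof -
    have "(1 - d)\<^sup>2 \<le> 1\<^sup>2" "(1 + d)\<^sup>2 \<le> 2\<^sup>2" "d\<^sup>2 \<le> 1\<^sup>2" by (rule power_mono; use d in simp)+
    then have sq: "(1 - d)\<^sup>2 \<le> 4" "(1 + d)\<^sup>2 \<le> 4" "d\<^sup>2 \<le> 4" by simp_all
    have "p * (1 - d)\<^sup>2 \<le> p * 4" by (rule mult_left_mono[OF sq(1)]) (use assms in simp)
    moreover have "(1 - p) * (1 + d)\<^sup>2 \<le> (1 - p) * 4"
      by (rule mult_left_mono[OF sq(2)]) (use assms in simp)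
    moreover have "(1 - p) * d\<^sup>2 \<le> (1 - p) * 4"
      by (rule mult_left_mono[OF sq(3)]) (use assms in simp)
    ultimately show "p * (1 - d)\<^sup>2 + (1 - p) * (1 + d)\<^sup>2 \<le> 4" "p * (1 - d)\<^sup>2 + (1 - p) * d\<^sup>2 \<le> 4"
      by (auto simp: algebra_simps)
  qed
  have "chain_expectation p (Suc n) (\<lambda>s. (real (card (fst s)) - d * real (Suc n))\<^sup>2)
    \<le> chain_expectation p n (\<lambda>s. (real (card (fst s)) - d * real n)\<^sup>2 + 4)"
  proof (rule expectation_vertex_chain_Suc_le[OF p assms(2)])
    fix V :: "nat set" assume V: "finite V" "Suc n \<notin> V"
    define y where "y = real (card V) - d * real n"
    have add: "real (card (insert (Suc n) V)) - d * real (Suc n) = y + 1 - d"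
      using V by (simp add: y_def algebra_simps)
    show "p * (real (card (insert (Suc n) V)) - d * real (Suc n))\<^sup>2 +
      (1 - p) * (if V = {} then (real (card V) - d * real (Suc n))\<^sup>2
        else (\<Sum>v\<in>V. (real (card (V - {v})) - d * real (Suc n))\<^sup>2) / real (card V))
      \<le> (real (card V) - d * real n)\<^sup>2 + 4"
    proof (cases "V = {}")
      case True
      \<comment> \<open>From the empty set the centred drift is \<open>p - d \<ge> 0\<close> instead
        of 0, but \<open>y\<close> is nonpositive there, so the cross term only lowers the
        square.\<close>
      have y: "y \<le> 0" using d True by (simp add: y_def)
      have "p * (y + 1 - d)\<^sup>2 + (1 - p) * (y - d)\<^sup>2 = y\<^sup>2 + 2 * y * (p - d) + (p * (1 - d)\<^sup>2 + (1 - p) * d\<^sup>2)"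
        by (simp add: power2_eq_square algebra_simps)
      moreover have "2 * y * (p - d) \<le> 0"
        using y assms by (simp add: d_def mult_nonpos_nonneg)
      moreover have "real (card V) - d * real (Suc n) = y - d" by (simp add: y_def algebra_simps)
      ultimately show ?thesis unfolding add y_def[symmetric] using True var by simp
    next
      case False
      then have c: "real (card V) > 0" using V by (simp add: card_gt_0_iff)
      have rem: "real (card (V - {v})) - d * real (Suc n) = y - 1 - d" if "v \<in> V" for v
      proof -
        have "real (card V) = real (card (V - {v})) + 1"
          using V that by (metis card.remove of_nat_Suc add.commute)
        then show ?thesis by (simp add: y_def algebra_simps)
      qed
      have "p * (y + 1 - d)\<^sup>2 + (1 - p) * (y - 1 - d)\<^sup>2 =
          y\<^sup>2 + 2 * y * (2 * p - 1 - d) + (p * (1 - d)\<^sup>2 + (1 - p) * (1 + d)\<^sup>2)"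
        by (simp add: power2_eq_square algebra_simps)
      then have "p * (y + 1 - d)\<^sup>2 + (1 - p) * (y - 1 - d)\<^sup>2 \<le> y\<^sup>2 + 4"
        using var by (simp add: d_def)
      moreover have "(\<Sum>v\<in>V. (real (card (V - {v})) - d * real (Suc n))\<^sup>2) / real (card V) = (y - 1 - d)\<^sup>2"
      proof -
        have "(\<Sum>v\<in>V. (real (card (V - {v})) - d * real (Suc n))\<^sup>2) = (\<Sum>v\<in>V. (y - 1 - d)\<^sup>2)"
          by (rule sum.cong[OF refl]) (simp only: rem)
        then show ?thesis using c by simp
      qed
      ultimately show ?thesis unfolding add y_def[symmetric] using False by simp
    qed
  qed
  also have "\<dots> = chain_expectation p n (\<lambda>s. (real (card (fst s)) - d * real n)\<^sup>2) + 4"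
    by (subst Bochner_Integration.integral_add) auto
  finally show ?case using Suc.IH by (simp add: d_def)
qed simp

text \<open>Asymptotically of order \<open>(m / n) powr g\<close>. With
  \<open>g = (1 - p) / d\<close> it is the limiting fraction of survivors; with
  \<open>g = 1 - p\<close> it bounds the survival probability of a single vertex.\<close>

definition survival :: "real \<Rightarrow> nat \<Rightarrow> nat \<Rightarrow> real" where
  "survival g m n = (\<Prod>j\<in>{m..<n}. 1 - g / real j)"

lemma survival_same [simp]: "survival g m m = 1"
  by (simp add: survival_def)

lemma survival_Suc: "m \<le> n \<Longrightarrow> survival g m (Suc n) = survival g m n * (1 - g / real n)"
  by (simp add: survival_def)

lemma survival_Suc_left: "m < n \<Longrightarrow> survival g m n = (1 - g / real m) * survival g (Suc m) n"
  by (simp add: survival_def prod.atLeast_Suc_lessThan)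

lemma survival_bounds:
  assumes "0 \<le> g" "g \<le> real m" "0 < m"
  shows "0 \<le> survival g m n" "survival g m n \<le> 1"
proof -
  have "0 \<le> 1 - g / real j \<and> 1 - g / real j \<le> 1" if "j \<ge> m" for j
  proof -
    have "g \<le> real j" "0 < real j" using assms that by linarith+
    then show ?thesis using assms by simp
  qed
  then show "0 \<le> survival g m n" "survival g m n \<le> 1"
    unfolding survival_def by (auto intro!: prod_nonneg prod_le_1)
qed

text \<open>A given vertex is removed at the next step with probability
  \<open>(1 - p) / card V\<close>, and \<open>card V \<le> n\<close> always holds. The exponent is
  cruder than \<open>(1 - p) / d\<close>, but the bound covers every birth time from 1 on and rests
  on no concentration of \<open>card V\<close>.\<close>

lemma prob_mem_vertex_chain:
  assumes "0 \<le> p" "p \<le> 1" "1 \<le> w" "w \<le> n"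
  shows "chain_expectation p n (\<lambda>s. of_bool (w \<in> fst s)) \<le> survival (1 - p) w n"
  using assms(4)
proof (induction rule: dec_induct)
  case base
  have "chain_expectation p w (\<lambda>s. of_bool (w \<in> fst s) :: real) \<le>
      chain_expectation p w (\<lambda>s. 1)"
    by (rule expectation_vertex_chain_mono) simp
  then show ?case by simp
next
  case (step n)
  have n: "0 < n" using step assms by simp
  have "chain_expectation p (Suc n) (\<lambda>s. of_bool (w \<in> fst s) :: real) \<le>
    chain_expectation p n (\<lambda>s. (1 - (1 - p) / real n) * of_bool (w \<in> fst s))"
  proof (rule expectation_vertex_chain_Suc_le[OF assms(1,2)])
    fix V assume V: "V \<subseteq> {1..n}" "finite V" "Suc n \<notin> V"
    have ne: "w \<noteq> Suc n" using step by simp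
    show "p * of_bool (w \<in> insert (Suc n) V) + (1 - p) * (if V = {} then of_bool (w \<in> V)
        else (\<Sum>v\<in>V. of_bool (w \<in> V - {v})) / real (card V)) \<le> (1 - (1 - p) / real n) * of_bool (w \<in> V)"
    proof (cases "w \<in> V")
      case True
      have c: "card V \<le> n" "0 < card V"
        using card_mono[OF _ V(1)] True V(2) by (auto simp: card_gt_0_iff)
      have "(\<Sum>v\<in>V. of_bool (w \<in> V - {v}) :: real) = real (card (V - {w}))"
      proof -
        have "(\<Sum>v\<in>V - {w}. of_bool (w \<in> V - {v}) :: real) = (\<Sum>v\<in>V - {w}. 1)"
          by (rule sum.cong[OF refl]) (use True in auto)
        then show ?thesis unfolding sum.remove[OF V(2) True] by simp
      qed
      also have "\<dots> = real (card V) - 1" using True V(2) c by (simp add: card_Diff_singleton)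
      finally have "(\<Sum>v\<in>V. of_bool (w \<in> V - {v}) :: real) / real (card V) = 1 - 1 / real (card V)"
        using c by (simp add: field_simps)
      moreover have "1 / real n \<le> 1 / real (card V)" using c by (simp add: frac_le)
      then have "(1 - p) * (1 - 1 / real (card V)) \<le> (1 - p) * (1 - 1 / real n)"
        using assms by (intro mult_left_mono) auto
      ultimately have "(1 - p) * ((\<Sum>v\<in>V. of_bool (w \<in> V - {v})) / real (card V)) \<le> (1 - p) * (1 - 1 / real n)"
        by (simp only:)
      also have "\<dots> = (1 - (1 - p) / real n) - p" by (simp add: right_diff_distrib)
      finally have "p + (1 - p) * ((\<Sum>v\<in>V. of_bool (w \<in> V - {v})) / real (card V)) \<le> 1 - (1 - p) / real n"
        by linarith
      moreover have "V \<noteq> {}" "w \<in> insert (Suc n) V" using True by auto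
      ultimately show ?thesis using True by (simp only: if_False of_bool_eq mult_1_right)
    next
      case False
      then show ?thesis using ne by (auto intro!: sum.neutral)
    qed
  qed
  also have "\<dots> = (1 - (1 - p) / real n) * chain_expectation p n (\<lambda>s. of_bool (w \<in> fst s))"
    by simp
  also have "\<dots> \<le> (1 - (1 - p) / real n) * survival (1 - p) w n"
    using step.IH assms n by (intro mult_left_mono) (auto simp: divide_le_eq)
  finally show ?case using step by (simp add: survival_Suc mult.commute)
qed

text \<open>First moment from the second through
  \<open>\<bar>y\<bar> \<le> r / 2 + y\<^sup>2 / (2 * r)\<close> with
  \<open>r = sqrt n\<close>.\<close>

lemma expectation_abs_card:
  assumes "1 / 2 < p" "p \<le> 1" "j \<le> n" "0 < n"
  shows "chain_expectation p j
    (\<lambda>s. \<bar>real (card (fst s)) - (2 * p - 1) * real j\<bar>) \<le> 5 / 2 * sqrt (real n)"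
proof -
  define r where "r = sqrt (real n)"
  have r: "0 < r" "r * r = real n" using assms by (simp_all add: r_def)
  define y where "y s = real (card (fst s)) - (2 * p - 1) * real j" for s :: "nat set \<times> (nat \<Rightarrow> nat)"
  have "chain_expectation p j (\<lambda>s. \<bar>y s\<bar>) \<le>
    chain_expectation p j (\<lambda>s. r / 2 + (y s)\<^sup>2 * (1 / (2 * r)))"
  proof (rule expectation_vertex_chain_mono)
    fix V h
    have "2 * r * \<bar>y (V, h)\<bar> \<le> r\<^sup>2 + \<bar>y (V, h)\<bar>\<^sup>2"
      using sum_squares_bound[of r "\<bar>y (V, h)\<bar>"] by simp
    then show "\<bar>y (V, h)\<bar> \<le> r / 2 + (y (V, h))\<^sup>2 * (1 / (2 * r))"
      using r by (simp add: field_simps power2_eq_square)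
  qed
  also have "\<dots> = r / 2 + chain_expectation p j (\<lambda>s. (y s)\<^sup>2) * (1 / (2 * r))"
    by simp
  also have "\<dots> \<le> r / 2 + (4 * real j) * (1 / (2 * r))"
    using expectation_card_sq[OF assms(1,2), of j] r unfolding y_def
    by (intro add_left_mono mult_right_mono) auto
  also have "\<dots> \<le> r / 2 + (4 * (r * r)) * (1 / (2 * r))"
    using r assms by (intro add_left_mono mult_right_mono) auto
  also have "\<dots> = 5 / 2 * r" using r by (simp add: field_simps)
  finally show ?thesis by (simp add: y_def r_def)
qed

text \<open>Replacing \<open>1 / N\<close> by \<open>1 / (d j)\<close> in the drift costs only \<open>\<bar>N - d j\<bar> / d\<close>, because the number
  \<open>A\<close> of survivors is at most \<open>N\<close> and the deviation \<open>A - a\<close> is at most \<open>j\<close>.\<close>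

lemma survivors_step:
  fixes p d A N a j :: real
  assumes "1 / 2 < p" "p \<le> 1" "d = 2 * p - 1" "0 \<le> A" "A \<le> N" "A \<le> j" "0 \<le> a" "a \<le> d * j" "0 < j"
    and a': "a' = a * (1 - (1 - p) / d / j)"
  shows "p * (A - a')\<^sup>2 + (1 - p) * (if N = 0 then (A - a')\<^sup>2
      else ((N - A) * (A - a')\<^sup>2 + A * (A - 1 - a')\<^sup>2) / N) \<le> (A - a)\<^sup>2 + (1 + \<bar>N - d * j\<bar> / d)"
proof -
  define y where "y = A - a"
  \<comment> \<open>\<open>g\<close> is the one-step decrease of the target \<open>a\<close>, and
    \<open>k\<close> is the probability that one of the \<open>A\<close> survivors is removed; the
    centred variable has drift \<open>g - k\<close>.\<close>
  define g where "g = (1 - p) * a / (d * j)"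
  define k where "k = (if N = 0 then 0 else (1 - p) * (A / N))"
  have d: "0 < d" "d \<le> 1" using assms by auto
  have dj: "0 < d * j" "d * j \<le> j" using d assms by (auto simp: mult_left_le_one_le)
  have a'_eq: "A - a' = y + g" "A - 1 - a' = y + g - 1"
    using d assms by (simp_all add: a' y_def g_def field_simps)
  have frac: "0 \<le> A / N" "A / N \<le> 1" using assms by (auto simp: divide_le_eq)
  have ag: "0 \<le> a / (d * j)" "a / (d * j) \<le> 1" using assms dj by (auto simp: divide_le_eq)
  have g: "0 \<le> g" "g \<le> 1" unfolding g_def
    using ag assms mult_mono[of "1 - p" 1 "a / (d * j)" 1] by auto
  have k: "0 \<le> k" "k \<le> 1" unfolding k_def
    using frac assms mult_mono[of "1 - p" 1 "A / N" 1] by auto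
  have "p * (A - a')\<^sup>2 + (1 - p) * (if N = 0 then (A - a')\<^sup>2
      else ((N - A) * (A - a')\<^sup>2 + A * (A - 1 - a')\<^sup>2) / N) = y\<^sup>2 + 2 * y * (g - k) + (g\<^sup>2 - 2 * k * g + k)"
  proof (cases "N = 0")
    case True
    then show ?thesis unfolding a'_eq k_def by (simp add: power2_eq_square algebra_simps)
  next
    case False
    have "((N - A) * (y + g)\<^sup>2 + A * (y + g - 1)\<^sup>2) / N = (1 - A / N) * (y + g)\<^sup>2 + A / N * (y + g - 1)\<^sup>2"
      using False by (simp add: field_simps)
    moreover have "p * (y + g)\<^sup>2 + (1 - p) * ((1 - r) * (y + g)\<^sup>2 + r * (y + g - 1)\<^sup>2) =
        y\<^sup>2 + 2 * y * (g - (1 - p) * r) + (g\<^sup>2 - 2 * ((1 - p) * r) * g + (1 - p) * r)" for r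
      by (simp add: power2_eq_square algebra_simps)
    ultimately show ?thesis unfolding a'_eq k_def using False by (simp only: if_False)
  qed
  also have "g\<^sup>2 - 2 * k * g + k \<le> 1"
  proof -
    have "g * (g - 1) \<le> 0" using g by (simp add: mult_nonneg_nonpos)
    moreover have "(1 - 2 * k) * g + k \<le> 1"
    proof -
      have "(1 - k) * (1 - g) \<ge> 0" "k * g \<ge> 0" using g k by simp_all
      then show ?thesis by (simp add: algebra_simps)
    qed
    ultimately show ?thesis by (simp add: power2_eq_square algebra_simps)
  qed
  also have "2 * y * (g - k) \<le> \<bar>N - d * j\<bar> / d"
  proof -
    \<comment> \<open>The drift splits into a restoring part \<open>- y / (d * j)\<close>, whose
      nonpositive contribution is dropped, and the error of replacing \<open>N\<close> by
      \<open>d * j\<close>. The factor \<open>1 / 2\<close> below comes from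
      \<open>1 - p \<le> 1 / 2\<close>.\<close>
    have gk: "g - k = (1 - p) * (- y / (d * j) + (if N = 0 then 0 else A / N) * (N - d * j) / (d * j))"
      using d assms by (auto simp: g_def k_def y_def field_simps)
    have "\<bar>y\<bar> \<le> j" using assms dj by (auto simp: y_def)
    have "2 * y * (g - k) = (1 - p) * (- (2 * y\<^sup>2 / (d * j)) + 2 * y * ((if N = 0 then 0 else A / N) * (N - d * j) / (d * j)))"
      unfolding gk by (simp add: power2_eq_square algebra_simps)
    also have "\<dots> \<le> (1 - p) * (2 * \<bar>y\<bar> * (1 * \<bar>N - d * j\<bar> / (d * j)))"
    proof (rule mult_left_mono)
      have "2 * y * ((if N = 0 then 0 else A / N) * (N - d * j) / (d * j)) \<le>
          \<bar>2 * y * ((if N = 0 then 0 else A / N) * (N - d * j) / (d * j))\<bar>" by (rule abs_ge_self)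
      also have "\<dots> = 2 * \<bar>y\<bar> * ((if N = 0 then 0 else A / N) * \<bar>N - d * j\<bar> / (d * j))"
        using dj frac d assms by (simp add: abs_mult)
      also have "\<dots> \<le> 2 * \<bar>y\<bar> * (1 * \<bar>N - d * j\<bar> / (d * j))"
        using dj frac by (intro mult_left_mono divide_right_mono mult_right_mono) auto
      finally show "- (2 * y\<^sup>2 / (d * j)) + 2 * y * ((if N = 0 then 0 else A / N) * (N - d * j) / (d * j))
          \<le> 2 * \<bar>y\<bar> * (1 * \<bar>N - d * j\<bar> / (d * j))"
        using dj by (smt (verit) divide_nonneg_pos zero_le_power2)
    qed (use assms in simp)
    also have "\<dots> \<le> (1 / 2) * (2 * j * (1 * \<bar>N - d * j\<bar> / (d * j)))"
      using \<open>\<bar>y\<bar> \<le> j\<close> assms dj by (intro mult_mono) auto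
    also have "\<dots> = \<bar>N - d * j\<bar> / d" using assms d by simp
    finally show ?thesis .
  qed
  finally show ?thesis by (simp add: y_def)
qed

lemma sum_card_Diff_atMost:
  fixes F :: "nat \<Rightarrow> real"
  assumes "finite V"
  shows "(\<Sum>v\<in>V. F (card ((V - {v}) \<inter> {..m}))) =
    (real (card V) - real (card (V \<inter> {..m}))) * F (card (V \<inter> {..m})) +
     real (card (V \<inter> {..m})) * F (card (V \<inter> {..m}) - 1)"
proof -
  have "(\<Sum>v\<in>V. F (card ((V - {v}) \<inter> {..m}))) =
     (\<Sum>v\<in>V. if v \<le> m then F (card (V \<inter> {..m}) - 1) else F (card (V \<inter> {..m})))"
  proof (rule sum.cong[OF refl])
    fix v assume v: "v \<in> V"
    have "(V - {v}) \<inter> {..m} = (if v \<le> m then V \<inter> {..m} - {v} else V \<inter> {..m})" by auto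
    then show "F (card ((V - {v}) \<inter> {..m})) = (if v \<le> m then F (card (V \<inter> {..m}) - 1) else F (card (V \<inter> {..m})))"
      using v assms by (simp add: card_Diff_singleton)
  qed
  also have "\<dots> = real (card {v\<in>V. v \<le> m}) * F (card (V \<inter> {..m}) - 1) + real (card {v\<in>V. \<not> v \<le> m}) * F (card (V \<inter> {..m}))"
    using assms by (simp add: sum.If_cases Int_def)
  also have "{v\<in>V. v \<le> m} = V \<inter> {..m}" by auto
  also have "{v\<in>V. \<not> v \<le> m} = V - V \<inter> {..m}" by auto
  also have "real (card (V - V \<inter> {..m})) = real (card V) - real (card (V \<inter> {..m}))"
    using assms by (subst card_Diff_subset) (auto intro!: of_nat_diff card_mono)
  finally show ?thesis by simp
qed

text \<open>The mean square error is at most \<open>4 * m\<close> at time \<open>m\<close>, and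
  every later step adds \<open>1 + \<bar>N - d * j\<bar> / d\<close>, whose mean is
  \<open>O(sqrt n)\<close>. The total is of order \<open>n powr (3 / 2)\<close>, negligible against
  the square of a count of order \<open>n\<close>.\<close>

lemma expectation_survivors_sq:
  assumes p: "1 / 2 < p" "p \<le> 1" and d: "d = 2 * p - 1"
    and m: "0 < m" "(1 - p) / d \<le> real m" "m \<le> n"
  shows "chain_expectation p n
    (\<lambda>s. (real (card (fst s \<inter> {..m})) - d * real m * survival ((1 - p) / d) m n)\<^sup>2) \<le> 8 / d * (real n * sqrt (real n))"
proof -
  define a where "a j = d * real m * survival ((1 - p) / d) m j" for j
  define u where "u j = chain_expectation p j
    (\<lambda>s. (real (card (fst s \<inter> {..m})) - a j)\<^sup>2)" for j
  define c where "c = 1 + 5 / 2 * sqrt (real n) / d"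
  have d01: "0 < d" "d \<le> 1" using p d by auto
  have n: "0 < n" using m by simp
  have sb: "0 \<le> survival ((1 - p) / d) m j" "survival ((1 - p) / d) m j \<le> 1" for j
    using survival_bounds[of "(1 - p) / d" m j] m p d01 by auto
  have "u j \<le> 4 * real m + real (j - m) * c" if "m \<le> j" "j \<le> n" for j
    using that
  proof (induction j rule: dec_induct)
    case base
    have "u m = chain_expectation p m (\<lambda>s. (real (card (fst s)) - (2 * p - 1) * real m)\<^sup>2)"
      unfolding u_def
    proof (rule expectation_vertex_chain_cong)
      fix V h assume "(V, h) \<in> set_pmf (vertex_chain p m)"
      then have "V \<subseteq> {1..m}" using vertex_chain_support by blast
      then have "V \<inter> {..m} = V" by auto
      then show "(real (card (fst (V, h) \<inter> {..m})) - a m)\<^sup>2 = (real (card (fst (V, h))) - (2 * p - 1) * real m)\<^sup>2"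
        by (simp add: a_def d)
    qed
    then show ?case using expectation_card_sq[OF p, of m] by simp
  next
    case (step j)
    have j: "0 < j" using step m by simp
    have p0: "0 \<le> p" using p by simp
    have "u (Suc j) \<le> chain_expectation p j
      (\<lambda>s. (real (card (fst s \<inter> {..m})) - a j)\<^sup>2 + (1 + \<bar>real (card (fst s)) - d * real j\<bar> / d))"
      unfolding u_def
    proof (rule expectation_vertex_chain_Suc_le[OF p0 p(2)])
      fix V assume V: "V \<subseteq> {1..j}" "finite V" "Suc j \<notin> V"
      let ?A = "card (V \<inter> {..m})"
      have ins: "insert (Suc j) V \<inter> {..m} = V \<inter> {..m}" using step by auto
      have A: "?A \<le> card V" using V by (intro card_mono) auto
      have cV: "card V \<le> j" using card_mono[OF _ V(1)] by simp
      have sum: "(\<Sum>v\<in>V. (real (card ((V - {v}) \<inter> {..m})) - a (Suc j))\<^sup>2) =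
        (real (card V) - real ?A) * (real ?A - a (Suc j))\<^sup>2 + real ?A * (real ?A - 1 - a (Suc j))\<^sup>2"
        using sum_card_Diff_atMost[OF V(2), of "\<lambda>x. (real x - a (Suc j))\<^sup>2" m]
        by (cases "?A") simp_all
      have aj: "0 \<le> a j" "a j \<le> d * real j"
      proof -
        show "0 \<le> a j" using d01 sb by (simp add: a_def)
        have "a j \<le> d * real m * 1" unfolding a_def using d01 sb by (intro mult_left_mono) auto
        also have "\<dots> \<le> d * real j" using d01 step by simp
        finally show "a j \<le> d * real j" .
      qed
      have aS: "a (Suc j) = a j * (1 - (1 - p) / d / real j)"
        using step by (simp add: a_def survival_Suc)
      have "p * (real ?A - a (Suc j))\<^sup>2 + (1 - p) * (if real (card V) = 0 then (real ?A - a (Suc j))\<^sup>2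
        else ((real (card V) - real ?A) * (real ?A - a (Suc j))\<^sup>2 + real ?A * (real ?A - 1 - a (Suc j))\<^sup>2) / real (card V))
        \<le> (real ?A - a j)\<^sup>2 + (1 + \<bar>real (card V) - d * real j\<bar> / d)"
        by (rule survivors_step[OF p d]) (use A cV aj j aS in auto)
      then show "p * (real (card (insert (Suc j) V \<inter> {..m})) - a (Suc j))\<^sup>2 +
         (1 - p) * (if V = {} then (real ?A - a (Suc j))\<^sup>2
           else (\<Sum>v\<in>V. (real (card ((V - {v}) \<inter> {..m})) - a (Suc j))\<^sup>2) / real (card V))
         \<le> (real ?A - a j)\<^sup>2 + (1 + \<bar>real (card V) - d * real j\<bar> / d)"
        unfolding ins sum using V(2) by simp
    qed
    also have "\<dots> = u j + (1 + chain_expectation p j (\<lambda>s. \<bar>real (card (fst s)) - d * real j\<bar>) / d)"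
      by (simp add: u_def)
    also have "\<dots> \<le> u j + c"
      using expectation_abs_card[OF p _ n, of j] step d01 unfolding c_def d
      by (intro add_left_mono divide_right_mono) auto
    finally show ?case using step by (simp add: Suc_diff_le algebra_simps)
  qed
  from this[of n] have "u n \<le> 4 * real m + real (n - m) * c" using m by simp
  also have "\<dots> \<le> 4 * real n + real n * c"
    using m d01 by (intro add_mono mult_mono) (auto simp: c_def)
  also have "\<dots> = 5 * (real n * 1) + 5 / 2 / d * (real n * sqrt (real n))"
    by (simp add: c_def algebra_simps)
  also have "\<dots> \<le> 5 / d * (real n * sqrt (real n)) + 5 / 2 / d * (real n * sqrt (real n))"
    using d01 n by (intro add_right_mono mult_mono) (auto simp: field_simps)
  also have "\<dots> \<le> 8 / d * (real n * sqrt (real n))"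
    using d01 by (simp add: field_simps)
  finally show ?thesis by (simp add: u_def a_def)
qed


section \<open>Uniform control of the vertex process\<close>

lemma exp_le_one_minus:
  fixes x :: real
  assumes "0 \<le> x" "x \<le> 1 / 2"
  shows "exp (- 2 * x) \<le> 1 - x"
proof -
  have "x * x \<le> (1 / 2) * x" using assms by (intro mult_right_mono) auto
  then have "- 2 * x \<le> ln (1 - x)"
    using ln_one_minus_pos_lower_bound[of x] assms by (simp add: power2_eq_square)
  then have "exp (- 2 * x) \<le> exp (ln (1 - x))" by (simp only: exp_le_cancel_iff)
  then show ?thesis using assms by simp
qed

text \<open>Crude but sufficient: it is applied with \<open>m\<close> of order \<open>n\<close>,
  where the exponent stays bounded.\<close>

lemma survival_ge_exp:
  assumes "0 \<le> g" "2 * g \<le> real m" "0 < m" "m \<le> n"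
  shows "exp (- 2 * g * real (n - m) / real m) \<le> survival g m n"
  using assms(4)
proof (induction n rule: dec_induct)
  case (step n)
  have n: "0 < n" "real m \<le> real n" using step assms by auto
  define x where "x = g / real n"
  have x: "0 \<le> x" "x \<le> 1 / 2" using assms n by (auto simp: x_def divide_le_eq)
  have "exp (- 2 * g * real (Suc n - m) / real m) = exp (- 2 * g * real (n - m) / real m) * exp (- 2 * g / real m)"
  proof -
    have "real (Suc n - m) = real (n - m) + 1" using step by (simp add: Suc_diff_le)
    then have "- 2 * g * real (Suc n - m) / real m = - 2 * g * real (n - m) / real m + - 2 * g / real m"
      by (simp only: distrib_left add_divide_distrib mult_1_right)
    then show ?thesis by (simp only: exp_add)
  qed
  also have "exp (- 2 * g / real m) \<le> exp (- 2 * x)"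
    using assms n by (simp add: x_def frac_le)
  also have "\<dots> \<le> 1 - x" by (rule exp_le_one_minus[OF x])
  finally have "exp (- 2 * g * real (Suc n - m) / real m) \<le> exp (- 2 * g * real (n - m) / real m) * (1 - x)"
    by simp
  also have "\<dots> \<le> survival g m n * (1 - x)"
    using step.IH x by (intro mult_right_mono) auto
  finally show ?case using step by (simp add: survival_Suc x_def)
qed simp

text \<open>Each factor satisfies \<open>1 - g / n \<le> (n / (n + 1)) powr g\<close>, and these
  bounds telescope.\<close>

lemma survival_le_powr:
  assumes "0 \<le> g" "g \<le> real m" "0 < m" "m \<le> n"
  shows "survival g m n \<le> (real m / real n) powr g"
  using assms(4)
proof (induction n rule: dec_induct)
  case base
  then show ?case using assms by simp
next
  case (step n)
  have n: "0 < n" "real m \<le> real n" using step assms by auto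
  have "1 - g / real n \<le> exp (- (g / real n))" using exp_ge_add_one_self[of "- (g / real n)"] by simp
  also have "\<dots> \<le> exp (- g * ln (1 + 1 / real n))"
    using ln_add_one_self_le_self[of "1 / real n"] assms n mult_left_mono[of "ln (1 + 1 / real n)" "1 / real n" g]
    by simp
  also have "\<dots> = (real n / real (Suc n)) powr g"
  proof -
    have "real n / real (Suc n) = inverse (1 + 1 / real n)" using n by (simp add: field_simps)
    then have "ln (real n / real (Suc n)) = - ln (1 + 1 / real n)" using n by (simp add: ln_inverse add_pos_pos)
    then show ?thesis using n by (simp add: powr_def)
  qed
  finally have "survival g m (Suc n) \<le> (real m / real n) powr g * (real n / real (Suc n)) powr g"
    using step survival_bounds[of g m n] assms n
    by (subst survival_Suc) (auto intro!: mult_mono simp: divide_le_eq)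
  also have "\<dots> = (real m / real (Suc n)) powr g"
    using n by (simp add: powr_mult[symmetric])
  finally show ?case .
qed

lemma sum_inverse_squares_le:
  assumes "0 < L"
  shows "(\<Sum>i=L..n. 1 / (real i)\<^sup>2) \<le> 2 / real L"
proof (cases "L \<le> n")
  case True
  have inv: "1 / x\<^sup>2 \<le> 2 / x - 2 / (x + 1)" if "1 \<le> x" for x :: real
  proof -
    have "x * (x + 1) \<le> x * (2 * x)" using that by (intro mult_left_mono) auto
    then have "2 / (x * (2 * x)) \<le> 2 / (x * (x + 1))" using that by (intro divide_left_mono) auto
    moreover have "2 / (x * (x + 1)) = 2 / x - 2 / (x + 1)" using that by (simp add: field_simps)
    ultimately show ?thesis by (simp add: power2_eq_square)
  qed
  from True have "(\<Sum>i=L..n. 1 / (real i)\<^sup>2) \<le> 2 / real L - 2 / real (Suc n)"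
  proof (induction n rule: dec_induct)
    case base
    show ?case using inv[of "real L"] assms by (simp add: add.commute)
  next
    case (step n)
    have "1 / (real (Suc n))\<^sup>2 \<le> 2 / real (Suc n) - 2 / real (Suc (Suc n))"
      using inv[of "real (Suc n)"] by (simp add: add.commute)
    then show ?case using step by simp
  qed
  then show ?thesis by (smt (verit) divide_nonneg_nonneg of_nat_0_le_iff)
qed (use assms in simp)

text \<open>Turns second moments at single times into bounds that are uniform in time.\<close>

lemma deviation_sum_ge:
  fixes f :: "nat \<Rightarrow> real"
  assumes "\<And>i. L \<le> i \<Longrightarrow> i < j \<Longrightarrow> \<bar>f (Suc i) - f i\<bar> \<le> 2"
    and "\<theta> * real j < \<bar>f j\<bar>" "0 < \<theta>" "\<theta> \<le> 1" "0 < L" "2 * L \<le> j" "j \<le> n"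
  shows "\<theta> ^ 3 / 16 \<le> (\<Sum>i=L..n. (f i)\<^sup>2 / real i ^ 3)"
proof -
  \<comment> \<open>As \<open>f\<close> moves by at most 2 per step, \<open>\<bar>f\<bar>\<close> is
    still at least \<open>\<theta> * j / 2\<close> on the \<open>t + 1\<close> indices from
    \<open>j - t\<close> to \<open>j\<close>. Each contributes at least
    \<open>\<theta>\<^sup>2 / (4 * j)\<close>, and \<open>t + 1 > \<theta> * j / 4\<close>, whence
    the constant 16.\<close>
  define t where "t = nat \<lfloor>\<theta> * real j / 4\<rfloor>"
  have t: "real t \<le> \<theta> * real j / 4" "\<theta> * real j / 4 < real t + 1"
  proof -
    have "0 \<le> \<theta> * real j / 4" using assms by simp
    then have "real t = of_int \<lfloor>\<theta> * real j / 4\<rfloor>" by (simp add: t_def)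
    then show "real t \<le> \<theta> * real j / 4" "\<theta> * real j / 4 < real t + 1" by linarith+
  qed
  have j: "0 < real j" using assms by simp
  have tj: "\<theta> * real j / 4 \<le> real j / 4" using assms by simp
  then have tL: "t \<le> j - L"
  proof -
    have "real t \<le> real j / 4" using t tj by linarith
    then have "4 * t \<le> j" by simp
    then show ?thesis using assms by linarith
  qed
  have dev: "\<theta> * real j - 2 * real s \<le> \<bar>f (j - s)\<bar>" if "s \<le> t" for s
    using that
  proof (induction s)
    case 0
    then show ?case using assms by simp
  next
    case (Suc s)
    have "L \<le> j - Suc s" "j - Suc s < j" "Suc (j - Suc s) = j - s" using Suc.prems tL assms by linarith+
    then have "\<bar>f (j - s) - f (j - Suc s)\<bar> \<le> 2" using assms(1) by metis
    then show ?case using Suc by auto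
  qed
  have big: "\<theta>\<^sup>2 / 4 / real j \<le> (f i)\<^sup>2 / real i ^ 3" if "i \<in> {j - t..j}" for i
  proof -
    define s where "s = j - i"
    have s: "s \<le> t" "i = j - s" "0 < i" using that tL assms by (auto simp: s_def)
    have "\<theta> * real j / 2 \<le> \<theta> * real j - 2 * real s" using t s by (simp add: field_simps)
    also have "\<dots> \<le> \<bar>f i\<bar>" using dev[OF s(1)] s by simp
    finally have "(\<theta> * real j / 2)\<^sup>2 \<le> (f i)\<^sup>2"
      using assms by (subst abs_le_square_iff[symmetric]) auto
    then have "(\<theta> * real j / 2)\<^sup>2 / real j ^ 3 \<le> (f i)\<^sup>2 / real i ^ 3"
      using that s(3) by - (rule frac_le, auto intro: power_mono)
    moreover have "(\<theta> * real j / 2)\<^sup>2 / real j ^ 3 = \<theta>\<^sup>2 / 4 / real j"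
      using j by (simp add: power2_eq_square power3_eq_cube)
    ultimately show ?thesis by simp
  qed
  have "\<theta> ^ 3 / 16 = (\<theta> * real j / 4) * (\<theta>\<^sup>2 / 4 / real j)"
    using j by (simp add: power2_eq_square power3_eq_cube)
  also have "\<dots> \<le> (real t + 1) * (\<theta>\<^sup>2 / 4 / real j)"
    using t by (intro mult_right_mono) auto
  also have "\<dots> = (\<Sum>i\<in>{j - t..j}. \<theta>\<^sup>2 / 4 / real j)"
    using tL by (simp add: Suc_diff_diff)
  also have "\<dots> \<le> (\<Sum>i\<in>{j - t..j}. (f i)\<^sup>2 / real i ^ 3)"
    using big by (rule sum_mono)
  also have "\<dots> \<le> (\<Sum>i=L..n. (f i)\<^sup>2 / real i ^ 3)"
    using tL assms by (intro sum_mono2) auto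
  finally show ?thesis .
qed

lemma prob_vertex_chain_le:
  fixes W :: "_ \<Rightarrow> real"
  assumes "0 < c" "\<And>V h. (V, h) \<in> set_pmf (vertex_chain p n) \<Longrightarrow> 0 \<le> W (V, h)"
    and "\<And>V h. (V, h) \<in> set_pmf (vertex_chain p n) \<Longrightarrow> (V, h) \<in> A \<Longrightarrow> c \<le> W (V, h)"
    and "chain_expectation p n W \<le> B"
  shows "chain_prob p n A \<le> B / c"
proof -
  have "chain_prob p n A = chain_expectation p n (indicator A)"
    by simp
  also have "\<dots> \<le> chain_expectation p n (\<lambda>s. W s / c)"
    by (rule expectation_vertex_chain_mono) (use assms in \<open>auto simp: indicator_def\<close>)
  also have "\<dots> \<le> B / c" using assms by (simp add: divide_right_mono)
  finally show ?thesis .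
qed

text \<open>The weighted sum of squares has mean at most the sum of \<open>4 / i\<^sup>2\<close>
  from \<open>L\<close> on, hence at most \<open>8 / L\<close>. This is independent of
  \<open>n\<close>, so a fixed \<open>L\<close> controls all later times at once.\<close>

lemma prob_card_deviation:
  assumes p: "1 / 2 < p" "p \<le> 1" and "0 < \<theta>" "\<theta> \<le> 1" "0 < L"
  shows "chain_prob p n
    {(V, h). \<exists>j. 2 * L \<le> j \<and> j \<le> n \<and> \<theta> * real j < \<bar>real (h j) - (2 * p - 1) * real j\<bar>}
    \<le> 8 / real L / (\<theta> ^ 3 / 16)"
proof (rule prob_vertex_chain_le)
  let ?f = "\<lambda>h i. real (h i) - (2 * p - 1) * real i"
  let ?W = "\<lambda>(V, h). \<Sum>i=L..n. (?f h i)\<^sup>2 / real i ^ 3"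
  show "0 < \<theta> ^ 3 / 16" using assms by simp
  show "0 \<le> ?W (V, h)" for V :: "nat set" and h by (simp add: sum_nonneg)
  show "\<theta> ^ 3 / 16 \<le> ?W (V, h)" if s: "(V, h) \<in> set_pmf (vertex_chain p n)"
    and dev: "(V, h) \<in> {(V, h). \<exists>j. 2 * L \<le> j \<and> j \<le> n \<and> \<theta> * real j < \<bar>?f h j\<bar>}" for V h
  proof -
    obtain j where j: "2 * L \<le> j" "j \<le> n" "\<theta> * real j < \<bar>?f h j\<bar>" using dev by auto
    have "\<theta> ^ 3 / 16 \<le> (\<Sum>i=L..n. (?f h i)\<^sup>2 / real i ^ 3)"
    proof (rule deviation_sum_ge[where f = "?f h", OF _ j(3) assms(3-5) j(1,2)])
      fix i assume "i < j"
      then have "h (Suc i) \<le> Suc (h i)" "h i \<le> Suc (h (Suc i))"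
        using vertex_chain_support[OF s] j by auto
      then have "\<bar>real (h (Suc i)) - real (h i)\<bar> \<le> 1" by linarith
      then show "\<bar>?f h (Suc i) - ?f h i\<bar> \<le> 2" using p by (auto simp: algebra_simps)
    qed
    then show ?thesis by simp
  qed
  have p0: "0 \<le> p" using p by simp
  have "chain_expectation p n ?W =
    (\<Sum>i=L..n. chain_expectation p n (\<lambda>(V, h). (?f h i)\<^sup>2 / real i ^ 3))"
    by (simp add: case_prod_unfold Bochner_Integration.integral_sum)
  also have "\<dots> \<le> (\<Sum>i=L..n. 4 * (1 / (real i)\<^sup>2))"
  proof (rule sum_mono)
    fix i assume i: "i \<in> {L..n}"
    have "chain_expectation p n (\<lambda>(V, h). (?f h i)\<^sup>2 / real i ^ 3) =
      chain_expectation p i (\<lambda>(V, h). (real (card V) - (2 * p - 1) * real i)\<^sup>2 / real i ^ 3)"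
      using expectation_vertex_chain_past[OF p0 p(2), of i n "\<lambda>x. (real x - (2 * p - 1) * real i)\<^sup>2 / real i ^ 3"] i by simp
    also have "\<dots> = chain_expectation p i (\<lambda>s. (real (card (fst s)) - (2 * p - 1) * real i)\<^sup>2) / real i ^ 3"
      by (simp add: case_prod_unfold)
    also have "\<dots> \<le> (4 * real i) / real i ^ 3"
      by (intro divide_right_mono expectation_card_sq p) simp
    also have "\<dots> = 4 * (1 / (real i)\<^sup>2)" by (simp add: power2_eq_square power3_eq_cube)
    finally show "chain_expectation p n (\<lambda>(V, h). (?f h i)\<^sup>2 / real i ^ 3) \<le> 4 * (1 / (real i)\<^sup>2)" .
  qed
  also have "\<dots> = 4 * (\<Sum>i=L..n. 1 / (real i)\<^sup>2)" by (simp only: sum_distrib_left)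
  also have "\<dots> \<le> 4 * (2 / real L)" by (intro mult_left_mono sum_inverse_squares_le assms) simp
  finally show "chain_expectation p n ?W \<le> 8 / real L" by simp
qed

text \<open>The second moment bound is of order \<open>n powr (3 / 2)\<close> whatever
  \<open>i\<close> is, so the weights are simply estimated by \<open>1 / L ^ 3\<close>; the result
  is useful for \<open>L\<close> of order \<open>n\<close>.\<close>

lemma prob_survivors_deviation:
  assumes p: "1 / 2 < p" "p \<le> 1" and d: "d = 2 * p - 1"
    and "0 < \<theta>" "\<theta> \<le> 1" "0 < L" "(1 - p) / d \<le> real L"
  shows "chain_prob p n
    {(V, h). \<exists>m. 2 * L \<le> m \<and> m \<le> n \<and>
      \<theta> * real m < \<bar>real (card (V \<inter> {..m})) - d * real m * survival ((1 - p) / d) m n\<bar>}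
    \<le> real n * (8 / d * (real n * sqrt (real n)) / real L ^ 3) / (\<theta> ^ 3 / 16)"
proof (rule prob_vertex_chain_le)
  define b where "b m = d * real m * survival ((1 - p) / d) m n" for m
  let ?f = "\<lambda>V i. real (card (V \<inter> {..i})) - b i"
  let ?W = "\<lambda>s. \<Sum>i=L..n. (?f (fst s) i)\<^sup>2 / real i ^ 3"
  have d0: "0 < d" using p d by simp
  show "0 < \<theta> ^ 3 / 16" using assms by simp
  show "0 \<le> ?W (V, h)" for V and h :: "nat \<Rightarrow> nat" by (simp add: sum_nonneg)
  show "\<theta> ^ 3 / 16 \<le> ?W (V, h)" if s: "(V, h) \<in> set_pmf (vertex_chain p n)"
    and dev: "(V, h) \<in> {(V, h). \<exists>m. 2 * L \<le> m \<and> m \<le> n \<and>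
      \<theta> * real m < \<bar>real (card (V \<inter> {..m})) - d * real m * survival ((1 - p) / d) m n\<bar>}" for V h
  proof -
    have fin: "finite V" using vertex_chain_support[OF s] by (auto intro: finite_subset)
    obtain j where j: "2 * L \<le> j" "j \<le> n" "\<theta> * real j < \<bar>?f V j\<bar>" using dev by (auto simp: b_def)
    have "\<theta> ^ 3 / 16 \<le> (\<Sum>i=L..n. (?f V i)\<^sup>2 / real i ^ 3)"
    proof (rule deviation_sum_ge[where f = "?f V", OF _ j(3) assms(4-6) j(1,2)])
      fix i assume i: "L \<le> i" "i < j"
      have i': "i < n" "0 < i" using i j assms by linarith+
      define S where "S = survival ((1 - p) / d) (Suc i) n"
      have "(1 - p) / d \<le> real (Suc i)" using assms i by linarith
      then have S: "0 \<le> S" "S \<le> 1"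
        using survival_bounds[of "(1 - p) / d" "Suc i" n] d0 p by (auto simp: S_def)
      \<comment> \<open>The target grows by \<open>p * S \<le> 1\<close>, because
        \<open>d * (1 + (1 - p) / d) = p\<close>, and the count grows by 0 or 1; so the difference
        moves by at most 2.\<close>
      have "b (Suc i) - b i = d * S * (real (Suc i) - real i * (1 - (1 - p) / d / real i))"
        unfolding b_def survival_Suc_left[OF i'(1)] S_def by (simp add: algebra_simps)
      also have "real (Suc i) - real i * (1 - (1 - p) / d / real i) = 1 + (1 - p) / d"
        using i' d0 by (simp add: field_simps)
      also have "d * S * (1 + (1 - p) / d) = (d + (1 - p)) * S" using d0 by (simp add: field_simps)
      also have "d + (1 - p) = p" using d by simp
      finally have b: "0 \<le> b (Suc i) - b i" "b (Suc i) - b i \<le> 1"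
        using S p mult_mono[of p 1 S 1] by auto
      have "V \<inter> {..Suc i} = (if Suc i \<in> V then insert (Suc i) (V \<inter> {..i}) else V \<inter> {..i})"
        by (auto simp: le_Suc_eq)
      then have "real (card (V \<inter> {..Suc i})) - real (card (V \<inter> {..i})) \<in> {0, 1}"
        using fin by simp
      then show "\<bar>?f V (Suc i) - ?f V i\<bar> \<le> 2" using b by auto
    qed
    then show ?thesis by simp
  qed
  have "chain_expectation p n ?W =
    (\<Sum>i=L..n. chain_expectation p n (\<lambda>s. (?f (fst s) i)\<^sup>2) / real i ^ 3)"
    by (simp add: Bochner_Integration.integral_sum)
  also have "\<dots> \<le> (\<Sum>i=L..n. 8 / d * (real n * sqrt (real n)) / real L ^ 3)"
  proof (rule sum_mono)
    fix i assume i: "i \<in> {L..n}"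
    then show "chain_expectation p n (\<lambda>s. (?f (fst s) i)\<^sup>2) / real i ^ 3
      \<le> 8 / d * (real n * sqrt (real n)) / real L ^ 3"
      unfolding b_def using assms d0
      by (intro frac_le expectation_survivors_sq[OF p d] power_mono) auto
  qed
  also have "\<dots> = real (card {L..n}) * (8 / d * (real n * sqrt (real n)) / real L ^ 3)" by simp
  also have "\<dots> \<le> real n * (8 / d * (real n * sqrt (real n)) / real L ^ 3)"
    using d0 assms(6) by (intro mult_right_mono) auto
  finally show "chain_expectation p n ?W \<le> real n * (8 / d * (real n * sqrt (real n)) / real L ^ 3)" .
qed

text \<open>The expected weight telescopes through
  \<open>S (Suc w) / w = (S (Suc w) - S w) / (1 - p)\<close>, where \<open>S\<close> is the survival
  bound. Hence the weight is small once \<open>K / n\<close> is.\<close>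

lemma prob_early_weight:
  assumes p: "0 \<le> p" "p < 1" and "K < n" "0 < \<tau>"
  shows "chain_prob p n {(V, h). \<tau> < (\<Sum>w\<in>V \<inter> {..K}. 1 / real w)}
    \<le> (real (Suc K) / real n) powr (1 - p) / (1 - p) / \<tau>"
proof (rule prob_vertex_chain_le)
  let ?W = "\<lambda>s. \<Sum>w=1..K. of_bool (w \<in> fst s) / real w"
  show "0 < \<tau>" by fact
  show "0 \<le> ?W (V, h)" for V and h :: "nat \<Rightarrow> nat" by (simp add: sum_nonneg)
  show "\<tau> \<le> ?W (V, h)" if s: "(V, h) \<in> set_pmf (vertex_chain p n)"
    and "(V, h) \<in> {(V, h). \<tau> < (\<Sum>w\<in>V \<inter> {..K}. 1 / real w)}" for V h
  proof -
    have V: "V \<inter> {..K} = {1..K} \<inter> V" using vertex_chain_support[OF s] by auto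
    have "(\<Sum>w\<in>V \<inter> {..K}. 1 / real w) = (\<Sum>w=1..K. if w \<in> V then 1 / real w else 0)"
      unfolding V by (rule sum.inter_restrict) simp
    also have "\<dots> = ?W (V, h)" by (rule sum.cong) auto
    finally show ?thesis using that by simp
  qed
  define S where "S w = survival (1 - p) w n" for w
  have "chain_expectation p n ?W =
    (\<Sum>w=1..K. chain_expectation p n (\<lambda>s. of_bool (w \<in> fst s)) / real w)"
    by (simp add: Bochner_Integration.integral_sum)
  also have "\<dots> \<le> (\<Sum>w=1..K. (S (Suc w) - S w) / (1 - p))"
  proof (rule sum_mono)
    fix w assume w: "w \<in> {1..K}"
    have Sw: "S w = (1 - (1 - p) / real w) * S (Suc w)"
      unfolding S_def using w assms by (intro survival_Suc_left) auto
    have S0: "0 \<le> S (Suc w)" unfolding S_def using p by (intro survival_bounds) auto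
    have "chain_expectation p n (\<lambda>s. of_bool (w \<in> fst s)) / real w \<le> S w / real w"
      unfolding S_def using w assms by (intro divide_right_mono prob_mem_vertex_chain) auto
    also have "\<dots> \<le> S (Suc w) / real w"
    proof (rule divide_right_mono)
      have "S w \<le> 1 * S (Suc w)" unfolding Sw using S0 p by (intro mult_right_mono) auto
      then show "S w \<le> S (Suc w)" by simp
    qed simp
    also have "\<dots> = (S (Suc w) - S w) / (1 - p)" unfolding Sw using p w by (simp add: field_simps)
    finally show "chain_expectation p n (\<lambda>s. of_bool (w \<in> fst s)) / real w \<le> (S (Suc w) - S w) / (1 - p)" .
  qed
  also have "\<dots> = (S (Suc K) - S 1) / (1 - p)"
    using sum_Suc_diff[of 1 K S] by (simp add: sum_divide_distrib[symmetric])
  also have "\<dots> \<le> S (Suc K) / (1 - p)"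
    using survival_bounds[of "1 - p" 1 n] p by (intro divide_right_mono) (auto simp: S_def)
  also have "\<dots> \<le> (real (Suc K) / real n) powr (1 - p) / (1 - p)"
    unfolding S_def using assms by (intro divide_right_mono survival_le_powr) auto
  finally show "chain_expectation p n ?W \<le> (real (Suc K) / real n) powr (1 - p) / (1 - p)" .
qed


section \<open>Mean degrees for a typical vertex process\<close>

text \<open>\<open>K\<close> is about \<open>n / Q\<close> and separates early from late vertices; the early survivors are
  controlled only through their total weight \<open>\<tau>\<close>.\<close>

locale good_state =
  fixes p \<beta> \<theta> \<tau> Q :: real and n K L :: nat and V :: "nat set" and h :: "nat \<Rightarrow> nat" and d \<gamma> :: real
  assumes p: "1 / 2 < p" "p < 1"
    and d_def: "d = 2 * p - 1" and \<gamma>_def: "\<gamma> = (1 - p) / d"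
    and beta: "0 < \<beta>" and theta: "0 < \<theta>" "\<theta> \<le> d / 2"
    and L: "0 < L" "2 * L < K" and K: "K \<le> n" "real n \<le> Q * real K" "2 * \<gamma> \<le> real K" "\<beta> \<le> d / 2 * real K"
    and vertex_gt: "\<And>w. w \<in> V \<Longrightarrow> 2 * L + 1 < w"
    and V: "V \<subseteq> {1..n}" "h n = card V" "\<And>j. j \<le> n \<Longrightarrow> card (V \<inter> {..j}) \<le> h j"
    and h: "\<And>j. 2 * L \<le> j \<Longrightarrow> j \<le> n \<Longrightarrow> \<bar>real (h j) - d * real j\<bar> \<le> \<theta> * real j"
    and survivors: "\<And>m. K \<le> m \<Longrightarrow> m \<le> n \<Longrightarrow>
      \<bar>real (card (V \<inter> {..m})) - d * real m * survival \<gamma> m n\<bar> \<le> \<theta> * real m"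
    and early: "(\<Sum>w\<in>V \<inter> {..K}. 1 / real w) \<le> \<tau>"
begin

abbreviation "s m \<equiv> survival \<gamma> m n"
abbreviation "q \<equiv> attach_prob \<beta> h"

text \<open>For \<open>m \<ge> K\<close>, up to a factor near \<open>\<beta> / d\<close>, the mean
  number of edges from a vertex born at time \<open>m\<close> to younger survivors.\<close>

definition "rw m = (\<Sum>w\<in>{w\<in>V. m < w}. 1 / real (w - 1))"
definition "mean_in v = real (card {u\<in>V. u < v}) * q v"
definition "mean_out v = (\<Sum>w\<in>{w\<in>V. v < w}. q w)"

lemma finV: "finite V" using V(1) finite_subset by blast

lemma vertex_range: "v \<in> V \<Longrightarrow> 1 \<le> v" "v \<in> V \<Longrightarrow> v \<le> n"
  using V(1) by auto

lemma d_pos: "0 < d" "d \<le> 1" and gamma_pos: "0 < \<gamma>"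
  using p by (auto simp: d_def \<gamma>_def)

lemma K_pos: "0 < K" "0 < n" using L K by auto

lemma Q_ge: "1 \<le> Q"
proof (rule ccontr)
  assume "\<not> 1 \<le> Q"
  then have "Q * real K < 1 * real K" using K_pos by (intro mult_strict_right_mono) auto
  then show False using K by simp
qed

lemma s_bounds: "K \<le> m \<Longrightarrow> 0 \<le> s m" "K \<le> m \<Longrightarrow> s m \<le> 1"
  using survival_bounds[of \<gamma> m n] gamma_pos K K_pos by auto

lemma h_bounds:
  assumes "2 * L \<le> j" "j \<le> n"
  shows "(d - \<theta>) * real j \<le> real (h j)" "real (h j) \<le> (d + \<theta>) * real j"
  using h[OF assms] by (auto simp: algebra_simps)

lemma d_theta: "0 < d - \<theta>" "0 < d + \<theta>" "d / 2 \<le> d - \<theta>"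
  using d_pos theta by auto

lemma q_bounds:
  assumes "w \<in> V"
  shows "0 \<le> q w" "q w \<le> 1" "q w \<le> \<beta> / (d - \<theta>) * (1 / real (w - 1))" 
proof -
  have w: "2 * L \<le> w - 1" "w - 1 \<le> n" "0 < w - 1"
    using vertex_gt[OF assms] assms V(1) L(1) by auto
  show "0 \<le> q w" "q w \<le> 1" using beta by (auto simp: attach_prob_def)
  have pos: "0 < (d - \<theta>) * real (w - 1)" using w d_theta by simp
  have "q w \<le> \<beta> / real (h (w - 1))" by (simp add: attach_prob_def)
  also have "\<dots> \<le> \<beta> / ((d - \<theta>) * real (w - 1))"
    by (rule frac_le) (use h_bounds(1)[OF w(1,2)] beta pos in linarith)+
  finally show "q w \<le> \<beta> / (d - \<theta>) * (1 / real (w - 1))" by simp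
qed

lemma q_late:
  assumes "w \<in> V" "K < w"
  shows "\<beta> / (d + \<theta>) * (1 / real (w - 1)) \<le> q w" "q w \<le> 2 * \<beta> / (d * real K)"
proof -
  have w: "2 * L \<le> w - 1" "w - 1 \<le> n" "0 < w - 1" "K \<le> w - 1"
    using vertex_gt[OF assms(1)] assms V(1) L(1) by auto
  have "\<beta> \<le> (d - \<theta>) * real (w - 1)"
  proof -
    have "d / 2 * real K \<le> (d - \<theta>) * real (w - 1)"
      using d_theta d_pos w by (intro mult_mono) auto
    then show ?thesis using K by linarith
  qed
  then have hb: "\<beta> \<le> real (h (w - 1))" using h_bounds(1)[OF w(1,2)] by linarith
  then have "q w = \<beta> / real (h (w - 1))" using beta by (simp add: attach_prob_def)
  moreover have "\<beta> / ((d + \<theta>) * real (w - 1)) \<le> \<beta> / real (h (w - 1))"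
    by (rule frac_le) (use h_bounds(2)[OF w(1,2)] hb beta in linarith)+
  ultimately show "\<beta> / (d + \<theta>) * (1 / real (w - 1)) \<le> q w" by simp
  have "q w \<le> \<beta> / (d - \<theta>) * (1 / real (w - 1))" by (rule q_bounds[OF assms(1)])
  also have "\<dots> \<le> \<beta> / (d / 2) * (1 / real K)"
    using d_theta d_pos beta w K_pos by (intro mult_mono divide_left_mono) auto
  finally show "q w \<le> 2 * \<beta> / (d * real K)" by (simp add: mult.commute)
qed

text \<open>Summation by parts against \<open>1 / (w - 1)\<close>; for the limiting profile \<open>d w s(w)\<close> the sum telescopes exactly.\<close>

lemma rw_bound:
  assumes "K \<le> m" "m \<le> n"
  shows "\<bar>rw m - p / \<gamma> * (1 - s m)\<bar> \<le> \<theta> * (2 + Q)"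
proof -
  define B where "B w = real (card (V \<inter> {..w}))" for w
  define b where "b w = d * real w * s w" for w
  define D where "D w = B w - b w" for w
  \<comment> \<open>\<open>E\<close> is the error of the partial sums. Summation by parts shows that
    \<open>E N - D N / N\<close> changes in one step only by \<open>D (Suc N) / (N * Suc N)\<close>,
    at most \<open>\<theta> / m\<close> in absolute value; the \<open>n - m\<close> steps cost at
    most \<open>\<theta> * Q\<close>.\<close>
  define E where "E N = (\<Sum>w\<in>{w\<in>V. m < w \<and> w \<le> N}. 1 / real (w - 1)) - p / \<gamma> * (s N - s m)" for N
  have m0: "0 < m" using assms K_pos by simp
  have D: "\<bar>D w\<bar> \<le> \<theta> * real w" if "K \<le> w" "w \<le> n" for w
    using survivors[OF that] by (simp add: D_def B_def b_def)
  have "\<bar>E N - D N / real N\<bar> \<le> \<theta> + \<theta> * (real (N - m) / real m)" if "m \<le> N" "N \<le> n" for N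
    using that
  proof (induction N rule: dec_induct)
    case base
    have "E m = 0" unfolding E_def by (auto intro!: sum.neutral)
    then show ?case using D[OF assms] m0 by (simp add: divide_le_eq)
  next
    case (step N)
    have N: "0 < N" "N < n" "K \<le> N" "real m \<le> real N" using step m0 assms by auto
    have sN: "s N = (1 - \<gamma> / real N) * s (Suc N)" using N by (intro survival_Suc_left) auto
    have set: "{w\<in>V. m < w \<and> w \<le> Suc N} =
        (if Suc N \<in> V then insert (Suc N) {w\<in>V. m < w \<and> w \<le> N} else {w\<in>V. m < w \<and> w \<le> N})"
      using step by (auto simp: le_Suc_eq)
    have Bset: "V \<inter> {..Suc N} = (if Suc N \<in> V then insert (Suc N) (V \<inter> {..N}) else V \<inter> {..N})"
      by (auto simp: le_Suc_eq)
    have dB: "(\<Sum>w\<in>{w\<in>V. m < w \<and> w \<le> Suc N}. 1 / real (w - 1)) =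
        (\<Sum>w\<in>{w\<in>V. m < w \<and> w \<le> N}. 1 / real (w - 1)) + (B (Suc N) - B N) / real N"
      unfolding set B_def Bset using finV by simp
    have "b (Suc N) - b N = p * s (Suc N)"
    proof -
      have "b (Suc N) - b N = d * s (Suc N) * (real (Suc N) - real N * (1 - \<gamma> / real N))"
        unfolding b_def sN by (simp add: algebra_simps)
      also have "real (Suc N) - real N * (1 - \<gamma> / real N) = 1 + \<gamma>" using N by (simp add: field_simps)
      also have "d * s (Suc N) * (1 + \<gamma>) = (d + d * \<gamma>) * s (Suc N)" by (simp add: algebra_simps)
      also have "d + d * \<gamma> = p" using d_pos by (simp add: \<gamma>_def d_def)
      finally show ?thesis .
    qed
    then have DD: "D (Suc N) - D N = (B (Suc N) - B N) - p * s (Suc N)" by (simp add: D_def)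
    have ss: "p / \<gamma> * (s (Suc N) - s N) = p * s (Suc N) / real N"
      unfolding sN using N gamma_pos by (simp add: field_simps)
    have "E (Suc N) = E N + (B (Suc N) - B N) / real N - p / \<gamma> * (s (Suc N) - s N)"
      unfolding E_def dB by (simp only: right_diff_distrib)
    then have dE: "E (Suc N) = E N + (D (Suc N) - D N) / real N"
      unfolding ss DD by (simp add: diff_divide_distrib)
    have "E (Suc N) - D (Suc N) / real (Suc N) = (E N - D N / real N) + D (Suc N) / (real N * real (Suc N))"
    proof -
      have "x / real N - x / real (Suc N) = x / (real N * real (Suc N))" for x
        using N by (simp add: field_simps)
      from this[of "D (Suc N)"] show ?thesis unfolding dE by (simp only: diff_divide_distrib)
    qed
    moreover have "\<bar>D (Suc N) / (real N * real (Suc N))\<bar> \<le> \<theta> / real m"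
    proof -
      have "\<bar>D (Suc N) / (real N * real (Suc N))\<bar> = \<bar>D (Suc N)\<bar> / (real N * real (Suc N))"
        by (simp add: abs_mult)
      also have "\<dots> \<le> \<theta> * real (Suc N) / (real N * real (Suc N))"
        using D[of "Suc N"] N by (intro divide_right_mono) auto
      also have "\<dots> = \<theta> / real N" by simp
      also have "\<dots> \<le> \<theta> / real m" using N m0 theta by (intro divide_left_mono) auto
      finally show ?thesis .
    qed
    moreover have "\<theta> * (real (Suc N - m) / real m) = \<theta> * (real (N - m) / real m) + \<theta> / real m"
    proof -
      have "real (Suc N - m) = real (N - m) + 1" using step by (simp add: Suc_diff_le)
      then show ?thesis by (simp only: add_divide_distrib distrib_left times_divide_eq_right mult_1_right)
    qed
    moreover have "\<bar>E N - D N / real N\<bar> \<le> \<theta> + \<theta> * (real (N - m) / real m)"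
      using step.IH N by simp
    ultimately show ?case by linarith
  qed
  from this[of n] have "\<bar>E n - D n / real n\<bar> \<le> \<theta> + \<theta> * (real (n - m) / real m)" using assms by simp
  moreover have "real (n - m) / real m \<le> Q"
  proof -
    have "real (n - m) \<le> Q * real K" using K by simp
    also have "\<dots> \<le> Q * real m" using Q_ge assms by simp
    finally show ?thesis using m0 by (simp add: divide_le_eq)
  qed
  then have "\<theta> * (real (n - m) / real m) \<le> \<theta> * Q" using theta by (intro mult_left_mono) auto
  moreover have "\<bar>D n / real n\<bar> \<le> \<theta>"
    using D[of n] K K_pos by (simp add: divide_le_eq)
  moreover have "\<theta> * (2 + Q) = 2 * \<theta> + \<theta> * Q" by (simp add: algebra_simps)
  ultimately have "\<bar>E n\<bar> \<le> \<theta> * (2 + Q)" by linarith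
  moreover have "{w\<in>V. m < w \<and> w \<le> n} = {w\<in>V. m < w}" using V(1) by auto
  ultimately show ?thesis unfolding E_def rw_def by simp
qed

lemma mean_out_le_rw: "mean_out v \<le> \<beta> / (d - \<theta>) * rw v"
  unfolding mean_out_def rw_def sum_distrib_left
  by (intro sum_mono q_bounds(3)) simp

lemma below_eq: "v \<in> V \<Longrightarrow> {u\<in>V. u < v} = V \<inter> {..v - 1}"
  using V(1) by force

lemma mean_in_le:
  assumes "v \<in> V"
  shows "mean_in v \<le> \<beta> / (d - \<theta>) * (real (card (V \<inter> {..v - 1})) / real (v - 1))"
proof -
  have "mean_in v \<le> real (card (V \<inter> {..v - 1})) * (\<beta> / (d - \<theta>) * (1 / real (v - 1)))"
    unfolding mean_in_def below_eq[OF assms] by (rule mult_left_mono[OF q_bounds(3)[OF assms]]) simp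
  then show ?thesis by (simp add: mult_ac)
qed

text \<open>The older survivors were among the \<open>h (v - 1)\<close> vertices present at the
  birth of \<open>v\<close>, each joined with probability at most
  \<open>\<beta> / h (v - 1)\<close>; so no error term in \<open>\<theta>\<close> arises.\<close>

lemma mean_in_le_beta:
  assumes "v \<in> V"
  shows "mean_in v \<le> \<beta>"
proof -
  have v: "v - 1 \<le> n" using vertex_range[OF assms] by simp
  show ?thesis
  proof (cases "h (v - 1) = 0")
    case True
    then show ?thesis using beta by (simp add: mean_in_def attach_prob_def)
  next
    case False
    have "mean_in v \<le> real (h (v - 1)) * (\<beta> / real (h (v - 1)))"
      unfolding mean_in_def below_eq[OF assms] using V(3)[OF v] beta
      by (intro mult_mono) (auto simp: attach_prob_def)
    then show ?thesis using False by simp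
  qed
qed

text \<open>Since \<open>1 / (v - 1) \<le> 1 / w\<close> for \<open>w \<le> v - 1\<close>, the total
  weight of early survivors also bounds their density.\<close>

lemma early_fraction:
  assumes "v \<in> V" "v \<le> K"
  shows "real (card (V \<inter> {..v - 1})) / real (v - 1) \<le> \<tau>"
proof -
  have "real (card (V \<inter> {..v - 1})) / real (v - 1) = (\<Sum>w\<in>V \<inter> {..v - 1}. 1 / real (v - 1))" by simp
  also have "\<dots> \<le> (\<Sum>w\<in>V \<inter> {..v - 1}. 1 / real w)"
  proof (rule sum_mono)
    fix w assume w: "w \<in> V \<inter> {..v - 1}"
    then have "1 \<le> w" using vertex_range by blast
    then show "1 / real (v - 1) \<le> 1 / real w" using w by (intro frac_le) auto
  qed
  also have "\<dots> \<le> (\<Sum>w\<in>V \<inter> {..K}. 1 / real w)"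
    using assms finV by (intro sum_mono2) auto
  finally show ?thesis using early by simp
qed

lemma late_fraction:
  assumes "v \<in> V" "K < v"
  shows "real (card (V \<inter> {..v - 1})) / real (v - 1) \<le> d * s (v - 1) + \<theta>"
    "d * s (v - 1) - \<theta> \<le> real (card (V \<inter> {..v - 1})) / real (v - 1)"
proof -
  have v: "K \<le> v - 1" "v - 1 \<le> n" "0 < v - 1" using vertex_range[OF assms(1)] assms(2) K_pos by auto
  have "real (card (V \<inter> {..k})) / real k \<le> d * s k + \<theta> \<and>
      d * s k - \<theta> \<le> real (card (V \<inter> {..k})) / real k" if "K \<le> k" "k \<le> n" "0 < k" for k
    using survivors[OF that(1,2)] that(3) by (auto simp: field_simps abs_le_iff)
  from this[OF v] show "real (card (V \<inter> {..v - 1})) / real (v - 1) \<le> d * s (v - 1) + \<theta>"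
    "d * s (v - 1) - \<theta> \<le> real (card (V \<inter> {..v - 1})) / real (v - 1)" by blast+
qed

text \<open>With \<open>s = s (v - 1)\<close>, the in-degree contributes \<open>d * s\<close> and
  the out-degree \<open>p / \<gamma> * (1 - s)\<close>. As \<open>d < p / \<gamma>\<close>, the sum
  is largest for \<open>s\<close> near 0: old vertices gain more out-edges than they lose
  in-edges.\<close>

lemma mean_late_le:
  assumes "v \<in> V" "K < v"
  shows "mean_in v + mean_out v \<le>
    \<beta> / (d - \<theta>) * (p / \<gamma> - (p / \<gamma> - d) * s (v - 1) + \<theta> * (3 + Q))"
proof -
  have v: "K \<le> v - 1" "v - 1 \<le> n" using vertex_range[OF assms(1)] assms(2) by auto
  have "rw v \<le> rw (v - 1)" unfolding rw_def using finV by (intro sum_mono2) auto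
  also have "\<dots> \<le> p / \<gamma> * (1 - s (v - 1)) + \<theta> * (2 + Q)" using rw_bound[OF v] by linarith
  finally have r: "rw v \<le> p / \<gamma> * (1 - s (v - 1)) + \<theta> * (2 + Q)" .
  define F where "F = real (card (V \<inter> {..v - 1})) / real (v - 1)"
  have c: "0 \<le> \<beta> / (d - \<theta>)" using beta d_theta by simp
  have "mean_in v + mean_out v \<le> \<beta> / (d - \<theta>) * F + \<beta> / (d - \<theta>) * rw v"
    using mean_in_le[OF assms(1), folded F_def] mean_out_le_rw[of v] by linarith
  also have "\<dots> = \<beta> / (d - \<theta>) * (F + rw v)"
    by (simp only: distrib_left)
  also have "\<dots> \<le> \<beta> / (d - \<theta>) * (p / \<gamma> - (p / \<gamma> - d) * s (v - 1) + \<theta> * (3 + Q))"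
  proof (rule mult_left_mono[OF _ c])
    have "d * s (v - 1) + \<theta> + (p / \<gamma> * (1 - s (v - 1)) + \<theta> * (2 + Q)) =
        p / \<gamma> - (p / \<gamma> - d) * s (v - 1) + \<theta> * (3 + Q)"
      by (simp add: algebra_simps)
    then show "F + rw v \<le>
        p / \<gamma> - (p / \<gamma> - d) * s (v - 1) + \<theta> * (3 + Q)"
      using r late_fraction(1)[OF assms, folded F_def] by linarith
  qed
  finally show ?thesis .
qed

text \<open>In \<open>3 * \<tau>\<close>, one \<open>\<tau>\<close> is the density of the older
  survivors, and two come from the younger ones up to \<open>K\<close>, where
  \<open>1 / (w - 1) \<le> 2 / w\<close>.\<close>

lemma mean_early_le:
  assumes "v \<in> V" "v \<le> K"
  shows "mean_in v + mean_out v \<le> \<beta> / (d - \<theta>) * (p / \<gamma> + 3 * \<tau> + \<theta> * (2 + Q))"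
proof -
  define F where "F = real (card (V \<inter> {..v - 1})) / real (v - 1)"
  have c: "0 \<le> \<beta> / (d - \<theta>)" using beta d_theta by simp
  have split: "{w\<in>V. v < w} = {w\<in>V. v < w \<and> w \<le> K} \<union> {w\<in>V. K < w}" using assms by auto
  have "rw v = (\<Sum>w\<in>{w\<in>V. v < w \<and> w \<le> K}. 1 / real (w - 1)) + rw K"
    unfolding rw_def split by (rule sum.union_disjoint) (use finV in auto)
  also have "(\<Sum>w\<in>{w\<in>V. v < w \<and> w \<le> K}. 1 / real (w - 1)) \<le> (\<Sum>w\<in>{w\<in>V. v < w \<and> w \<le> K}. 2 * (1 / real w))"
  proof (rule sum_mono)
    fix w assume "w \<in> {w\<in>V. v < w \<and> w \<le> K}"
    then have "2 < w" using vertex_gt[of w] L by auto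
    then show "1 / real (w - 1) \<le> 2 * (1 / real w)" by (simp add: field_simps of_nat_diff)
  qed
  also have "\<dots> = 2 * (\<Sum>w\<in>{w\<in>V. v < w \<and> w \<le> K}. 1 / real w)" by (simp only: sum_distrib_left)
  also have "(\<Sum>w\<in>{w\<in>V. v < w \<and> w \<le> K}. 1 / real w) \<le> (\<Sum>w\<in>V \<inter> {..K}. 1 / real w)"
    using finV by (intro sum_mono2) auto
  also have "rw K \<le> p / \<gamma> * (1 - s K) + \<theta> * (2 + Q)" using rw_bound[of K] K by auto
  finally have "rw v \<le> 2 * \<tau> + (p / \<gamma> * (1 - s K) + \<theta> * (2 + Q))" using early by simp
  moreover have "p / \<gamma> * (1 - s K) \<le> p / \<gamma> * 1"
    using s_bounds[of K] gamma_pos p by (intro mult_left_mono) auto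
  ultimately have r: "rw v \<le> p / \<gamma> + 2 * \<tau> + \<theta> * (2 + Q)" by simp
  have "mean_in v + mean_out v \<le> \<beta> / (d - \<theta>) * F + \<beta> / (d - \<theta>) * rw v"
    using mean_in_le[OF assms(1), folded F_def] mean_out_le_rw[of v] by linarith
  also have "\<dots> = \<beta> / (d - \<theta>) * (F + rw v)"
    by (simp only: distrib_left)
  also have "\<dots> \<le> \<beta> / (d - \<theta>) * (p / \<gamma> + 3 * \<tau> + \<theta> * (2 + Q))"
    using r early_fraction[OF assms, folded F_def] by (intro mult_left_mono[OF _ c]) linarith
  finally show ?thesis .
qed

text \<open>Taken at \<open>K\<close> because only edges to vertices born after \<open>K\<close> are
  counted in the lower bound; the same mean then serves every \<open>v \<le> K\<close>.\<close>

lemma mean_out_ge: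
  shows "\<beta> / (d + \<theta>) * (p / \<gamma> * (1 - s K) - \<theta> * (2 + Q)) \<le> mean_out K"
proof -
  have "\<beta> / (d + \<theta>) * (p / \<gamma> * (1 - s K) - \<theta> * (2 + Q)) \<le> \<beta> / (d + \<theta>) * rw K"
    using rw_bound[of K] K beta d_theta by (intro mult_left_mono) auto
  also have "\<dots> \<le> mean_out K"
    unfolding mean_out_def rw_def sum_distrib_left by (intro sum_mono q_late(1)) auto
  finally show ?thesis .
qed

lemma mean_in_ge:
  assumes "v \<in> V" "K < v"
  shows "\<beta> / (d + \<theta>) * (d * s (v - 1) - \<theta>) \<le> mean_in v"
proof -
  have "\<beta> / (d + \<theta>) * (d * s (v - 1) - \<theta>) \<le> \<beta> / (d + \<theta>) * (real (card (V \<inter> {..v - 1})) / real (v - 1))"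
    using beta d_theta by (intro mult_left_mono[OF late_fraction(2)[OF assms]]) simp
  also have "\<dots> = real (card (V \<inter> {..v - 1})) * (\<beta> / (d + \<theta>) * (1 / real (v - 1)))" by simp
  also have "\<dots> \<le> mean_in v"
    unfolding mean_in_def below_eq[OF assms(1)] by (rule mult_left_mono[OF q_late(1)[OF assms]]) simp
  finally show ?thesis .
qed

lemma card_early_ge: "(d * s K - \<theta>) * real K \<le> real (card {v\<in>V. v \<le> K})"
proof -
  have "{v\<in>V. v \<le> K} = V \<inter> {..K}" by auto
  then show ?thesis using survivors[of K] K by (auto simp: algebra_simps abs_le_iff)
qed

lemma card_late_ge:
  assumes "K \<le> m" "m \<le> n"
  shows "d * (real n - real m) - 2 * \<theta> * real n \<le> real (card {v\<in>V. m < v})"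
proof -
  have "card V = card (V \<inter> {..m}) + card {v\<in>V. m < v}"
    using finV by (subst card_Un_disjoint[symmetric]) (auto intro!: arg_cong[where f = card])
  moreover have "(d - \<theta>) * real n \<le> real (card V)" using h_bounds(1)[of n] L K V(2) by auto
  moreover have "real (card (V \<inter> {..m})) \<le> d * real m + \<theta> * real n"
  proof -
    have "real (card (V \<inter> {..m})) \<le> d * real m * s m + \<theta> * real m" using survivors[OF assms] by linarith
    also have "\<dots> \<le> d * real m * 1 + \<theta> * real n"
      using s_bounds[OF assms(1)] d_pos theta assms by (intro add_mono mult_left_mono) auto
    finally show ?thesis by simp
  qed
  ultimately show ?thesis by (auto simp: algebra_simps)
qed

end


section \<open>Asymptotics at the extremal degree level\<close>

text \<open>The inverse of the normalisation of the maximum degree. At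
  \<open>k = deg_level x n\<close> one has
  \<open>k * (ln k - a) = ln n + (x - a + o(1)) * ln n / ln (ln n)\<close>, so comparing
  \<open>x\<close> with \<open>a\<close> decides in which direction the difference from
  \<open>ln n\<close> diverges.\<close>

definition deg_level :: "real \<Rightarrow> real \<Rightarrow> real" where
  "deg_level x n = ln n / (ln (ln n))\<^sup>2 * (ln (ln n) + ln (ln (ln n)) + x)"

lemma filterlim_deg_level: "filterlim (deg_level x) at_top at_top"
  unfolding deg_level_def by real_asymp

lemma deg_level_over_self: "((\<lambda>n. deg_level x n / n) \<longlongrightarrow> 0) at_top"
  unfolding deg_level_def by real_asymp

text \<open>The factor 1 is the exponent \<open>\<alpha> = 1\<close> of a union bound over all
  \<open>n\<close> labels.\<close>

lemma deg_level_above: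
  assumes "a < x"
  shows "filterlim (\<lambda>n. deg_level x n * (ln (deg_level x n) - a) - 1 * ln n) at_top at_top"
proof -
  define \<delta> where "\<delta> = x - a"
  have "0 < \<delta>" using assms by (simp add: \<delta>_def)
  then have "filterlim (\<lambda>n. deg_level (a + \<delta>) n * (ln (deg_level (a + \<delta>) n) - a) - 1 * ln n) at_top at_top"
    unfolding deg_level_def by real_asymp
  then show ?thesis by (simp add: \<delta>_def)
qed

text \<open>The leading term is \<open>(1 - \<alpha>) * ln n\<close>, whatever \<open>x\<close> and
  \<open>a\<close> are.\<close>

lemma deg_level_sublinear:
  assumes "\<alpha> < 1"
  shows "filterlim (\<lambda>n. deg_level x n * (ln (deg_level x n) - a) - \<alpha> * ln n) at_top at_top"
  unfolding deg_level_def using assms by real_asymp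

text \<open>The shift by 1 covers rounding the level up to an integer, and the last logarithm covers
  the factor \<open>k\<close> in the upper bound for \<open>fact k\<close>.\<close>

lemma deg_level_below:
  assumes "x < a"
  shows "filterlim (\<lambda>n. ln n - (deg_level x n + 1) * (ln (deg_level x n + 1) - a) - ln (deg_level x n + 1)) at_top at_top"
proof -
  define \<delta> where "\<delta> = a - x"
  have "0 < \<delta>" using assms by (simp add: \<delta>_def)
  then have "filterlim (\<lambda>n. ln n - (deg_level (a - \<delta>) n + 1) * (ln (deg_level (a - \<delta>) n + 1) - a)
      - ln (deg_level (a - \<delta>) n + 1)) at_top at_top"
    unfolding deg_level_def by real_asymp
  then show ?thesis by (simp add: \<delta>_def)
qed

text \<open>The least natural number reaching the level. Negative levels become 0, which agrees with
  degrees being nonnegative.\<close>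

definition deg_ceil :: "real \<Rightarrow> nat \<Rightarrow> nat" where
  "deg_ceil x n = nat \<lceil>deg_level x (real n)\<rceil>"

lemma deg_ceil_le_iff: "deg_ceil x n \<le> k \<longleftrightarrow> deg_level x (real n) \<le> real k"
  unfolding deg_ceil_def by linarith

lemma eventually_deg_level_ge: "eventually (\<lambda>n. C \<le> deg_level x (real n)) sequentially"
  using filterlim_compose[OF filterlim_deg_level filterlim_real_sequentially]
  by (simp add: filterlim_at_top)

lemma deg_ceil_bounds:
  "0 \<le> deg_level x (real n) \<Longrightarrow>
     deg_level x (real n) \<le> real (deg_ceil x n) \<and> real (deg_ceil x n) \<le> deg_level x (real n) + 1"
  unfolding deg_ceil_def by linarith

lemma deg_ceil_over_self: "(\<lambda>n. real (deg_ceil x n) / real n) \<longlonglongrightarrow> 0"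
proof (rule tendsto_sandwich)
  show "\<forall>\<^sub>F n in sequentially. 0 \<le> real (deg_ceil x n) / real n" by simp
  show "\<forall>\<^sub>F n in sequentially. real (deg_ceil x n) / real n \<le> deg_level x (real n) / real n + 1 / real n"
    using eventually_deg_level_ge[of 0 x] eventually_gt_at_top[of 0]
    by eventually_elim (use deg_ceil_bounds in \<open>auto simp: add_divide_distrib[symmetric] intro: divide_right_mono\<close>)
  show "(\<lambda>n. deg_level x (real n) / real n + 1 / real n) \<longlonglongrightarrow> 0"
    using tendsto_add[OF filterlim_compose[OF deg_level_over_self filterlim_real_sequentially] lim_const_over_n[of 1]]
    by simp
qed simp

text \<open>With \<open>a = 1 + ln \<mu>\<close>, the power equals
  \<open>exp (- (k * (ln k - a)))\<close>. Beyond \<open>exp a\<close> the product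
  \<open>k * (ln k - a)\<close> increases, so rounding the level up only helps.\<close>

lemma chernoff_level_tendsto_0:
  assumes "0 < \<mu>"
    and lim: "filterlim (\<lambda>n. deg_level x n * (ln (deg_level x n) - (1 + ln \<mu>)) - \<alpha> * ln n) at_top at_top"
  shows "(\<lambda>n. real n powr \<alpha> * (exp 1 * \<mu> / real (deg_ceil x n)) ^ deg_ceil x n) \<longlonglongrightarrow> 0"
proof (rule tendsto_sandwich)
  define a where "a = 1 + ln \<mu>"
  let ?f = "\<lambda>n. deg_level x (real n) * (ln (deg_level x (real n)) - a) - \<alpha> * ln (real n)"
  show "\<forall>\<^sub>F n in sequentially. 0 \<le> real n powr \<alpha> * (exp 1 * \<mu> / real (deg_ceil x n)) ^ deg_ceil x n"
    using assms by simp
  have "\<forall>\<^sub>F n in sequentially. real n powr \<alpha> * (exp 1 * \<mu> / real (deg_ceil x n)) ^ deg_ceil x n \<le> exp (- ?f n)"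
    using eventually_deg_level_ge[of "max 1 (exp a)" x] eventually_gt_at_top[of 0]
  proof eventually_elim
    case (elim n)
    define y where "y = deg_level x (real n)"
    define k where "k = deg_ceil x n"
    have y: "1 \<le> y" "exp a \<le> y" using elim by (auto simp: y_def)
    have k: "y \<le> real k" using deg_ceil_bounds[of x n] y by (auto simp: y_def k_def)
    have "a \<le> ln y" using y by (subst ln_ge_iff) auto
    moreover have "ln y \<le> ln (real k)" using y k by simp
    ultimately have "y * (ln y - a) \<le> real k * (ln (real k) - a)"
      using y k by (intro mult_mono) auto
    moreover have "(exp 1 * \<mu> / real k) ^ k = exp (- (real k * (ln (real k) - a)))"
    proof -
      have "exp 1 * \<mu> / real k = exp (a - ln (real k))"
        using y k assms(1) by (simp add: a_def exp_diff exp_add)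
      then show ?thesis by (simp add: exp_of_nat_mult[symmetric] algebra_simps)
    qed
    moreover have "real n powr \<alpha> = exp (\<alpha> * ln (real n))" using elim by (simp add: powr_def)
    ultimately show ?case unfolding k_def[symmetric] y_def[symmetric] by (simp add: exp_add[symmetric])
  qed
  then show "\<forall>\<^sub>F n in sequentially. real n powr \<alpha> * (exp 1 * \<mu> / real (deg_ceil x n)) ^ deg_ceil x n \<le> exp (- ?f n)" .
  have "filterlim ?f at_top sequentially"
    using filterlim_compose[OF lim filterlim_real_sequentially] by (simp add: a_def)
  then have "filterlim (\<lambda>n. - ?f n) at_bot sequentially" by (rule filterlim_uminus_at_bot_at_top[THEN filterlim_compose])
  then show "(\<lambda>n. exp (- ?f n)) \<longlonglongrightarrow> 0" by (rule filterlim_compose[OF exp_at_bot])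
qed simp

text \<open>The induction step is \<open>exp 1 \<le> (1 + 1 / k) ^ Suc k\<close>.\<close>

lemma fact_le_stirling:
  assumes "0 < k"
  shows "fact k \<le> exp 1 * real k * (real k / exp 1) ^ k"
  using assms
proof (induction k rule: nat_induct_non_zero)
  case (Suc k)
  have "exp 1 * real k ^ Suc k \<le> real (Suc k) ^ Suc k"
  proof -
    have "1 / real (Suc k) \<le> ln (1 + 1 / real k)"
    proof -
      have "ln (1 - 1 / real (Suc k)) \<le> - (1 / real (Suc k))"
        using Suc ln_le_minus_one[of "1 - 1 / real (Suc k)"] by simp
      moreover have "1 - 1 / real (Suc k) = inverse (1 + 1 / real k)" using Suc by (simp add: field_simps)
      then have "ln (1 - 1 / real (Suc k)) = - ln (1 + 1 / real k)"
        using Suc by (simp only: ln_inverse)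
      ultimately show ?thesis by simp
    qed
    then have "1 \<le> real (Suc k) * ln (1 + 1 / real k)" by (simp add: field_simps)
    then have "exp 1 \<le> exp (real (Suc k) * ln (1 + 1 / real k))" by simp
    also have "\<dots> = (1 + 1 / real k) ^ Suc k" using Suc by (simp only: exp_of_nat_mult) (simp add: add_pos_pos)
    also have "1 + 1 / real k = real (Suc k) / real k" using Suc by (simp add: field_simps)
    finally have "exp 1 \<le> real (Suc k) ^ Suc k / real k ^ Suc k" by (simp only: power_divide)
    then show ?thesis using Suc by (simp add: pos_le_divide_eq del: power_Suc)
  qed
  then have "exp 1 * real k ^ Suc k / exp 1 ^ k \<le> real (Suc k) ^ Suc k / exp 1 ^ k"
    by (rule divide_right_mono) simp
  then have "exp 1 * real k * (real k / exp 1) ^ k \<le> exp 1 * (real (Suc k) / exp 1) ^ Suc k"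
    by (simp add: power_divide)
  with Suc.IH have "fact k \<le> exp 1 * (real (Suc k) / exp 1) ^ Suc k" by linarith
  then have "real (Suc k) * fact k \<le> real (Suc k) * (exp 1 * (real (Suc k) / exp 1) ^ Suc k)"
    by (intro mult_left_mono) auto
  then show ?case by (simp only: fact_Suc of_nat_mult mult_ac)
qed simp

text \<open>Counterpart of the Chernoff estimate: up to a constant, the expected number of vertices
  at the level among \<open>C * n\<close> vertices of Poisson mean \<open>\<mu>\<close>.\<close>

lemma poisson_level_at_top:
  assumes "0 < \<mu>" "x < 1 + ln \<mu>" "0 < C"
  shows "filterlim (\<lambda>n. C * real n * (\<mu> ^ deg_ceil x n / fact (deg_ceil x n))) at_top sequentially"
proof -
  define a where "a = 1 + ln \<mu>"
  let ?f = "\<lambda>n. ln (real n) - (deg_level x (real n) + 1) * (ln (deg_level x (real n) + 1) - a)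
      - ln (deg_level x (real n) + 1)"
  have "filterlim ?f at_top sequentially"
    using filterlim_compose[OF deg_level_below[of x a] filterlim_real_sequentially] assms by (simp add: a_def)
  then have "filterlim (\<lambda>n. C * exp (- 1) * exp (?f n)) at_top sequentially"
    using assms by (intro filterlim_tendsto_pos_mult_at_top[OF tendsto_const] filterlim_compose[OF exp_at_top]) auto
  then show ?thesis
  proof (rule filterlim_at_top_mono)
    show "\<forall>\<^sub>F n in sequentially. C * exp (- 1) * exp (?f n) \<le> C * real n * (\<mu> ^ deg_ceil x n / fact (deg_ceil x n))"
      using eventually_deg_level_ge[of "max 1 (exp a)" x] eventually_gt_at_top[of 0]
    proof eventually_elim
      case (elim n)
      define y where "y = deg_level x (real n)"
      define k where "k = deg_ceil x n"
      have y: "1 \<le> y" "exp a \<le> y" using elim by (auto simp: y_def)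
      have k: "y \<le> real k" "real k \<le> y + 1" "0 < k"
        using deg_ceil_bounds[of x n] y by (auto simp: y_def k_def)
      have "exp a \<le> real k" using y k by linarith
      then have "a \<le> ln (real k)" using k by (subst ln_ge_iff) auto
      moreover have l: "ln (real k) \<le> ln (y + 1)" using y k by simp
      ultimately have "real k * (ln (real k) - a) \<le> (y + 1) * (ln (y + 1) - a)"
        using y k by (intro mult_mono) auto
      then have "- 1 + (ln (real n) - (y + 1) * (ln (y + 1) - a) - ln (y + 1)) \<le>
          ln (real n) + (real k * ln \<mu> - (1 + ln (real k) + real k * (ln (real k) - 1)))"
        using l by (simp add: a_def algebra_simps)
      then have "exp (- 1 + (ln (real n) - (y + 1) * (ln (y + 1) - a) - ln (y + 1))) \<le>
          exp (ln (real n) + (real k * ln \<mu> - (1 + ln (real k) + real k * (ln (real k) - 1))))"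
        by (simp only: exp_le_cancel_iff)
      also have "\<dots> = real n * (\<mu> ^ k / (exp 1 * real k * (real k / exp 1) ^ k))"
      proof -
        have "exp (real k * ln \<mu>) = \<mu> ^ k" using assms by (simp add: exp_of_nat_mult)
        moreover have "exp (real k * (ln (real k) - 1)) = (real k / exp 1) ^ k"
          using k by (simp add: exp_of_nat_mult exp_diff)
        ultimately show ?thesis using elim k by (simp add: exp_add exp_diff)
      qed
      also have "\<dots> \<le> real n * (\<mu> ^ k / fact k)"
        using fact_le_stirling[OF k(3)] assms k
        by (intro mult_left_mono divide_left_mono) (auto intro!: mult_pos_pos)
      finally have "exp (- 1) * exp (?f n) \<le> real n * (\<mu> ^ k / fact k)"
        unfolding y_def by (simp only: exp_add)
      then show ?case using assms unfolding k_def
        by (simp only: mult.assoc mult_le_cancel_left_pos)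
    qed
  qed
qed


section \<open>Degrees given the vertex process\<close>

definition in_pairs :: "nat set \<Rightarrow> nat \<Rightarrow> (nat \<times> nat) set" where
  "in_pairs V v = (\<lambda>u. (u, v)) ` {u\<in>V. u < v}"

text \<open>The cutoff \<open>K\<close> keeps younger ends whose attachment probabilities are small;
  \<open>K = 0\<close> keeps all of them, since \<open>v < w\<close> forces
  \<open>0 < w\<close>.\<close>

definition out_pairs :: "nat set \<Rightarrow> nat \<Rightarrow> nat \<Rightarrow> (nat \<times> nat) set" where
  "out_pairs V K v = (\<lambda>w. (v, w)) ` {w\<in>V. v < w \<and> K < w}"

lemma in_pairs_subset: "v \<in> V \<Longrightarrow> in_pairs V v \<subseteq> ordered_pairs V"
  and out_pairs_subset: "v \<in> V \<Longrightarrow> out_pairs V K v \<subseteq> ordered_pairs V"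
  by (auto simp: in_pairs_def out_pairs_def ordered_pairs_def)

lemma edge_graph_of_iff:
  "{u, v} \<in> edges (graph_of V b) \<longleftrightarrow>
     u \<in> V \<and> v \<in> V \<and> (u < v \<and> b (u, v) \<or> v < u \<and> b (v, u))"
  by (auto simp: graph_of_def doubleton_eq_iff)

lemma deg_minus_graph_of:
  assumes "v \<in> V"
  shows "deg_minus (graph_of V b) v = card {e \<in> in_pairs V v. b e}"
proof -
  have "{u \<in> neighbours (graph_of V b) v. u < v} = {u \<in> V. u < v \<and> b (u, v)}"
    unfolding neighbours_def edge_graph_of_iff using assms by (auto simp: graph_of_def)
  moreover have "{e \<in> in_pairs V v. b e} = (\<lambda>u. (u, v)) ` {u \<in> V. u < v \<and> b (u, v)}"
    by (auto simp: in_pairs_def)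
  ultimately show ?thesis by (simp add: deg_minus_def card_image inj_on_def)
qed

lemma deg_plus_graph_of:
  assumes "v \<in> V"
  shows "deg_plus (graph_of V b) v = card {e \<in> out_pairs V 0 v. b e}"
proof -
  have "{u \<in> neighbours (graph_of V b) v. u > v} = {u \<in> V. v < u \<and> b (v, u)}"
    unfolding neighbours_def edge_graph_of_iff using assms by (auto simp: graph_of_def)
  moreover have "{e \<in> out_pairs V 0 v. b e} = (\<lambda>u. (v, u)) ` {u \<in> V. v < u \<and> b (v, u)}"
    by (auto simp: out_pairs_def)
  ultimately show ?thesis by (simp add: deg_plus_def card_image inj_on_def)
qed

lemma deg_sum_graph_of:
  assumes "finite V" "v \<in> V"
  shows "deg_sum (graph_of V b) v = card {e \<in> in_pairs V v \<union> out_pairs V 0 v. b e}"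
proof -
  have "{e \<in> in_pairs V v \<union> out_pairs V 0 v. b e} = {e \<in> in_pairs V v. b e} \<union> {e \<in> out_pairs V 0 v. b e}"
    by auto
  moreover have "{e \<in> in_pairs V v. b e} \<inter> {e \<in> out_pairs V 0 v. b e} = {}"
    by (auto simp: in_pairs_def out_pairs_def)
  moreover have "finite (in_pairs V v)" "finite (out_pairs V 0 v)"
    using assms by (auto simp: in_pairs_def out_pairs_def)
  ultimately show ?thesis
    unfolding deg_sum_def deg_plus_graph_of[OF assms(2)] deg_minus_graph_of[OF assms(2)]
    by (simp add: card_Un_disjoint)
qed

lemma sum_in_pairs: "(\<Sum>e\<in>in_pairs V v. q (snd e)) = real (card {u\<in>V. u < v}) * q v"
  unfolding in_pairs_def by (subst sum.reindex) (auto simp: inj_on_def)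

lemma sum_out_pairs: "(\<Sum>e\<in>out_pairs V K v. q (snd e)) = (\<Sum>w\<in>{w\<in>V. v < w \<and> K < w}. q w)"
  unfolding out_pairs_def by (subst sum.reindex) (auto simp: inj_on_def)

lemma sum_in_out_pairs:
  assumes "finite V"
  shows "(\<Sum>e\<in>in_pairs V v \<union> out_pairs V 0 v. q (snd e)) =
    real (card {u\<in>V. u < v}) * q v + (\<Sum>w\<in>{w\<in>V. v < w}. q w)"
proof -
  have "(\<Sum>e\<in>in_pairs V v \<union> out_pairs V 0 v. q (snd e)) =
      (\<Sum>e\<in>in_pairs V v. q (snd e)) + (\<Sum>e\<in>out_pairs V 0 v. q (snd e))"
    by (rule sum.union_disjoint) (use assms in \<open>auto simp: in_pairs_def out_pairs_def\<close>)
  also have "{w\<in>V. v < w} = {w\<in>V. v < w \<and> 0 < w}" by auto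
  ultimately show ?thesis by (simp only: sum_in_pairs sum_out_pairs)
qed

text \<open>Averages a bound for fixed \<open>(V, h)\<close> over the vertex process; on the
  exceptional set \<open>A\<close> the probability is estimated by 1.\<close>

lemma prob_drgvr_law_le:
  assumes "\<And>V h. (V, h) \<in> set_pmf (vertex_chain p n) \<Longrightarrow> (V, h) \<notin> A \<Longrightarrow>
      measure_pmf.prob (edge_pmf V (attach_prob \<beta> h)) {b. graph_of V b \<in> S} \<le> r"
    and "0 \<le> r"
  shows "drgvr_prob \<beta> p n S \<le> chain_prob p n A + r"
proof -
  let ?P = "\<lambda>s. measure_pmf.prob (case s of (V, h) \<Rightarrow> independent_graph V (attach_prob \<beta> h)) S"
  have "drgvr_prob \<beta> p n S = chain_expectation p n ?P"
  proof -
    have "ennreal (drgvr_prob \<beta> p n S) = (\<integral>\<^sup>+s. ennreal (?P s) \<partial>vertex_chain p n)"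
      unfolding drgvr_law_eq_vertex_chain measure_pmf.emeasure_eq_measure[symmetric] by simp
    also have "\<dots> = ennreal (chain_expectation p n ?P)"
      by (rule nn_integral_eq_integral) auto
    finally show ?thesis by simp
  qed
  also have "\<dots> \<le> chain_expectation p n (\<lambda>s. indicator A s + r)"
  proof (rule expectation_vertex_chain_mono)
    fix V h assume s: "(V, h) \<in> set_pmf (vertex_chain p n)"
    show "?P (V, h) \<le> indicator A (V, h) + r"
    proof (cases "(V, h) \<in> A")
      case True
      show ?thesis
        by (rule order.trans[OF measure_pmf.prob_le_1]) (use True assms(2) in simp)
    next
      case False
      then show ?thesis using assms(1)[OF s]
        by (simp add: independent_graph_def vimage_def)
    qed
  qed
  also have "\<dots> = chain_prob p n A + r" by simp
  finally show ?thesis .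
qed

lemma tendsto_0_if_eventually_le:
  fixes f :: "nat \<Rightarrow> real"
  assumes "\<And>n. 0 \<le> f n" "\<And>e. 0 < e \<Longrightarrow> eventually (\<lambda>n. f n \<le> e) sequentially"
  shows "f \<longlonglongrightarrow> 0"
proof (rule LIMSEQ_I)
  fix r :: real assume "0 < r"
  then have "eventually (\<lambda>n. f n \<le> r / 2) sequentially" by (intro assms) simp
  then have "eventually (\<lambda>n. norm (f n - 0) < r) sequentially"
    by eventually_elim (use assms(1) \<open>0 < r\<close> in \<open>auto simp: abs_of_nonneg\<close>)
  then show "\<exists>N. \<forall>n\<ge>N. norm (f n - 0) < r" by (simp add: eventually_sequentially)
qed

text \<open>Union bound over the at most \<open>n powr \<alpha>\<close> vertices satisfying
  \<open>R\<close>, each treated by Chernoff with mean at most \<open>\<mu>\<close>. The parameter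
  \<open>inc\<close> makes the argument independent of the kind of degree.\<close>

lemma prob_high_degree_tendsto_0:
  fixes R :: "nat \<Rightarrow> nat \<Rightarrow> bool"
  assumes p: "0 \<le> p" "p \<le> 1" "0 < \<beta>" "0 < \<mu>"
    and deg: "\<And>V b v. finite V \<Longrightarrow> v \<in> V \<Longrightarrow> dg (graph_of V b) v = card {e \<in> inc V v. b e}"
    and inc: "\<And>V v. v \<in> V \<Longrightarrow> inc V v \<subseteq> ordered_pairs V"
    and mean: "\<And>e. 0 < e \<Longrightarrow> eventually (\<lambda>n. chain_prob p n
        {(V, h). \<exists>v\<in>V. R n v \<and> \<mu> < (\<Sum>e\<in>inc V v. attach_prob \<beta> h (snd e))} \<le> e) sequentially"
    and R: "eventually (\<lambda>n. real (card {v\<in>{1..n}. R n v}) \<le> real n powr \<alpha>) sequentially"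
    and lim: "filterlim (\<lambda>n. deg_level x n * (ln (deg_level x n) - (1 + ln \<mu>)) - \<alpha> * ln n) at_top at_top"
  shows "(\<lambda>n. drgvr_prob \<beta> p n {g. \<exists>v\<in>verts g. R n v \<and> deg_ceil x n \<le> dg g v}) \<longlonglongrightarrow> 0"
proof (rule tendsto_0_if_eventually_le)
  fix r :: real assume r: "0 < r"
  let ?bad = "\<lambda>n. {(V, h). \<exists>v\<in>V. R n v \<and> \<mu> < (\<Sum>e\<in>inc V v. attach_prob \<beta> h (snd e))}"
  have "eventually (\<lambda>n. chain_prob p n (?bad n) \<le> r / 2) sequentially"
    using r by (intro mean) simp
  moreover have "eventually (\<lambda>n. real n powr \<alpha> * (exp 1 * \<mu> / real (deg_ceil x n)) ^ deg_ceil x n < r / 2) sequentially"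
    using chernoff_level_tendsto_0[OF p(4) lim] r by (intro order_tendstoD) auto
  ultimately show "eventually (\<lambda>n. drgvr_prob \<beta> p n {g. \<exists>v\<in>verts g. R n v \<and> deg_ceil x n \<le> dg g v} \<le> r) sequentially"
    using R eventually_deg_level_ge[of \<mu> x]
  proof eventually_elim
    case (elim n)
    define k where "k = deg_ceil x n"
    have k: "\<mu> \<le> real k" using elim(4) deg_ceil_bounds[of x n] p(4) by (auto simp: k_def)
    have "drgvr_prob \<beta> p n {g. \<exists>v\<in>verts g. R n v \<and> k \<le> dg g v} \<le>
      chain_prob p n (?bad n) + real n powr \<alpha> * (exp 1 * \<mu> / real k) ^ k"
    proof (rule prob_drgvr_law_le)
      fix V h assume s: "(V, h) \<in> set_pmf (vertex_chain p n)" and nb: "(V, h) \<notin> ?bad n"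
      have V: "V \<subseteq> {1..n}" using vertex_chain_support[OF s] by blast
      then have fin: "finite V" by (rule finite_subset) simp
      define q where "q = attach_prob \<beta> h"
      have q: "0 \<le> q v \<and> q v \<le> 1" for v using p(3) by (auto simp: q_def attach_prob_def)
      define B where "B = {v\<in>V. R n v}"
      have finB: "finite B" using fin by (simp add: B_def)
      have "{b. graph_of V b \<in> {g. \<exists>v\<in>verts g. R n v \<and> k \<le> dg g v}} = (\<Union>v\<in>B. {b. k \<le> card {e\<in>inc V v. b e}})"
        using deg[OF fin] by (auto simp: B_def graph_of_def)
      then have "measure_pmf.prob (edge_pmf V q) {b. graph_of V b \<in> {g. \<exists>v\<in>verts g. R n v \<and> k \<le> dg g v}}
        \<le> (\<Sum>v\<in>B. measure_pmf.prob (edge_pmf V q) {b. k \<le> card {e\<in>inc V v. b e}})"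
        by (simp only:) (rule measure_pmf.finite_measure_subadditive_finite[OF finB], simp)
      also have "\<dots> \<le> (\<Sum>v\<in>B. (exp 1 * \<mu> / real k) ^ k)"
      proof (rule sum_mono)
        fix v assume "v \<in> B"
        then have v: "v \<in> V" "R n v" by (auto simp: B_def)
        show "measure_pmf.prob (edge_pmf V q) {b. k \<le> card {e\<in>inc V v. b e}} \<le> (exp 1 * \<mu> / real k) ^ k"
          unfolding edge_pmf_def
        proof (rule prob_bernoulli_count_ge)
          show "(\<Sum>e\<in>inc V v. q (snd e)) \<le> \<mu>" using nb v by (force simp: q_def)
        qed (use fin inc[OF v(1)] q k p(4) in auto)
      qed
      also have "\<dots> = real (card B) * (exp 1 * \<mu> / real k) ^ k" by simp
      also have "\<dots> \<le> real n powr \<alpha> * (exp 1 * \<mu> / real k) ^ k"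
      proof (rule mult_right_mono)
        have "card B \<le> card {v\<in>{1..n}. R n v}" unfolding B_def using V by (intro card_mono) auto
        then show "real (card B) \<le> real n powr \<alpha>" using elim(3) by linarith
      qed (use p(4) in simp)
      finally show "measure_pmf.prob (edge_pmf V (attach_prob \<beta> h)) {b. graph_of V b \<in> {g. \<exists>v\<in>verts g. R n v \<and> k \<le> dg g v}}
        \<le> real n powr \<alpha> * (exp 1 * \<mu> / real k) ^ k" by (simp add: q_def)
    qed (use p(4) in simp)
    then show ?case using elim(1,2) unfolding k_def by linarith
  qed
qed simp

text \<open>Linearly many vertices of mean at least \<open>\<mu>'\<close> have independent counts on
  their disjoint sets \<open>inc n V v\<close>, and each hits the level with probability at least a
  constant times \<open>\<mu> ^ k / fact k\<close>. The conclusion is for a fixed \<open>r\<close>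
  because \<open>C\<close>, \<open>\<sigma>\<close> and the typical event will depend on the
  tolerated error.\<close>

lemma eventually_prob_no_high_degree_le:
  assumes p: "0 \<le> p" "p \<le> 1" "0 < \<beta>" "0 < \<mu>" "x < 1 + ln \<mu>"
    and deg: "\<And>V b v n. finite V \<Longrightarrow> v \<in> V \<Longrightarrow> card {e \<in> inc n V v. b e} \<le> dg (graph_of V b) v"
    and inc: "\<And>V v n. v \<in> V \<Longrightarrow> inc n V v \<subseteq> ordered_pairs V" "\<And>V v n. finite V \<Longrightarrow> card (inc n V v) \<le> card V"
    and disj: "\<And>V n. disjoint_family_on (inc n V) V"
    and C: "0 < C" and \<sigma>: "0 < \<sigma>" and \<mu>': "\<mu> < \<mu>'"
    and mean: "eventually (\<lambda>n. chain_prob p n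
        {(V, h). \<not> (\<exists>B\<subseteq>V. C * real n \<le> real (card B) \<and> (\<forall>v\<in>B.
           \<mu>' \<le> (\<Sum>e\<in>inc n V v. attach_prob \<beta> h (snd e)) \<and>
           (\<forall>e\<in>inc n V v. attach_prob \<beta> h (snd e) \<le> \<sigma> / real n)))} \<le> r) sequentially"
    and r: "0 < r"
  shows "eventually (\<lambda>n. drgvr_prob \<beta> p n {g. \<forall>v\<in>verts g. dg g v < deg_ceil x n} \<le> 2 * r) sequentially"
proof -
  let ?bad = "\<lambda>n. {(V, h). \<not> (\<exists>B\<subseteq>V. C * real n \<le> real (card B) \<and> (\<forall>v\<in>B.
           \<mu>' \<le> (\<Sum>e\<in>inc n V v. attach_prob \<beta> h (snd e)) \<and>
           (\<forall>e\<in>inc n V v. attach_prob \<beta> h (snd e) \<le> \<sigma> / real n)))}"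
  \<comment> \<open>\<open>exp (- 2 * \<sigma>)\<close> is a lower bound for
    \<open>(1 - \<sigma> / n) ^ n\<close> once \<open>2 * \<sigma> \<le> n\<close>.\<close>
  define C' where "C' = C * exp (- 2 * \<sigma>)"
  have C': "0 < C'" using C by (simp add: C'_def)
  have "(\<lambda>n. exp (- (C' * real n * (\<mu> ^ deg_ceil x n / fact (deg_ceil x n))))) \<longlonglongrightarrow> 0"
    by (rule filterlim_compose[OF exp_at_bot])
       (rule filterlim_uminus_at_bot_at_top[THEN filterlim_compose], rule poisson_level_at_top[OF p(4,5) C'])
  then have "eventually (\<lambda>n. exp (- (C' * real n * (\<mu> ^ deg_ceil x n / fact (deg_ceil x n)))) < r) sequentially"
    using r by (rule order_tendstoD)
  moreover have "eventually (\<lambda>n. real (deg_ceil x n) / real n < (\<mu>' - \<mu>) / \<sigma>) sequentially"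
    using deg_ceil_over_self[of x] \<mu>' \<sigma> by (intro order_tendstoD) auto
  moreover have "eventually (\<lambda>n. 2 * \<sigma> \<le> real n) sequentially"
    using filterlim_real_sequentially by (simp add: filterlim_at_top)
  ultimately show ?thesis using mean eventually_gt_at_top[of 0]
  proof eventually_elim
    case (elim n)
    define k where "k = deg_ceil x n"
    define t where "t = \<sigma> / real n"
    have t: "0 \<le> t" "t \<le> 1 / 2" using elim(3,5) \<sigma> by (auto simp: t_def divide_le_eq)
    have "drgvr_prob \<beta> p n {g. \<forall>v\<in>verts g. dg g v < k} \<le>
      chain_prob p n (?bad n) + exp (- (C' * real n * (\<mu> ^ k / fact k)))"
    proof (rule prob_drgvr_law_le)
      fix V h assume s: "(V, h) \<in> set_pmf (vertex_chain p n)" and nb: "(V, h) \<notin> ?bad n"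
      have V: "V \<subseteq> {1..n}" using vertex_chain_support[OF s] by blast
      then have fin: "finite V" by (rule finite_subset) simp
      have cV: "card V \<le> n" using card_mono[OF _ V] by simp
      define q where "q = attach_prob \<beta> h"
      have q: "0 \<le> q v \<and> q v \<le> 1" for v using p(3) by (auto simp: q_def attach_prob_def)
      obtain B where B: "B \<subseteq> V" "C * real n \<le> real (card B)"
        "\<And>v. v \<in> B \<Longrightarrow> \<mu>' \<le> (\<Sum>e\<in>inc n V v. q (snd e))"
        "\<And>v e. v \<in> B \<Longrightarrow> e \<in> inc n V v \<Longrightarrow> q (snd e) \<le> t"
        using nb unfolding q_def t_def by auto
      have finB: "finite B" using B(1) fin by (rule finite_subset)
      define \<rho> where "\<rho> = exp (- 2 * \<sigma>) * \<mu> ^ k / fact k"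
      have "measure_pmf.prob (edge_pmf V q) {b. graph_of V b \<in> {g. \<forall>v\<in>verts g. dg g v < k}} \<le>
        measure_pmf.prob (edge_pmf V q) {b. \<forall>v\<in>B. card {e\<in>inc n V v. b e} < k}"
      proof (rule measure_pmf.finite_measure_mono)
        show "{b. graph_of V b \<in> {g. \<forall>v\<in>verts g. dg g v < k}} \<subseteq> {b. \<forall>v\<in>B. card {e\<in>inc n V v. b e} < k}"
        proof safe
          fix b v assume *: "\<forall>v\<in>verts (graph_of V b). dg (graph_of V b) v < k" "v \<in> B"
          then have "v \<in> V" using B(1) by blast
          with * have "dg (graph_of V b) v < k" by (simp add: graph_of_def)
          then show "card {e\<in>inc n V v. b e} < k" using deg[OF fin \<open>v \<in> V\<close>, of n b] by linarith
        qed
      qed simp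
      also have "\<dots> \<le> exp (- \<rho> * real (card B))"
        unfolding edge_pmf_def
      proof (rule prob_all_bernoulli_count_less[OF finite_ordered_pairs[OF fin] finB])
        show "disjoint_family_on (inc n V) B" by (rule disjoint_family_on_mono[OF B(1) disj])
        show "inc n V v \<subseteq> ordered_pairs V" if "v \<in> B" for v using that B(1) inc by blast
        show "\<rho> \<le> pmf (bernoulli_count (inc n V v) (\<lambda>e. q (snd e))) k" if v: "v \<in> B" for v
        proof -
          have vV: "v \<in> V" using v B(1) by blast
          have finI: "finite (inc n V v)" using inc(1)[OF vV] fin finite_ordered_pairs finite_subset by blast
          \<comment> \<open>The gap between \<open>\<mu>\<close> and \<open>\<mu>'\<close> pays for
            the barred mass \<open>k * t\<close>, because \<open>k / n\<close> tends to 0.\<close>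
          have "real k * t \<le> \<mu>' - \<mu>"
          proof -
            have "real k / real n * \<sigma> \<le> (\<mu>' - \<mu>) / \<sigma> * \<sigma>"
              using elim(2) \<sigma> unfolding k_def by (intro mult_right_mono) auto
            then show ?thesis using \<sigma> by (simp add: t_def)
          qed
          then have m: "\<mu> \<le> (\<Sum>e\<in>inc n V v. q (snd e)) - real k * t" using B(3)[OF v] by linarith
          have "exp (- 2 * \<sigma>) = exp (- 2 * t) ^ n"
            using elim(5) by (simp add: exp_of_nat_mult[symmetric] t_def)
          also have "\<dots> \<le> exp (- 2 * t) ^ card (inc n V v)"
            using inc(2)[OF fin, of n v] cV t by (intro power_decreasing) auto
          also have "\<dots> \<le> (1 - t) ^ card (inc n V v)"
          proof (rule power_mono)
            show "exp (- 2 * t) \<le> 1 - t" by (rule exp_le_one_minus[OF t])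
          qed simp
          finally have e: "exp (- 2 * \<sigma>) \<le> (1 - t) ^ card (inc n V v)" .
          have "\<rho> \<le> (1 - t) ^ card (inc n V v) * max 0 ((\<Sum>e\<in>inc n V v. q (snd e)) - real k * t) ^ k / fact k"
            unfolding \<rho>_def using e m p(4) t
            by (intro divide_right_mono mult_mono power_mono) auto
          also have "\<dots> \<le> pmf (bernoulli_count (inc n V v) (\<lambda>e. q (snd e))) k"
            by (rule pmf_bernoulli_count_ge[OF finI]) (use B(4)[OF v] q t in auto)
          finally show ?thesis .
        qed
      qed
      also have "\<dots> \<le> exp (- (C' * real n * (\<mu> ^ k / fact k)))"
      proof -
        have "\<rho> * (C * real n) \<le> \<rho> * real (card B)"
          using B(2) p(4) by (intro mult_left_mono) (auto simp: \<rho>_def)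
        then show ?thesis by (simp add: \<rho>_def C'_def mult_ac)
      qed
      finally show "measure_pmf.prob (edge_pmf V (attach_prob \<beta> h)) {b. graph_of V b \<in> {g. \<forall>v\<in>verts g. dg g v < k}}
        \<le> exp (- (C' * real n * (\<mu> ^ k / fact k)))" by (simp add: q_def)
    qed simp
    then show ?case using elim(1,4) unfolding k_def by linarith
  qed
qed


section \<open>Typical vertex processes have high probability\<close>

text \<open>Order of choices: \<open>Q\<close> from \<open>e\<close> and \<open>\<tau>\<close>
  through the early weight; then \<open>\<theta>\<close>, which may be tiny compared with
  \<open>1 / Q\<close>; then \<open>L\<close> from \<open>\<theta>\<close> and \<open>e\<close>;
  finally \<open>n\<close>. Four failure events receive \<open>e / 4\<close> each.\<close>

lemma good_state_whp:
  fixes p \<beta> d \<gamma> e \<tau> :: real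
  assumes p: "1 / 2 < p" "p < 1" and beta: "0 < \<beta>" and d_def: "d = 2 * p - 1"
    and \<gamma>_def: "\<gamma> = (1 - p) / d" and e: "0 < e" and \<tau>: "0 < \<tau>"
  shows "eventually (\<lambda>Q. \<forall>\<theta>. 0 < \<theta> \<and> \<theta> \<le> d / 2 \<longrightarrow> (\<exists>L. eventually (\<lambda>n.
    chain_prob p n
      {(V, h). \<not> good_state p \<beta> \<theta> \<tau> Q n (nat \<lceil>real n / Q\<rceil>) L V h d \<gamma>} \<le> e) sequentially)) at_top"
proof -
  have d: "0 < d" "d \<le> 1" using p by (auto simp: d_def)
  have g: "0 < \<gamma>" using p d by (simp add: \<gamma>_def)
  have "((\<lambda>Q. (3 / Q) powr (1 - p) / (1 - p) / \<tau>) \<longlongrightarrow> 0) at_top"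
    using p \<tau> by real_asymp
  then have "eventually (\<lambda>Q. (3 / Q) powr (1 - p) / (1 - p) / \<tau> < e / 4) at_top"
    using e by (intro order_tendstoD) auto
  then show ?thesis using eventually_ge_at_top[of 2]
  proof (eventually_elim, intro allI impI, elim conjE)
    fix Q \<theta> :: real
    assume Q: "(3 / Q) powr (1 - p) / (1 - p) / \<tau> < e / 4" "2 \<le> Q" and \<theta>: "0 < \<theta>" "\<theta> \<le> d / 2"
    have \<theta>1: "\<theta> \<le> 1" using \<theta> d by simp
    \<comment> \<open>Chosen so that the bound of \<open>prob_card_deviation\<close> is at most
      \<open>e / 4\<close>.\<close>
    define L where "L = nat \<lceil>128 / \<theta> ^ 3 / (e / 4)\<rceil> + 1"
    have L: "0 < L" "8 / real L / (\<theta> ^ 3 / 16) \<le> e / 4"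
    proof -
      show "0 < L" by (simp add: L_def)
      have "128 / \<theta> ^ 3 / (e / 4) \<le> real L" unfolding L_def by linarith
      moreover have "y \<le> real L * (e / 4)" if "y / (e / 4) \<le> real L" for y
        using that e by (simp add: field_simps)
      ultimately have "128 / \<theta> ^ 3 \<le> real L * (e / 4)" by blast
      then have "128 / \<theta> ^ 3 / real L \<le> e / 4"
        using \<open>0 < L\<close> by (subst pos_divide_le_eq) (auto simp: mult.commute)
      then show "8 / real L / (\<theta> ^ 3 / 16) \<le> e / 4" by (simp add: mult.commute)
    qed
    define K where "K n = nat \<lceil>real n / Q\<rceil>" for n
    \<comment> \<open>A single vertex \<open>w \<le> 2 * L + 1\<close> already has weight above
      \<open>\<tau>'\<close>; so total weight at most \<open>\<tau>'\<close> up to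
      \<open>2 * L + 1\<close> means that no such vertex survives.\<close>
    define \<tau>' where "\<tau>' = 1 / (2 * real L + 2)"
    have \<tau>': "0 < \<tau>'" by (simp add: \<tau>'_def)
    have "((\<lambda>x. (real (2 * L + 2) / x) powr (1 - p) / (1 - p) / \<tau>') \<longlongrightarrow> 0) at_top"
      using p \<tau>' by real_asymp
    then have "(\<lambda>n. (real (2 * L + 2) / real n) powr (1 - p) / (1 - p) / \<tau>') \<longlonglongrightarrow> 0"
      by (rule filterlim_compose[OF _ filterlim_real_sequentially])
    then have E4: "eventually (\<lambda>n. (real (2 * L + 2) / real n) powr (1 - p) / (1 - p) / \<tau>' < e / 4) sequentially"
      using e by (intro order_tendstoD) auto
    \<comment> \<open>The bound of \<open>prob_survivors_deviation\<close> with a parameter of order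
      \<open>n\<close>; it decays like \<open>1 / sqrt n\<close>.\<close>
    have "((\<lambda>x. x * (8 / d * (x * sqrt x) / (x / (3 * Q)) ^ 3) / (\<theta> ^ 3 / 16)) \<longlongrightarrow> 0) at_top"
      using d Q(2) \<theta>(1) by real_asymp
    then have "(\<lambda>n. real n * (8 / d * (real n * sqrt (real n)) / (real n / (3 * Q)) ^ 3) / (\<theta> ^ 3 / 16)) \<longlonglongrightarrow> 0"
      by (rule filterlim_compose[OF _ filterlim_real_sequentially])
    then have E2: "eventually (\<lambda>n. real n * (8 / d * (real n * sqrt (real n)) / (real n / (3 * Q)) ^ 3) / (\<theta> ^ 3 / 16) < e / 4) sequentially"
      using e by (intro order_tendstoD) auto
    \<comment> \<open>One lower bound for \<open>n / Q\<close>, and so for \<open>K n\<close>, that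
      covers all lower bounds which \<open>good_state\<close> requires of \<open>K\<close>; the
      summand 3 leaves room for rounding.\<close>
    define C where "C = 3 + 2 * real L + 2 * \<gamma> + 2 * \<beta> / d"
    have C: "3 \<le> C" "2 * real L + 1 \<le> C" "2 * \<gamma> + 1 \<le> C" "\<beta> \<le> d / 2 * C"
    proof -
      have "2 * \<beta> / d \<le> C" using g by (simp add: C_def)
      then show "\<beta> \<le> d / 2 * C" using d by (simp add: field_simps)
    qed (use g beta d in \<open>simp_all add: C_def\<close>)
    have "eventually (\<lambda>n. Q * C \<le> real n) sequentially"
      using filterlim_real_sequentially by (simp add: filterlim_at_top)
    with E2 E4 have "eventually (\<lambda>n. chain_prob p n
      {(V, h). \<not> good_state p \<beta> \<theta> \<tau> Q n (K n) L V h d \<gamma>} \<le> e) sequentially"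
      using eventually_gt_at_top[of "2 * L + 1"]
    proof eventually_elim
      case (elim n)
      have n: "0 < n" "C \<le> real n / Q" "Q * 3 \<le> real n" "Q \<le> real n"
      proof -
        show "0 < n" using elim(4) by simp
        show "C \<le> real n / Q" using elim(3) Q(2) by (simp add: pos_le_divide_eq mult.commute)
        have "Q * 3 \<le> Q * C" using Q(2) C(1) by (intro mult_left_mono) auto
        then show "Q * 3 \<le> real n" using elim(3) by linarith
        then show "Q \<le> real n" using Q(2) by linarith
      qed
      have Kb: "real n / Q \<le> real (K n)" "real (K n) < real n / Q + 1"
        unfolding K_def using n(2) C(1) by linarith+
      have nQ2: "real n / Q \<le> real n / 2" using Q(2) by (intro divide_left_mono) auto
      have Kn: "K n < n"
      proof -
        have "real n / 2 + 1 \<le> real n" using n(3) Q(2) by simp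
        then show ?thesis using Kb nQ2 by linarith
      qed
      \<comment> \<open>\<open>prob_survivors_deviation\<close> controls times from twice its
        parameter on, so half of \<open>K n\<close> reaches down to \<open>K n\<close>; it is still
        of order \<open>n\<close>.\<close>
      define L' where "L' = K n div 2"
      have L': "0 < L'" "2 * L' \<le> K n" "\<gamma> \<le> real L'" "real n / (3 * Q) \<le> real L'"
      proof -
        have K2: "real (K n) \<le> 2 * real L' + 1"
        proof -
          have "K n \<le> 2 * L' + 1" unfolding L'_def by presburger
          then have "real (K n) \<le> real (2 * L' + 1)" by (simp only: of_nat_le_iff)
          then show ?thesis by simp
        qed
        show "0 < L'" using K2 Kb n(2) C(1) by linarith
        show "2 * L' \<le> K n" unfolding L'_def by simp
        show "\<gamma> \<le> real L'" using K2 Kb n(2) C(3) by linarith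
        have "real n / (3 * Q) = (real n / Q) / 3" by simp
        then show "real n / (3 * Q) \<le> real L'" using K2 Kb n(2) C(1) by linarith
      qed
      let ?E1 = "{(V, h). \<exists>j. 2 * L \<le> j \<and> j \<le> n \<and> \<theta> * real j < \<bar>real (h j) - (2 * p - 1) * real j\<bar>}"
      let ?E2 = "{(V, h). \<exists>m. 2 * L' \<le> m \<and> m \<le> n \<and>
        \<theta> * real m < \<bar>real (card (V \<inter> {..m})) - d * real m * survival ((1 - p) / d) m n\<bar>}"
      let ?E3 = "{(V, h). \<tau> < (\<Sum>w\<in>V \<inter> {..K n}. 1 / real w)}"
      let ?E4 = "{(V, h). \<tau>' < (\<Sum>w\<in>V \<inter> {..2 * L + 1}. 1 / real w)}"
      let ?P = "chain_prob p n"
      have p': "p \<le> 1" "0 \<le> p" using p by auto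
      have "?P ?E1 \<le> e / 4"
        using prob_card_deviation[OF p(1) p'(1) \<theta>(1) \<theta>1 L(1), of n] L(2) by linarith
      moreover have "?P ?E2 \<le> e / 4"
      proof -
        have "?P ?E2 \<le> real n * (8 / d * (real n * sqrt (real n)) / real L' ^ 3) / (\<theta> ^ 3 / 16)"
          by (rule prob_survivors_deviation[OF p(1) p'(1) d_def \<theta>(1) \<theta>1 L'(1)])
             (use L'(3) in \<open>simp add: \<gamma>_def\<close>)
        also have "\<dots> \<le> real n * (8 / d * (real n * sqrt (real n)) / (real n / (3 * Q)) ^ 3) / (\<theta> ^ 3 / 16)"
        proof (intro divide_right_mono mult_left_mono)
          show "8 / d * (real n * sqrt (real n)) / real L' ^ 3 \<le> 8 / d * (real n * sqrt (real n)) / (real n / (3 * Q)) ^ 3"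
            by (rule frac_le) (use L'(4) d n(1) Q(2) in \<open>auto intro!: power_mono\<close>)
        qed (use \<theta> in auto)
        finally show ?thesis using elim(1) by linarith
      qed
      moreover have "?P ?E3 \<le> e / 4"
      proof -
        have "?P ?E3 \<le> (real (Suc (K n)) / real n) powr (1 - p) / (1 - p) / \<tau>"
          by (rule prob_early_weight[OF p'(2) p(2) Kn \<tau>])
        also have "\<dots> \<le> (3 / Q) powr (1 - p) / (1 - p) / \<tau>"
        proof (intro divide_right_mono powr_mono2)
          have "1 \<le> real n / Q" using n(4) Q(2) by (simp add: pos_le_divide_eq)
          then have "real (Suc (K n)) \<le> 3 * (real n / Q)" using Kb by simp
          then show "real (Suc (K n)) / real n \<le> 3 / Q" using n(1) by (simp add: field_simps)
        qed (use p \<tau> in auto)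
        finally show ?thesis using Q(1) by linarith
      qed
      moreover have "?P ?E4 \<le> e / 4"
      proof -
        have "?P ?E4 \<le> (real (Suc (2 * L + 1)) / real n) powr (1 - p) / (1 - p) / \<tau>'"
          by (rule prob_early_weight[OF p'(2) p(2) elim(4) \<tau>'])
        moreover have "Suc (2 * L + 1) = 2 * L + 2" by simp
        ultimately show ?thesis using elim(2) by (simp only:)
      qed
      moreover have "?P {(V, h). \<not> good_state p \<beta> \<theta> \<tau> Q n (K n) L V h d \<gamma>} \<le> ?P (?E1 \<union> (?E2 \<union> (?E3 \<union> ?E4)))"
      proof -
        have sub: "{(V, h). \<not> good_state p \<beta> \<theta> \<tau> Q n (K n) L V h d \<gamma>} \<inter> set_pmf (vertex_chain p n) \<subseteq> ?E1 \<union> (?E2 \<union> (?E3 \<union> ?E4))"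
        proof (rule subsetI, rule ccontr)
          fix x assume x: "x \<in> {(V, h). \<not> good_state p \<beta> \<theta> \<tau> Q n (K n) L V h d \<gamma>} \<inter> set_pmf (vertex_chain p n)"
            and nx: "x \<notin> ?E1 \<union> (?E2 \<union> (?E3 \<union> ?E4))"
          obtain V h where Vh: "x = (V, h)" by (cases x)
          have s: "(V, h) \<in> set_pmf (vertex_chain p n)" using x Vh by auto
          note supp = vertex_chain_support[OF s]
          have fin: "finite V" using supp by (auto intro: finite_subset)
          have "good_state p \<beta> \<theta> \<tau> Q n (K n) L V h d \<gamma>"
          proof
            show "1 / 2 < p" "p < 1" "d = 2 * p - 1" "\<gamma> = (1 - p) / d" "0 < \<beta>" "0 < \<theta>" "\<theta> \<le> d / 2" "0 < L"
              by fact+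
            show "2 * L < K n" using Kb n(2) C(2) by linarith
            show "K n \<le> n" using Kn by simp
            show "real n \<le> Q * real (K n)" using Kb(1) Q(2) by (simp add: pos_divide_le_eq mult.commute)
            show "2 * \<gamma> \<le> real (K n)" using Kb n(2) C(3) by linarith
            have "d / 2 * C \<le> d / 2 * real (K n)" using Kb n(2) d by (intro mult_left_mono) auto
            then show "\<beta> \<le> d / 2 * real (K n)" using C(4) by linarith
            show "V \<subseteq> {1..n}" "h n = card V" using supp by auto
            show "card (V \<inter> {..j}) \<le> h j" if "j \<le> n" for j using supp that by auto
            show "\<bar>real (h j) - d * real j\<bar> \<le> \<theta> * real j" if "2 * L \<le> j" "j \<le> n" for j
              using nx that unfolding Vh d_def by (auto simp: not_less)
            show "\<bar>real (card (V \<inter> {..m})) - d * real m * survival \<gamma> m n\<bar> \<le> \<theta> * real m"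
              if "K n \<le> m" "m \<le> n" for m
              using nx that L'(2) unfolding Vh \<gamma>_def by (auto simp: not_less)
            show "(\<Sum>w\<in>V \<inter> {..K n}. 1 / real w) \<le> \<tau>" using nx unfolding Vh by auto
            show "2 * L + 1 < w" if w: "w \<in> V" for w
            proof (rule ccontr)
              assume "\<not> 2 * L + 1 < w"
              then have w': "w \<in> V \<inter> {..2 * L + 1}" using w by simp
              have w0: "0 < w" using w supp by auto
              have "\<tau>' < 1 / real w" unfolding \<tau>'_def using w' w0 by (intro divide_strict_left_mono) auto
              also have "\<dots> \<le> (\<Sum>w\<in>V \<inter> {..2 * L + 1}. 1 / real w)"
                using w' fin by (intro member_le_sum) auto
              finally show False using nx unfolding Vh by auto
            qed
          qed
          then show False using x Vh by auto
        qed
        have "?P {(V, h). \<not> good_state p \<beta> \<theta> \<tau> Q n (K n) L V h d \<gamma>} =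
            ?P ({(V, h). \<not> good_state p \<beta> \<theta> \<tau> Q n (K n) L V h d \<gamma>} \<inter> set_pmf (vertex_chain p n))"
          by (rule measure_Int_set_pmf[symmetric])
        also have "\<dots> \<le> ?P (?E1 \<union> (?E2 \<union> (?E3 \<union> ?E4)))"
          by (rule measure_pmf.finite_measure_mono[OF sub]) simp
        finally show ?thesis .
      qed
      moreover have "?P (?E1 \<union> (?E2 \<union> (?E3 \<union> ?E4))) \<le> ?P ?E1 + (?P ?E2 + (?P ?E3 + ?P ?E4))"
        by (intro order.trans[OF measure_Un_le] add_left_mono) simp_all
      ultimately show ?case by linarith
    qed
    then show "\<exists>L. eventually (\<lambda>n. chain_prob p n
      {(V, h). \<not> good_state p \<beta> \<theta> \<tau> Q n (nat \<lceil>real n / Q\<rceil>) L V h d \<gamma>} \<le> e) sequentially"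
      unfolding K_def by blast
  qed
qed

lemma ex_small_parameter:
  fixes f :: "real \<Rightarrow> real"
  assumes "(f \<longlongrightarrow> l) (at_right 0)" "l < u" "0 < a"
  shows "\<exists>\<theta>>0. \<theta> \<le> a \<and> f \<theta> < u"
proof -
  have "eventually (\<lambda>\<theta>. f \<theta> < u) (at_right 0)" using assms(1,2) by (rule order_tendstoD)
  moreover have "eventually (\<lambda>\<theta>. \<theta> \<in> {0<..<a}) (at_right 0)" using assms(3) by (rule eventually_at_right_real)
  ultimately have "eventually (\<lambda>\<theta>. 0 < \<theta> \<and> \<theta> \<le> a \<and> f \<theta> < u) (at_right 0)"
    by eventually_elim auto
  then show ?thesis using eventually_happens'[of "at_right (0::real)"] by auto
qed

context good_state
begin

lemma sum_in_out_eq: "(\<Sum>e\<in>in_pairs V v \<union> out_pairs V 0 v. q (snd e)) = mean_in v + mean_out v"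
  unfolding sum_in_out_pairs[OF finV] mean_in_def mean_out_def ..

lemma sum_in_eq: "(\<Sum>e\<in>in_pairs V v. q (snd e)) = mean_in v"
  unfolding sum_in_pairs mean_in_def ..

lemma sum_out_eq: "v \<le> K \<Longrightarrow> (\<Sum>e\<in>out_pairs V K v. q (snd e)) = mean_out K"
  unfolding sum_out_pairs mean_out_def by (rule sum.cong) auto

lemma survival_le: "K \<le> m \<Longrightarrow> m \<le> n \<Longrightarrow> s m \<le> (real m / real n) powr \<gamma>"
  by (rule survival_le_powr) (use gamma_pos K K_pos in auto)

lemma survival_ge:
  assumes "K \<le> m" "m \<le> n" "real n - real m \<le> z * real m"
  shows "exp (- 2 * \<gamma> * z) \<le> s m"
proof -
  have m: "0 < m" using assms K_pos by simp
  have "real (n - m) / real m \<le> z" using assms m by (simp add: pos_divide_le_eq)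
  then have "\<gamma> * (real (n - m) / real m) \<le> \<gamma> * z" using gamma_pos by (intro mult_left_mono) auto
  then have "exp (- 2 * \<gamma> * z) \<le> exp (- 2 * \<gamma> * real (n - m) / real m)" by simp
  also have "\<dots> \<le> s m"
    by (rule survival_ge_exp) (use gamma_pos K m assms in auto)
  finally show ?thesis .
qed

lemma q_le_late:
  assumes "w \<in> V" "K < w"
  shows "q w \<le> (2 * \<beta> * Q / d) / real n"
proof -
  have "2 * \<beta> / d * real n \<le> 2 * \<beta> / d * (Q * real K)"
    using K beta d_pos by (intro mult_left_mono) auto
  then have "2 * \<beta> / (d * real K) \<le> (2 * \<beta> * Q / d) / real n"
    using K_pos d_pos by (simp add: field_simps)
  then show ?thesis using q_late(2)[OF assms] by linarith
qed

end

section \<open>Bounds on mean degrees that hold with high probability\<close>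

locale drgvr_params =
  fixes p \<beta> :: real
  assumes p: "1 / 2 < p" "p < 1" and beta: "0 < \<beta>"
begin

definition "d = 2 * p - 1"
definition "\<gamma> = (1 - p) / d"
definition "c = \<beta> * p / (1 - p)"

abbreviation "good \<theta> \<tau> Q n L V h \<equiv> good_state p \<beta> \<theta> \<tau> Q n (nat \<lceil>real n / Q\<rceil>) L V h d \<gamma>"

lemma d_pos: "0 < d" and gamma_pos: "0 < \<gamma>" and c_pos: "0 < c"
  using p beta by (auto simp: d_def \<gamma>_def c_def)

text \<open>Identifies \<open>c\<close> as the limiting mean out-degree of the oldest vertices:
  \<open>p / \<gamma> = d * (p / (1 - p))\<close>. The inequality, equivalent to
  \<open>1 < p / (1 - p)\<close>, is what makes old vertices win for the total degree.\<close>

lemma c_eq: "\<beta> / d * (p / \<gamma>) = c" and d_less: "d < p / \<gamma>"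
proof -
  have pg: "p / \<gamma> = d * (p / (1 - p))" by (simp add: \<gamma>_def)
  show "\<beta> / d * (p / \<gamma>) = c" unfolding pg using d_pos by (simp add: c_def)
  have "1 < p / (1 - p)" using p by (simp add: less_divide_eq)
  then show "d < p / \<gamma>" unfolding pg using d_pos mult_strict_left_mono[of 1 "p / (1 - p)" d] by simp
qed

text \<open>Hides the choice of parameters: a deterministic consequence may pick
  \<open>\<theta>\<close> after \<open>Q\<close>, but has to hold for every \<open>L\<close>, since
  \<open>L\<close> is dictated by the probability estimate.\<close>

lemma good_imp_whp:
  assumes "0 < e" "0 < \<tau>"
    and "eventually (\<lambda>Q. \<exists>\<theta>>0. \<theta> \<le> d / 2 \<and>
      (\<forall>L. eventually (\<lambda>n. \<forall>V h. good \<theta> \<tau> Q n L V h \<longrightarrow> P n V h) sequentially)) at_top"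
    and B: "\<And>n V h. B n V h \<Longrightarrow> \<not> P n V h"
  shows "eventually (\<lambda>n. chain_prob p n {(V, h). B n V h} \<le> e) sequentially"
proof -
  have "eventually (\<lambda>Q. \<forall>\<theta>. 0 < \<theta> \<and> \<theta> \<le> d / 2 \<longrightarrow> (\<exists>L. eventually (\<lambda>n.
    chain_prob p n {(V, h). \<not> good \<theta> \<tau> Q n L V h} \<le> e) sequentially)) at_top"
    by (rule good_state_whp[OF p beta d_def \<gamma>_def assms(1,2)])
  from eventually_happens'[OF _ eventually_conj[OF this assms(3)]]
  obtain Q \<theta> L where
    1: "eventually (\<lambda>n. chain_prob p n {(V, h). \<not> good \<theta> \<tau> Q n L V h} \<le> e) sequentially"
    and 2: "eventually (\<lambda>n. \<forall>V h. good \<theta> \<tau> Q n L V h \<longrightarrow> P n V h) sequentially"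
    by auto
  from 1 2 show ?thesis
  proof eventually_elim
    case (elim n)
    have "chain_prob p n {(V, h). B n V h} \<le>
        chain_prob p n {(V, h). \<not> good \<theta> \<tau> Q n L V h}"
      by (rule measure_pmf.finite_measure_mono) (use elim(2) B in blast, simp)
    then show ?case using elim(1) by linarith
  qed
qed

lemma nat_ceiling_eventually:
  assumes "0 < \<delta>" "2 / \<delta> \<le> Q" "1 \<le> Q"
  shows "eventually (\<lambda>n. real (nat \<lceil>real n / Q\<rceil>) \<le> \<delta> * real n) sequentially"
proof -
  have "eventually (\<lambda>n. 2 / \<delta> \<le> real n) sequentially"
    using filterlim_real_sequentially by (simp add: filterlim_at_top)
  then show ?thesis
  proof eventually_elim
    case (elim n)
    have "real n / Q \<le> real n / (2 / \<delta>)" using assms by (intro divide_left_mono) auto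
    then have "real n / Q \<le> \<delta> * real n / 2" by (simp add: mult.commute)
    moreover have "1 \<le> \<delta> * real n / 2" using elim assms by (simp add: field_simps)
    moreover have "0 \<le> real n / Q" using assms by simp
    then have "real (nat \<lceil>real n / Q\<rceil>) \<le> real n / Q + 1" by linarith
    ultimately show ?case by linarith
  qed
qed

abbreviation "mean_deg V h v \<equiv> \<Sum>e\<in>in_pairs V v \<union> out_pairs V 0 v. attach_prob \<beta> h (snd e)"
abbreviation "mean_in_deg V h v \<equiv> \<Sum>e\<in>in_pairs V v. attach_prob \<beta> h (snd e)"

lemma mean_deg_whp:
  assumes "c < \<mu>" "0 < e"
  shows "eventually (\<lambda>n. chain_prob p n
    {(V, h). \<exists>v\<in>V. R n v \<and> \<mu> < mean_deg V h v} \<le> e) sequentially"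
proof -
  \<comment> \<open>Makes \<open>\<beta> / d * (3 * \<tau>)\<close> half of the slack
    \<open>\<mu> - c\<close>; the other half absorbs the error in \<open>\<theta>\<close>.\<close>
  define \<tau> where "\<tau> = (\<mu> - c) * d / (6 * \<beta>)"
  have \<tau>: "0 < \<tau>" using assms d_pos beta by (simp add: \<tau>_def)
  have lim: "\<beta> / d * (p / \<gamma> + 3 * \<tau>) < \<mu>"
  proof -
    have "\<beta> / d * (p / \<gamma> + 3 * \<tau>) = c + \<beta> / d * (3 * \<tau>)" by (simp only: distrib_left c_eq)
    also have "\<beta> / d * (3 * \<tau>) = (\<mu> - c) / 2" using d_pos beta by (simp add: \<tau>_def)
    also have "c + (\<mu> - c) / 2 < \<mu>" using assms by (simp add: field_simps)
    finally show ?thesis .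
  qed
  show ?thesis
  proof (rule good_imp_whp[where P = "\<lambda>n V h. \<forall>v\<in>V. mean_deg V h v \<le> \<mu>", OF assms(2) \<tau>], rule eventuallyI)
    fix Q
    have "((\<lambda>\<theta>. \<beta> / (d - \<theta>) * (p / \<gamma> + 3 * \<tau> + \<theta> * (3 + Q))) \<longlongrightarrow> \<beta> / d * (p / \<gamma> + 3 * \<tau>)) (at_right 0)"
      using d_pos by (auto intro!: tendsto_eq_intros)
    then obtain \<theta> where \<theta>: "0 < \<theta>" "\<theta> \<le> d / 2" "\<beta> / (d - \<theta>) * (p / \<gamma> + 3 * \<tau> + \<theta> * (3 + Q)) < \<mu>"
      using ex_small_parameter[OF _ lim, of _ "d / 2"] d_pos by auto
    show "\<exists>\<theta>>0. \<theta> \<le> d / 2 \<and> (\<forall>L. eventually (\<lambda>n. \<forall>V h. good \<theta> \<tau> Q n L V h \<longrightarrow>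
      (\<forall>v\<in>V. mean_deg V h v \<le> \<mu>)) sequentially)"
    proof (intro exI[of _ \<theta>] conjI allI eventuallyI impI ballI)
      fix L n V h v assume g: "good \<theta> \<tau> Q n L V h" and v: "v \<in> V"
      define K where "K = nat \<lceil>real n / Q\<rceil>"
      from g interpret good_state p \<beta> \<theta> \<tau> Q n K L V h d \<gamma> by (simp only: K_def)
      have b: "0 \<le> \<beta> / (d - \<theta>)" using beta d_theta by simp
      have "mean_in v + mean_out v \<le> \<beta> / (d - \<theta>) * (p / \<gamma> + 3 * \<tau> + \<theta> * (3 + Q))"
      proof (cases "v \<le> K")
        case True
        have "\<theta> * (2 + Q) \<le> \<theta> * (3 + Q)" using \<theta> by simp
        then show ?thesis
          by (intro order.trans[OF mean_early_le[OF v True]] mult_left_mono[OF _ b]) linarith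
      next
        case False
        have "0 \<le> (p / \<gamma> - d) * s (v - 1)"
          using d_less s_bounds[of "v - 1"] False by (intro mult_nonneg_nonneg) auto
        then show ?thesis using False \<tau>
          by (intro order.trans[OF mean_late_le[OF v]] mult_left_mono[OF _ b]) linarith+
      qed
      then show "mean_deg V h v \<le> \<mu>" unfolding sum_in_out_eq using \<theta>(3) by linarith
    qed (use \<theta> in auto)
  qed (meson not_le)
qed

text \<open>For a vertex born after \<open>\<delta> * n\<close> the factor \<open>s (v - 1)\<close>
  is bounded away from 0. This removes a fixed part of the mean, so \<open>\<mu>\<close> can stay
  strictly below \<open>c\<close>.\<close>

lemma mean_deg_late_whp:
  assumes "0 < \<delta>"
  obtains \<mu> where "0 < \<mu>" "\<mu> < c" "\<And>e. 0 < e \<Longrightarrow> eventually (\<lambda>n. chain_prob p n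
    {(V, h). \<exists>v\<in>V. \<delta> * real n < real v \<and> \<mu> < mean_deg V h v} \<le> e) sequentially"
proof -
  \<comment> \<open>From \<open>survival_ge\<close> with \<open>z = 2 / \<delta>\<close>, because
    \<open>v - 1 \<ge> \<delta> * n / 2\<close> for large \<open>n\<close>.\<close>
  define \<kappa> where "\<kappa> = exp (- 2 * \<gamma> * (2 / \<delta>))"
  have \<kappa>: "0 < \<kappa>" by (simp add: \<kappa>_def)
  define l where "l = \<beta> / d * (p / \<gamma> - (p / \<gamma> - d) * \<kappa>)"
  have "l = c - \<beta> / d * ((p / \<gamma> - d) * \<kappa>)" unfolding l_def by (simp only: right_diff_distrib c_eq)
  moreover have "0 < \<beta> / d * ((p / \<gamma> - d) * \<kappa>)" using beta d_pos d_less \<kappa> by simp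
  ultimately have l: "l < c" by simp
  define \<mu> where "\<mu> = (max 0 l + c) / 2"
  have \<mu>: "0 < \<mu>" "\<mu> < c" "l < \<mu>" using l c_pos by (auto simp: \<mu>_def max_def)
  have "eventually (\<lambda>n. chain_prob p n
    {(V, h). \<exists>v\<in>V. \<delta> * real n < real v \<and> \<mu> < mean_deg V h v} \<le> e) sequentially" if e: "0 < e" for e
  proof -
    show ?thesis
    proof (rule good_imp_whp[where P = "\<lambda>n V h. \<forall>v\<in>V. \<delta> * real n < real v \<longrightarrow> mean_deg V h v \<le> \<mu>", OF e zero_less_one])
      show "eventually (\<lambda>Q. \<exists>\<theta>>0. \<theta> \<le> d / 2 \<and> (\<forall>L. eventually (\<lambda>n. \<forall>V h. good \<theta> 1 Q n L V h \<longrightarrow>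
        (\<forall>v\<in>V. \<delta> * real n < real v \<longrightarrow> mean_deg V h v \<le> \<mu>)) sequentially)) at_top"
        using eventually_ge_at_top[of "max 1 (2 / \<delta>)"]
      proof eventually_elim
        case (elim Q)
        have "((\<lambda>\<theta>. \<beta> / (d - \<theta>) * (p / \<gamma> - (p / \<gamma> - d) * \<kappa> + \<theta> * (3 + Q))) \<longlongrightarrow> l) (at_right 0)"
          unfolding l_def using d_pos by (auto intro!: tendsto_eq_intros)
        then obtain \<theta> where \<theta>: "0 < \<theta>" "\<theta> \<le> d / 2" "\<beta> / (d - \<theta>) * (p / \<gamma> - (p / \<gamma> - d) * \<kappa> + \<theta> * (3 + Q)) < \<mu>"
          using ex_small_parameter[OF _ \<mu>(3), of _ "d / 2"] d_pos by auto
        show ?case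
        proof (intro exI[of _ \<theta>] conjI allI)
          fix L
          have "eventually (\<lambda>n. 2 / \<delta> \<le> real n) sequentially"
            using filterlim_real_sequentially by (simp add: filterlim_at_top)
          moreover have "eventually (\<lambda>n. real (nat \<lceil>real n / Q\<rceil>) \<le> \<delta> * real n) sequentially"
            by (rule nat_ceiling_eventually) (use assms elim in auto)
          ultimately show "eventually (\<lambda>n. \<forall>V h. good \<theta> 1 Q n L V h \<longrightarrow>
            (\<forall>v\<in>V. \<delta> * real n < real v \<longrightarrow> mean_deg V h v \<le> \<mu>)) sequentially"
          proof (eventually_elim, intro allI impI ballI)
            fix n V h v
            assume n: "2 / \<delta> \<le> real n" "real (nat \<lceil>real n / Q\<rceil>) \<le> \<delta> * real n"
              and g: "good \<theta> 1 Q n L V h" and v: "v \<in> V" "\<delta> * real n < real v"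
            define K where "K = nat \<lceil>real n / Q\<rceil>"
            from g interpret good_state p \<beta> \<theta> 1 Q n K L V h d \<gamma> by (simp only: K_def)
            have Kv: "K < v" using n(2) v(2) unfolding K_def[symmetric] by linarith
            have b: "0 \<le> \<beta> / (d - \<theta>)" using beta d_theta by simp
            have v1: "real (v - 1) = real v - 1" using Kv by (simp add: of_nat_diff)
            have "\<kappa> \<le> s (v - 1)"
              unfolding \<kappa>_def
            proof (rule survival_ge)
              have "2 \<le> \<delta> * real n" using n assms by (simp add: field_simps)
              then have "\<delta> * real n / 2 \<le> real (v - 1)" using v v1 by linarith
              then have "2 / \<delta> * (\<delta> * real n / 2) \<le> 2 / \<delta> * real (v - 1)"
                using assms by (intro mult_left_mono) auto
              then show "real n - real (v - 1) \<le> 2 / \<delta> * real (v - 1)" using assms by simp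
            qed (use Kv vertex_range[OF v(1)] in auto)
            then have "(p / \<gamma> - d) * \<kappa> \<le> (p / \<gamma> - d) * s (v - 1)"
              using d_less by (intro mult_left_mono) auto
            then have "mean_in v + mean_out v \<le> \<beta> / (d - \<theta>) * (p / \<gamma> - (p / \<gamma> - d) * \<kappa> + \<theta> * (3 + Q))"
              by (intro order.trans[OF mean_late_le[OF v(1) Kv]] mult_left_mono[OF _ b]) linarith
            then show "mean_deg V h v \<le> \<mu>" unfolding sum_in_out_eq using \<theta>(3) by linarith
          qed
        qed (use \<theta> in auto)
      qed
    qed (meson not_le)
  qed
  with \<mu> show ?thesis using that by blast
qed

lemma mean_in_deg_whp:
  assumes "\<beta> < \<mu>" "0 < e"
  shows "eventually (\<lambda>n. chain_prob p n
    {(V, h). \<exists>v\<in>V. R n v \<and> \<mu> < mean_in_deg V h v} \<le> e) sequentially"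
proof -
  show ?thesis
  proof (rule good_imp_whp[where P = "\<lambda>n V h. \<forall>v\<in>V. mean_in_deg V h v \<le> \<mu>", OF assms(2) zero_less_one], rule eventuallyI)
    fix Q
    show "\<exists>\<theta>>0. \<theta> \<le> d / 2 \<and> (\<forall>L. eventually (\<lambda>n. \<forall>V h. good \<theta> 1 Q n L V h \<longrightarrow>
      (\<forall>v\<in>V. mean_in_deg V h v \<le> \<mu>)) sequentially)"
    proof (intro exI[of _ "d / 2"] conjI allI eventuallyI impI ballI)
      fix L n V h v assume g: "good (d / 2) 1 Q n L V h" and v: "v \<in> V"
      define K where "K = nat \<lceil>real n / Q\<rceil>"
      from g interpret good_state p \<beta> "d / 2" 1 Q n K L V h d \<gamma> by (simp only: K_def)
      show "mean_in_deg V h v \<le> \<mu>" unfolding sum_in_eq using mean_in_le_beta[OF v] assms by linarith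
    qed (use d_pos in auto)
  qed (meson not_le)
qed

text \<open>At a birth before \<open>(1 - \<delta>) * n\<close> the eventual survivors have density
  at most about \<open>d * (1 - \<delta>) powr \<gamma>\<close>, a fixed factor below
  \<open>d\<close>.\<close>

lemma mean_in_deg_early_whp:
  assumes "0 < \<delta>" "\<delta> < 1"
  obtains \<mu> where "0 < \<mu>" "\<mu> < \<beta>" "\<And>e. 0 < e \<Longrightarrow> eventually (\<lambda>n. chain_prob p n
    {(V, h). \<exists>v\<in>V. real v \<le> (1 - \<delta>) * real n \<and> \<mu> < mean_in_deg V h v} \<le> e) sequentially"
proof -
  define \<kappa> where "\<kappa> = (1 - \<delta>) powr \<gamma>"
  have \<kappa>: "0 < \<kappa>" "\<kappa> < 1"
  proof -
    show "0 < \<kappa>" using assms by (simp add: \<kappa>_def)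
    have "(1 - \<delta>) powr \<gamma> < 1 powr \<gamma>" using assms gamma_pos by (intro powr_less_mono2) auto
    then show "\<kappa> < 1" by (simp add: \<kappa>_def)
  qed
  define \<mu> where "\<mu> = \<beta> * (1 + \<kappa>) / 2"
  have \<mu>: "0 < \<mu>" "\<mu> < \<beta>" "\<beta> / d * (d * \<kappa>) < \<mu>"
  proof -
    show "0 < \<mu>" using \<kappa> beta by (simp add: \<mu>_def)
    have "\<beta> * (1 + \<kappa>) < \<beta> * 2" "\<beta> * (2 * \<kappa>) < \<beta> * (1 + \<kappa>)"
      by (rule mult_strict_left_mono; use \<kappa> beta in simp)+
    then show "\<mu> < \<beta>" "\<beta> / d * (d * \<kappa>) < \<mu>" using d_pos by (simp_all add: \<mu>_def)
  qed
  have "eventually (\<lambda>n. chain_prob p n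
    {(V, h). \<exists>v\<in>V. real v \<le> (1 - \<delta>) * real n \<and> \<mu> < mean_in_deg V h v} \<le> e) sequentially" if e: "0 < e" for e
  proof -
    \<comment> \<open>The allowed early weight is set to \<open>d * \<kappa>\<close>, so that early
      and late vertices both end with the bound \<open>d * \<kappa> + \<theta>\<close>.\<close>
    have \<tau>: "0 < d * \<kappa>" using d_pos \<kappa> by simp
    show ?thesis
    proof (rule good_imp_whp[where P = "\<lambda>n V h. \<forall>v\<in>V. real v \<le> (1 - \<delta>) * real n \<longrightarrow> mean_in_deg V h v \<le> \<mu>", OF e \<tau>], rule eventuallyI)
      fix Q
      have "((\<lambda>\<theta>. \<beta> / (d - \<theta>) * (d * \<kappa> + \<theta>)) \<longlongrightarrow> \<beta> / d * (d * \<kappa>)) (at_right 0)"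
        using d_pos by (auto intro!: tendsto_eq_intros)
      then obtain \<theta> where \<theta>: "0 < \<theta>" "\<theta> \<le> d / 2" "\<beta> / (d - \<theta>) * (d * \<kappa> + \<theta>) < \<mu>"
        using ex_small_parameter[OF _ \<mu>(3), of _ "d / 2"] d_pos by auto
      show "\<exists>\<theta>>0. \<theta> \<le> d / 2 \<and> (\<forall>L. eventually (\<lambda>n. \<forall>V h. good \<theta> (d * \<kappa>) Q n L V h \<longrightarrow>
        (\<forall>v\<in>V. real v \<le> (1 - \<delta>) * real n \<longrightarrow> mean_in_deg V h v \<le> \<mu>)) sequentially)"
      proof (intro exI[of _ \<theta>] conjI allI eventuallyI impI ballI)
        fix L n V h v assume g: "good \<theta> (d * \<kappa>) Q n L V h" and v: "v \<in> V" "real v \<le> (1 - \<delta>) * real n"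
        define K where "K = nat \<lceil>real n / Q\<rceil>"
        from g interpret good_state p \<beta> \<theta> "d * \<kappa>" Q n K L V h d \<gamma> by (simp only: K_def)
        have b: "0 \<le> \<beta> / (d - \<theta>)" using beta d_theta by simp
        have frac: "real (card (V \<inter> {..v - 1})) / real (v - 1) \<le> d * \<kappa> + \<theta>"
        proof (cases "v \<le> K")
          case True
          show ?thesis
            by (rule order.trans[OF early_fraction[OF v(1) True]]) (use \<theta>(1) in simp)
        next
          case False
          have "s (v - 1) \<le> (real (v - 1) / real n) powr \<gamma>"
            by (rule survival_le) (use False vertex_range[OF v(1)] in auto)
          also have "\<dots> \<le> \<kappa>" unfolding \<kappa>_def
          proof (rule powr_mono2)
            have "real (v - 1) \<le> (1 - \<delta>) * real n" by (rule order.trans[OF _ v(2)]) simp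
            then show "real (v - 1) / real n \<le> 1 - \<delta>" using K_pos by (simp add: pos_divide_le_eq)
          qed (use gamma_pos in auto)
          finally have "d * s (v - 1) + \<theta> \<le> d * \<kappa> + \<theta>" using d_pos by simp
          then show ?thesis using late_fraction(1)[OF v(1)] False by (meson not_le order.trans)
        qed
        have "mean_in v \<le> \<beta> / (d - \<theta>) * (d * \<kappa> + \<theta>)"
          by (intro order.trans[OF mean_in_le[OF v(1)]] mult_left_mono[OF frac b])
        then show "mean_in_deg V h v \<le> \<mu>" unfolding sum_in_eq using \<theta>(3) by linarith
      qed (use \<theta> in auto)
    qed (meson not_le)
  qed
  with \<mu> show ?thesis using that by blast
qed

end


section \<open>Extremal degrees\<close>

text \<open>The witness has \<open>ln \<mu>\<close> at the midpoint of \<open>x - 1\<close> and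
  \<open>ln a\<close>.\<close>

lemma ex_between_below:
  assumes "0 < a" "x < 1 + ln a"
  shows "\<exists>\<mu>>0. \<mu> < a \<and> x < 1 + ln (\<mu> :: real)"
proof -
  have "exp ((x - 1 + ln a) / 2) < exp (ln a)" using assms by (subst exp_less_cancel_iff) simp
  then show ?thesis using assms by (intro exI[of _ "exp ((x - 1 + ln a) / 2)"]) (auto simp: field_simps)
qed

lemma ex_between_above:
  assumes "0 < a" "1 + ln a < x"
  shows "\<exists>\<mu>>0. a < \<mu> \<and> 1 + ln (\<mu> :: real) < x"
proof -
  have "exp (ln a) < exp ((x - 1 + ln a) / 2)" using assms by (subst exp_less_cancel_iff) simp
  then show ?thesis using assms by (intro exI[of _ "exp ((x - 1 + ln a) / 2)"]) (auto simp: field_simps)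
qed

lemma eventually_card_le_powr:
  "eventually (\<lambda>n. real (card {v\<in>{1..n}. R n v}) \<le> real n powr 1) sequentially"
proof (rule always_eventually, rule allI)
  fix n
  have "card {v\<in>{1..n}. R n v} \<le> card {1..n}" by (rule card_mono) auto
  then show "real (card {v\<in>{1..n}. R n v}) \<le> real n powr 1" by simp
qed

lemma disjoint_in_pairs: "disjoint_family_on (in_pairs V) V"
  by (auto simp: disjoint_family_on_def in_pairs_def)

lemma disjoint_out_pairs: "disjoint_family_on (out_pairs V K) V"
  by (auto simp: disjoint_family_on_def out_pairs_def)

lemma card_in_pairs_le: "finite V \<Longrightarrow> card (in_pairs V v) \<le> card V"
  unfolding in_pairs_def by (rule order.trans[OF card_image_le card_mono]) auto

lemma card_out_pairs_le: "finite V \<Longrightarrow> card (out_pairs V K v) \<le> card V"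
  unfolding out_pairs_def by (rule order.trans[OF card_image_le card_mono]) auto

context drgvr_params
begin

lemma good_ex_whp:
  assumes "eventually (\<lambda>Q. \<forall>\<theta>. 0 < \<theta> \<and> \<theta> \<le> d / 2 \<longrightarrow> (\<exists>L. eventually (\<lambda>n.
      chain_prob p n {(V, h). \<not> good \<theta> 1 Q n L V h} \<le> r) sequentially)) at_top"
    and "eventually A at_top"
  obtains Q where "A Q" "\<And>\<theta>. 0 < \<theta> \<Longrightarrow> \<theta> \<le> d / 2 \<Longrightarrow> \<exists>L. eventually (\<lambda>n.
      chain_prob p n {(V, h). \<not> good \<theta> 1 Q n L V h} \<le> r) sequentially"
  using eventually_happens'[OF _ eventually_conj[OF assms]] by auto

text \<open>The candidates are the vertices born up to \<open>K\<close>, about \<open>n / Q\<close>,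
  counted only with edges to vertices born after \<open>K\<close>. There are linearly many, their
  pairs are disjoint and have probabilities \<open>O(1 / n)\<close>, and their common mean is close
  to \<open>c\<close> for large \<open>Q\<close>.\<close>

lemma exists_high_deg_plus:
  assumes "x < 1 + ln c"
  shows "(\<lambda>n. drgvr_prob \<beta> p n {g. \<forall>v\<in>verts g. deg_plus g v < deg_ceil x n}) \<longlonglongrightarrow> 0"
proof (rule tendsto_0_if_eventually_le)
  fix e :: real assume e: "0 < e"
  define r where "r = e / 2"
  have r: "0 < r" using e by (simp add: r_def)
  obtain \<mu> where \<mu>: "0 < \<mu>" "\<mu> < c" "x < 1 + ln \<mu>" using ex_between_below[OF c_pos assms] by auto
  define \<mu>' where "\<mu>' = (\<mu> + c) / 2"
  have \<mu>': "\<mu> < \<mu>'" "\<mu>' < c" using \<mu> by (auto simp: \<mu>'_def)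
  \<comment> \<open>\<open>(2 / Q) powr \<gamma>\<close> bounds \<open>s K\<close> from above, since
    \<open>K \<le> 2 * n / Q\<close> once \<open>Q \<le> n\<close>.\<close>
  have "((\<lambda>Q. c * (1 - (2 / Q) powr \<gamma>)) \<longlongrightarrow> c) at_top"
    using gamma_pos c_pos by real_asymp
  then have "eventually (\<lambda>Q. \<mu>' < c * (1 - (2 / Q) powr \<gamma>)) at_top"
    using \<mu>'(2) by (intro order_tendstoD) auto
  then have "eventually (\<lambda>Q. \<mu>' < c * (1 - (2 / Q) powr \<gamma>) \<and> 1 \<le> Q) at_top"
    using eventually_ge_at_top by (rule eventually_conj)
  from good_ex_whp[OF good_state_whp[OF p beta d_def \<gamma>_def r zero_less_one] this]
  obtain Q where Q: "\<mu>' < c * (1 - (2 / Q) powr \<gamma>)" "1 \<le> Q" and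
    ex_L: "\<And>\<theta>. 0 < \<theta> \<Longrightarrow> \<theta> \<le> d / 2 \<Longrightarrow> \<exists>L. eventually (\<lambda>n.
      chain_prob p n {(V, h). \<not> good \<theta> 1 Q n L V h} \<le> r) sequentially"
    by blast
  \<comment> \<open>Lower bound for \<open>s K\<close> from \<open>n - K \<le> Q * K\<close>; it
    makes the number of candidates linear in \<open>n\<close>.\<close>
  define \<kappa> where "\<kappa> = exp (- 2 * \<gamma> * Q)"
  have \<kappa>: "0 < \<kappa>" by (simp add: \<kappa>_def)
  define y where "y = (2 / Q) powr \<gamma>"
  \<comment> \<open>Negated because \<open>ex_small_parameter\<close> delivers upper bounds.\<close>
  have "((\<lambda>\<theta>. - (\<beta> / (d + \<theta>) * (p / \<gamma> * (1 - y) - \<theta> * (2 + Q)))) \<longlongrightarrow> - (\<beta> / d * (p / \<gamma> * (1 - y)))) (at_right 0)"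
    using d_pos by (auto intro!: tendsto_eq_intros)
  moreover have "- (\<beta> / d * (p / \<gamma> * (1 - y))) < - \<mu>'"
    using Q(1) unfolding y_def[symmetric] mult.assoc[symmetric] c_eq by simp
  \<comment> \<open>The second term yields \<open>d * s K - \<theta> \<ge> d * \<kappa> / 2\<close>
    in the count of candidates.\<close>
  moreover have "0 < min (d / 2) (d * \<kappa> / 2)" using d_pos \<kappa> by simp
  ultimately obtain \<theta> where "0 < \<theta>" "\<theta> \<le> min (d / 2) (d * \<kappa> / 2)"
    "- (\<beta> / (d + \<theta>) * (p / \<gamma> * (1 - y) - \<theta> * (2 + Q))) < - \<mu>'"
    using ex_small_parameter by blast
  then have \<theta>: "0 < \<theta>" "\<theta> \<le> d / 2" "\<theta> \<le> d * \<kappa> / 2"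
    "\<mu>' < \<beta> / (d + \<theta>) * (p / \<gamma> * (1 - y) - \<theta> * (2 + Q))" by auto
  obtain L where L: "eventually (\<lambda>n.
      chain_prob p n {(V, h). \<not> good \<theta> 1 Q n L V h} \<le> r) sequentially"
    using ex_L[OF \<theta>(1,2)] by blast
  define C where "C = d * \<kappa> / (2 * Q)"
  define \<sigma> where "\<sigma> = 2 * \<beta> * Q / d"
  have C: "0 < C" and \<sigma>: "0 < \<sigma>" using d_pos \<kappa> Q beta by (auto simp: C_def \<sigma>_def)
  define inc where "inc n V v = out_pairs V (nat \<lceil>real n / Q\<rceil>) v" for n V v
  let ?ok = "\<lambda>n V h. \<exists>B\<subseteq>V. C * real n \<le> real (card B) \<and> (\<forall>v\<in>B.
           \<mu>' \<le> (\<Sum>e\<in>inc n V v. attach_prob \<beta> h (snd e)) \<and>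
           (\<forall>e\<in>inc n V v. attach_prob \<beta> h (snd e) \<le> \<sigma> / real n))"
  have "eventually (\<lambda>n. Q \<le> real n) sequentially"
    using filterlim_real_sequentially by (simp add: filterlim_at_top)
  with L have "eventually (\<lambda>n. chain_prob p n {(V, h). \<not> ?ok n V h} \<le> r) sequentially"
  proof eventually_elim
    case (elim n)
    have ok: "?ok n V h" if g: "good \<theta> 1 Q n L V h" for V h
    proof -
      define K where "K = nat \<lceil>real n / Q\<rceil>"
      from g interpret good_state p \<beta> \<theta> 1 Q n K L V h d \<gamma> by (simp only: K_def)
      have "real K \<le> 2 / Q * real n"
      proof -
        have "1 \<le> real n / Q" using elim(2) Q(2) by (simp add: pos_le_divide_eq)
        moreover have "real K \<le> real n / Q + 1" using calculation unfolding K_def by linarith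
        moreover have "2 / Q * real n = real n / Q + real n / Q" by simp
        ultimately show ?thesis by linarith
      qed
      then have "(real K / real n) powr \<gamma> \<le> y"
        unfolding y_def using K_pos gamma_pos by (intro powr_mono2) (auto simp: pos_divide_le_eq)
      then have "s K \<le> y" using survival_le[of K] K by linarith
      then have "p / \<gamma> * (1 - y) \<le> p / \<gamma> * (1 - s K)" using gamma_pos p by (intro mult_left_mono) auto
      then have "\<beta> / (d + \<theta>) * (p / \<gamma> * (1 - y) - \<theta> * (2 + Q)) \<le>
          \<beta> / (d + \<theta>) * (p / \<gamma> * (1 - s K) - \<theta> * (2 + Q))"
        using beta d_theta by (intro mult_left_mono) auto
      then have mean: "\<mu>' \<le> mean_out K" using mean_out_ge \<theta>(4) by linarith
      have "\<kappa> \<le> s K" unfolding \<kappa>_def by (rule survival_ge) (use K in auto)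
      then have "d * \<kappa> \<le> d * s K" using d_pos by (intro mult_left_mono) auto
      then have "d * \<kappa> / 2 * real K \<le> (d * s K - \<theta>) * real K" using \<theta>(3) by (intro mult_right_mono) auto
      moreover have "C * real n \<le> d * \<kappa> / 2 * real K"
      proof -
        have "d * \<kappa> / 2 * (real n / Q) \<le> d * \<kappa> / 2 * real K"
          using K(2) Q(2) d_pos \<kappa> by (intro mult_left_mono) (auto simp: pos_divide_le_eq mult.commute)
        then show ?thesis by (simp add: C_def)
      qed
      ultimately have "C * real n \<le> real (card {v\<in>V. v \<le> K})" using card_early_ge by linarith
      moreover have "\<mu>' \<le> (\<Sum>e\<in>inc n V v. attach_prob \<beta> h (snd e))" if "v \<in> V" "v \<le> K" for v
        unfolding inc_def K_def[symmetric] sum_out_eq[OF that(2)] by (rule mean)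
      moreover have "attach_prob \<beta> h (snd e) \<le> \<sigma> / real n" if e: "v \<in> V" "e \<in> inc n V v" for v e
      proof -
        obtain w where "e = (v, w)" "w \<in> V" "K < w"
          using e(2) unfolding inc_def K_def[symmetric] out_pairs_def by blast
        then show ?thesis using q_le_late[of w] by (simp only: snd_conv \<sigma>_def)
      qed
      ultimately show ?thesis by (intro exI[of _ "{v\<in>V. v \<le> K}"]) auto
    qed
    have "chain_prob p n {(V, h). \<not> ?ok n V h} \<le>
        chain_prob p n {(V, h). \<not> good \<theta> 1 Q n L V h}"
      by (rule measure_pmf.finite_measure_mono) (use ok in blast, simp)
    then show ?case using elim(1) by linarith
  qed
  then have "eventually (\<lambda>n. drgvr_prob \<beta> p n {g. \<forall>v\<in>verts g. deg_plus g v < deg_ceil x n} \<le> 2 * r) sequentially"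
  proof (rule eventually_prob_no_high_degree_le[rotated 12])
    show "0 \<le> p" "p \<le> 1" using p by auto
    show "0 < \<beta>" "0 < \<mu>" "x < 1 + ln \<mu>" "0 < C" "0 < \<sigma>" "\<mu> < \<mu>'" "0 < r"
      using beta \<mu> C \<sigma> \<mu>' r by simp_all
    show "card {e \<in> inc n V v. b e} \<le> deg_plus (graph_of V b) v" if V: "finite V" "v \<in> V" for n V b v
      unfolding deg_plus_graph_of[OF V(2)]
      by (rule card_mono) (use V in \<open>auto simp: inc_def out_pairs_def\<close>)
    show "inc n V v \<subseteq> ordered_pairs V" if "v \<in> V" for n V v
      unfolding inc_def using that by (rule out_pairs_subset)
    show "card (inc n V v) \<le> card V" if "finite V" for n V v
      unfolding inc_def using that by (rule card_out_pairs_le)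
    show "disjoint_family_on (inc n V) V" for n V
      using disjoint_out_pairs by (simp add: inc_def[abs_def])
  qed
  then show "eventually (\<lambda>n. drgvr_prob \<beta> p n {g. \<forall>v\<in>verts g. deg_plus g v < deg_ceil x n} \<le> e) sequentially"
    by (simp add: r_def)
qed simp

text \<open>The candidates are the survivors among about the last \<open>\<delta> * n\<close>
  labels. For small \<open>\<delta>\<close> most vertices present at their births are still alive,
  so their mean in-degrees are close to \<open>\<beta>\<close>.\<close>

lemma exists_high_deg_minus:
  assumes "x < 1 + ln \<beta>"
  shows "(\<lambda>n. drgvr_prob \<beta> p n {g. \<forall>v\<in>verts g. deg_minus g v < deg_ceil x n}) \<longlonglongrightarrow> 0"
proof (rule tendsto_0_if_eventually_le)
  fix e :: real assume e: "0 < e"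
  define r where "r = e / 2"
  have r: "0 < r" using e by (simp add: r_def)
  obtain \<mu> where \<mu>: "0 < \<mu>" "\<mu> < \<beta>" "x < 1 + ln \<mu>" using ex_between_below[OF beta assms] by auto
  define \<mu>' where "\<mu>' = (\<mu> + \<beta>) / 2"
  have \<mu>': "\<mu> < \<mu>'" "\<mu>' < \<beta>" using \<mu> by (auto simp: \<mu>'_def)
  have "((\<lambda>\<delta>. - (\<beta> * exp (- 2 * \<gamma> * (2 * \<delta>)))) \<longlongrightarrow> - \<beta>) (at_right 0)"
    by (auto intro!: tendsto_eq_intros)
  moreover have "- \<beta> < - \<mu>'" "0 < (1 / 2 :: real)" using \<mu>'(2) by simp_all
  ultimately obtain \<delta> where "0 < \<delta>" "\<delta> \<le> 1 / 2" "- (\<beta> * exp (- 2 * \<gamma> * (2 * \<delta>))) < - \<mu>'"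
    using ex_small_parameter by blast
  then have \<delta>: "0 < \<delta>" "\<delta> \<le> 1 / 2" "\<mu>' < \<beta> * exp (- 2 * \<gamma> * (2 * \<delta>))" by simp_all
  \<comment> \<open>\<open>Q \<ge> 4\<close> puts \<open>K\<close> below \<open>n / 2\<close>, hence
    below the cutoff \<open>m\<close> near \<open>(1 - \<delta>) * n\<close>.\<close>
  from good_ex_whp[OF good_state_whp[OF p beta d_def \<gamma>_def r zero_less_one] eventually_ge_at_top[of 4]]
  obtain Q where Q: "4 \<le> Q" and
    ex_L: "\<And>\<theta>. 0 < \<theta> \<Longrightarrow> \<theta> \<le> d / 2 \<Longrightarrow> \<exists>L. eventually (\<lambda>n.
      chain_prob p n {(V, h). \<not> good \<theta> 1 Q n L V h} \<le> r) sequentially"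
    by blast
  define \<kappa> where "\<kappa> = exp (- 2 * \<gamma> * (2 * \<delta>))"
  have "((\<lambda>\<theta>. - (\<beta> / (d + \<theta>) * (d * \<kappa> - \<theta>))) \<longlongrightarrow> - (\<beta> / d * (d * \<kappa>))) (at_right 0)"
    using d_pos by (auto intro!: tendsto_eq_intros)
  moreover have "- (\<beta> / d * (d * \<kappa>)) < - \<mu>'"
    using \<delta>(3) d_pos by (simp add: \<kappa>_def)
  \<comment> \<open>With \<open>\<theta> \<le> d * \<delta> / 8\<close> the loss
    \<open>2 * \<theta> * n\<close> in \<open>card_late_ge\<close> is at most a quarter of
    \<open>d * \<delta> * n\<close>, and rounding \<open>m\<close> costs at most half of it; a
    quarter remains, which is \<open>C * n\<close>.\<close>
  moreover have "0 < min (d / 2) (d * \<delta> / 8)" using d_pos \<delta> by simp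
  ultimately obtain \<theta> where "0 < \<theta>" "\<theta> \<le> min (d / 2) (d * \<delta> / 8)"
    "- (\<beta> / (d + \<theta>) * (d * \<kappa> - \<theta>)) < - \<mu>'"
    using ex_small_parameter by blast
  then have \<theta>: "0 < \<theta>" "\<theta> \<le> d / 2" "\<theta> \<le> d * \<delta> / 8" "\<mu>' < \<beta> / (d + \<theta>) * (d * \<kappa> - \<theta>)" by auto
  obtain L where L: "eventually (\<lambda>n.
      chain_prob p n {(V, h). \<not> good \<theta> 1 Q n L V h} \<le> r) sequentially"
    using ex_L[OF \<theta>(1,2)] by blast
  define C where "C = d * \<delta> / 4"
  define \<sigma> where "\<sigma> = 2 * \<beta> * Q / d"
  have C: "0 < C" and \<sigma>: "0 < \<sigma>" using d_pos \<delta> Q beta by (auto simp: C_def \<sigma>_def)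
  let ?ok = "\<lambda>n V h. \<exists>B\<subseteq>V. C * real n \<le> real (card B) \<and> (\<forall>v\<in>B.
           \<mu>' \<le> (\<Sum>e\<in>in_pairs V v. attach_prob \<beta> h (snd e)) \<and>
           (\<forall>e\<in>in_pairs V v. attach_prob \<beta> h (snd e) \<le> \<sigma> / real n))"
  have "eventually (\<lambda>n. 2 / \<delta> \<le> real n) sequentially"
    using filterlim_real_sequentially by (simp add: filterlim_at_top)
  moreover have "eventually (\<lambda>n. real (nat \<lceil>real n / Q\<rceil>) \<le> 1 / 2 * real n) sequentially"
    by (rule nat_ceiling_eventually) (use Q in auto)
  ultimately have "eventually (\<lambda>n. chain_prob p n {(V, h). \<not> ?ok n V h} \<le> r) sequentially"
    using L
  proof eventually_elim
    case (elim n)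
    have ok: "?ok n V h" if g: "good \<theta> 1 Q n L V h" for V h
    proof -
      define K where "K = nat \<lceil>real n / Q\<rceil>"
      from g interpret good_state p \<beta> \<theta> 1 Q n K L V h d \<gamma> by (simp only: K_def)
      define m where "m = nat \<lceil>(1 - \<delta>) * real n\<rceil>"
      have \<delta>n: "2 \<le> \<delta> * real n" using elim(1) \<delta>(1) by (simp add: field_simps)
      have \<delta>n': "\<delta> * real n \<le> 1 / 2 * real n" using \<delta> by (intro mult_right_mono) auto
      have split: "(1 - \<delta>) * real n = real n - \<delta> * real n" by (simp add: algebra_simps)
      have m: "real n - \<delta> * real n \<le> real m" "real m \<le> real n - \<delta> * real n + 1"
        using \<delta>n' unfolding m_def split by linarith+
      have mn: "m \<le> n" using m \<delta>n by linarith
      have Km: "K \<le> m"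
      proof -
        have "real K \<le> real m" using elim(2) m \<delta>n' unfolding K_def by linarith
        then show ?thesis by simp
      qed
      have mean: "\<mu>' \<le> mean_in v" if v: "v \<in> V" "m < v" for v
      proof -
        have v': "K \<le> v - 1" "v - 1 \<le> n" "K < v" "m \<le> v - 1" using v Km vertex_range[OF v(1)] by auto
        have "\<kappa> \<le> s (v - 1)" unfolding \<kappa>_def
        proof (rule survival_ge[OF v'(1,2)])
          have mv: "real m \<le> real (v - 1)" using v'(4) by (simp only: of_nat_le_iff)
          have "real n / 2 \<le> real (v - 1)" using mv m \<delta>n' by (intro order.trans[OF _ mv]) linarith
          then have "2 * \<delta> * (real n / 2) \<le> 2 * \<delta> * real (v - 1)" using \<delta>(1) by (intro mult_left_mono) auto
          then have "\<delta> * real n \<le> 2 * \<delta> * real (v - 1)" by simp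
          moreover have "real n - real (v - 1) \<le> real n - real m" using mv by (rule diff_left_mono)
          moreover have "real n - real m \<le> \<delta> * real n" using m by linarith
          ultimately show "real n - real (v - 1) \<le> 2 * \<delta> * real (v - 1)" by (meson order.trans)
        qed
        then have "d * \<kappa> - \<theta> \<le> d * s (v - 1) - \<theta>" using d_pos by simp
        then have "\<beta> / (d + \<theta>) * (d * \<kappa> - \<theta>) \<le> \<beta> / (d + \<theta>) * (d * s (v - 1) - \<theta>)"
          using beta d_theta by (intro mult_left_mono) auto
        also have "\<dots> \<le> mean_in v" by (rule mean_in_ge[OF v(1) v'(3)])
        finally show ?thesis using \<theta>(4) by linarith
      qed
      have "C * real n \<le> d * (real n - real m) - 2 * \<theta> * real n"
      proof -
        have "d * (\<delta> * real n / 2) \<le> d * (real n - real m)"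
          using m \<delta>n d_pos by (intro mult_left_mono) linarith+
        moreover have "2 * \<theta> * real n \<le> 2 * (d * \<delta> / 8) * real n"
          using \<theta>(3) by (intro mult_right_mono mult_left_mono) auto
        moreover have "d * (\<delta> * real n / 2) = d * \<delta> * real n / 2"
          "2 * (d * \<delta> / 8) * real n = d * \<delta> * real n / 4" "C * real n = d * \<delta> * real n / 4"
          by (simp_all add: C_def)
        ultimately show ?thesis by linarith
      qed
      then have "C * real n \<le> real (card {v\<in>V. m < v})" using card_late_ge[OF Km mn] by linarith
      moreover have "\<mu>' \<le> (\<Sum>e\<in>in_pairs V v. attach_prob \<beta> h (snd e))" if "v \<in> V" "m < v" for v
        unfolding sum_in_eq by (rule mean[OF that])
      moreover have "attach_prob \<beta> h (snd e) \<le> \<sigma> / real n" if "v \<in> V" "m < v" "e \<in> in_pairs V v" for v e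
      proof -
        have "snd e = v" using that(3) unfolding in_pairs_def by auto
        then show ?thesis using q_le_late[of v] that(1,2) Km by (simp only: \<sigma>_def)
      qed
      ultimately show ?thesis by (intro exI[of _ "{v\<in>V. m < v}"]) auto
    qed
    have "chain_prob p n {(V, h). \<not> ?ok n V h} \<le>
        chain_prob p n {(V, h). \<not> good \<theta> 1 Q n L V h}"
      by (rule measure_pmf.finite_measure_mono) (use ok in blast, simp)
    then show ?case using elim(3) by linarith
  qed
  then have "eventually (\<lambda>n. drgvr_prob \<beta> p n {g. \<forall>v\<in>verts g. deg_minus g v < deg_ceil x n} \<le> 2 * r) sequentially"
  proof (rule eventually_prob_no_high_degree_le[where inc = "\<lambda>n. in_pairs", rotated 12])
    show "0 \<le> p" "p \<le> 1" using p by auto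
    show "0 < \<beta>" "0 < \<mu>" "x < 1 + ln \<mu>" "0 < C" "0 < \<sigma>" "\<mu> < \<mu>'" "0 < r"
      using beta \<mu> C \<sigma> \<mu>' r by simp_all
    show "card {e \<in> in_pairs V v. b e} \<le> deg_minus (graph_of V b) v" if V: "finite V" "v \<in> V" for V b v
      unfolding deg_minus_graph_of[OF V(2)] ..
    show "in_pairs V v \<subseteq> ordered_pairs V" if "v \<in> V" for V v
      using that by (rule in_pairs_subset)
    show "card (in_pairs V v) \<le> card V" if "finite V" for V v
      using that by (rule card_in_pairs_le)
    show "disjoint_family_on (in_pairs V) V" for V
      by (rule disjoint_in_pairs)
  qed
  then show "eventually (\<lambda>n. drgvr_prob \<beta> p n {g. \<forall>v\<in>verts g. deg_minus g v < deg_ceil x n} \<le> e) sequentially"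
    by (simp add: r_def)
qed simp

section \<open>Absence of high degrees, globally and by age\<close>

lemma no_high_deg_sum:
  assumes "1 + ln c < x"
  shows "(\<lambda>n. drgvr_prob \<beta> p n {g. \<exists>v\<in>verts g. deg_ceil x n \<le> deg_sum g v}) \<longlonglongrightarrow> 0"
proof -
  obtain \<mu> where \<mu>: "0 < \<mu>" "c < \<mu>" "1 + ln \<mu> < x" using ex_between_above[OF c_pos assms] by auto
  have "(\<lambda>n. drgvr_prob \<beta> p n {g. \<exists>v\<in>verts g. True \<and> deg_ceil x n \<le> deg_sum g v}) \<longlonglongrightarrow> 0"
    by (rule prob_high_degree_tendsto_0[OF _ _ _ _ _ _ _ eventually_card_le_powr, where inc = "\<lambda>V v. in_pairs V v \<union> out_pairs V 0 v" and \<mu> = \<mu>])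
       (use p beta \<mu> deg_sum_graph_of in_pairs_subset out_pairs_subset mean_deg_whp[OF \<mu>(2), of _ "\<lambda>_ _. True"]
          deg_level_above[OF \<mu>(3)] in auto)
  then show ?thesis by simp
qed

text \<open>With at most \<open>n powr \<alpha>\<close> candidates a crude mean such as
  \<open>c + 1\<close> suffices, and every level is out of reach for them, including those below the
  maximum.\<close>

lemma no_high_deg_sum_early:
  assumes "\<alpha> < 1"
  shows "(\<lambda>n. drgvr_prob \<beta> p n
    {g. \<exists>v\<in>verts g. real v \<le> real n powr \<alpha> \<and> deg_ceil x n \<le> deg_sum g v}) \<longlonglongrightarrow> 0"
proof (rule prob_high_degree_tendsto_0[where inc = "\<lambda>V v. in_pairs V v \<union> out_pairs V 0 v" and \<mu> = "c + 1" and \<alpha> = \<alpha>])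
  show "filterlim (\<lambda>n. deg_level x n * (ln (deg_level x n) - (1 + ln (c + 1))) - \<alpha> * ln n) at_top at_top"
    by (rule deg_level_sublinear[OF assms])
  show "eventually (\<lambda>n. real (card {v\<in>{1..n}. real v \<le> real n powr \<alpha>}) \<le> real n powr \<alpha>) sequentially"
  proof (rule always_eventually, rule allI)
    fix n
    have "card {v\<in>{1..n}. real v \<le> real n powr \<alpha>} \<le> card {1..nat \<lfloor>real n powr \<alpha>\<rfloor>}"
      by (rule card_mono) (auto simp: le_nat_floor)
    also have "card {1..nat \<lfloor>real n powr \<alpha>\<rfloor>} = nat \<lfloor>real n powr \<alpha>\<rfloor>" by simp
    finally have "real (card {v\<in>{1..n}. real v \<le> real n powr \<alpha>}) \<le> real (nat \<lfloor>real n powr \<alpha>\<rfloor>)"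
      by (simp only: of_nat_le_iff)
    also have "\<dots> \<le> real n powr \<alpha>" by simp
    finally show "real (card {v\<in>{1..n}. real v \<le> real n powr \<alpha>}) \<le> real n powr \<alpha>" .
  qed
qed (use p beta c_pos deg_sum_graph_of in_pairs_subset out_pairs_subset
      mean_deg_whp[of "c + 1" _ "\<lambda>n v. real v \<le> real n powr \<alpha>"] in auto)

text \<open>\<open>x\<close> is placed strictly between \<open>1 + ln \<mu>\<close> and
  \<open>1 + ln c\<close>: a level that vertices born after \<open>\<delta> * n\<close> miss
  although some vertex reaches it.\<close>

lemma no_high_deg_sum_late:
  assumes "0 < \<delta>"
  obtains x where "x < 1 + ln c" "(\<lambda>n. drgvr_prob \<beta> p n
    {g. \<exists>v\<in>verts g. \<delta> * real n < real v \<and> deg_ceil x n \<le> deg_sum g v}) \<longlonglongrightarrow> 0"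
proof -
  obtain \<mu> where \<mu>: "0 < \<mu>" "\<mu> < c" "\<And>e. 0 < e \<Longrightarrow> eventually (\<lambda>n. chain_prob p n
    {(V, h). \<exists>v\<in>V. \<delta> * real n < real v \<and> \<mu> < mean_deg V h v} \<le> e) sequentially"
    using mean_deg_late_whp[OF assms] by blast
  define x where "x = 1 + (ln \<mu> + ln c) / 2"
  have "ln \<mu> < ln c" using \<mu> by simp
  then have x: "1 + ln \<mu> < x" "x < 1 + ln c" by (auto simp: x_def field_simps)
  have "(\<lambda>n. drgvr_prob \<beta> p n
    {g. \<exists>v\<in>verts g. \<delta> * real n < real v \<and> deg_ceil x n \<le> deg_sum g v}) \<longlonglongrightarrow> 0"
    by (rule prob_high_degree_tendsto_0[OF _ _ _ _ _ _ _ eventually_card_le_powr, where inc = "\<lambda>V v. in_pairs V v \<union> out_pairs V 0 v" and \<mu> = \<mu>])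
       (use p beta \<mu>(1,3) deg_sum_graph_of in_pairs_subset out_pairs_subset deg_level_above[OF x(1)] in auto)
  with x(2) show ?thesis using that by blast
qed

lemma no_high_deg_minus:
  assumes "1 + ln \<beta> < x"
  shows "(\<lambda>n. drgvr_prob \<beta> p n {g. \<exists>v\<in>verts g. deg_ceil x n \<le> deg_minus g v}) \<longlonglongrightarrow> 0"
proof -
  obtain \<mu> where \<mu>: "0 < \<mu>" "\<beta> < \<mu>" "1 + ln \<mu> < x" using ex_between_above[OF beta assms] by auto
  have "(\<lambda>n. drgvr_prob \<beta> p n {g. \<exists>v\<in>verts g. True \<and> deg_ceil x n \<le> deg_minus g v}) \<longlonglongrightarrow> 0"
    by (rule prob_high_degree_tendsto_0[OF _ _ _ _ _ _ _ eventually_card_le_powr, where inc = in_pairs and \<mu> = \<mu>])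
       (use p beta \<mu> deg_minus_graph_of in_pairs_subset mean_in_deg_whp[OF \<mu>(2), of _ "\<lambda>_ _. True"]
          deg_level_above[OF \<mu>(3)] in auto)
  then show ?thesis by simp
qed

lemma no_high_deg_minus_early:
  assumes "0 < \<delta>" "\<delta> < 1"
  obtains x where "x < 1 + ln \<beta>" "(\<lambda>n. drgvr_prob \<beta> p n
    {g. \<exists>v\<in>verts g. real v \<le> (1 - \<delta>) * real n \<and> deg_ceil x n \<le> deg_minus g v}) \<longlonglongrightarrow> 0"
proof -
  obtain \<mu> where \<mu>: "0 < \<mu>" "\<mu> < \<beta>" "\<And>e. 0 < e \<Longrightarrow> eventually (\<lambda>n. chain_prob p n
    {(V, h). \<exists>v\<in>V. real v \<le> (1 - \<delta>) * real n \<and> \<mu> < mean_in_deg V h v} \<le> e) sequentially"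
    using mean_in_deg_early_whp[OF assms] by blast
  define x where "x = 1 + (ln \<mu> + ln \<beta>) / 2"
  have "ln \<mu> < ln \<beta>" using \<mu> by simp
  then have x: "1 + ln \<mu> < x" "x < 1 + ln \<beta>" by (auto simp: x_def field_simps)
  have "(\<lambda>n. drgvr_prob \<beta> p n
    {g. \<exists>v\<in>verts g. real v \<le> (1 - \<delta>) * real n \<and> deg_ceil x n \<le> deg_minus g v}) \<longlonglongrightarrow> 0"
    by (rule prob_high_degree_tendsto_0[OF _ _ _ _ _ _ _ eventually_card_le_powr, where inc = in_pairs and \<mu> = \<mu>])
       (use p beta \<mu>(1,3) deg_minus_graph_of in_pairs_subset deg_level_above[OF x(1)] in auto)
  with x(2) show ?thesis using that by blast
qed

end


section \<open>Maximal degree and maximizers\<close>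

lemma deg_level_le_iff:
  assumes "1 < ln n"
  shows "deg_level x n \<le> y \<longleftrightarrow> x \<le> (ln (ln n))\<^sup>2 / ln n * y - ln (ln n) - ln (ln (ln n))"
proof -
  define a where "a = (ln (ln n))\<^sup>2 / ln n"
  have a: "0 < a" using assms by (simp add: a_def)
  have "deg_level x n = (ln (ln n) + ln (ln (ln n)) + x) / a" by (simp add: deg_level_def a_def)
  then have "deg_level x n \<le> y \<longleftrightarrow> ln (ln n) + ln (ln (ln n)) + x \<le> a * y"
    using a by (simp add: pos_divide_le_eq mult.commute)
  then show ?thesis unfolding a_def by linarith
qed

lemma eventually_ln_gt_1: "eventually (\<lambda>n. 1 < ln (real n)) sequentially"
  using filterlim_compose[OF ln_at_top filterlim_real_sequentially] by (simp add: filterlim_at_top_dense)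

lemma maximizers_of_high_degree:
  assumes "finite (verts g)" "v \<in> verts g" "k \<le> dg g v"
  shows "finite (maximizers dg g)" "maximizers dg g \<noteq> {}" "maximizers dg g \<subseteq> verts g"
    "k \<le> max_deg dg g"
proof -
  show "finite (maximizers dg g)" "maximizers dg g \<subseteq> verts g" using assms by (auto simp: maximizers_def)
  have "max_deg dg g \<in> dg g ` verts g" unfolding max_deg_def using assms by (intro Max_in) auto
  then show "maximizers dg g \<noteq> {}" by (auto simp: maximizers_def)
  have "dg g v \<le> max_deg dg g" unfolding max_deg_def using assms by (intro Max_ge) auto
  then show "k \<le> max_deg dg g" using assms(3) by simp
qed

lemma drgvr_law_support: "g \<in> set_pmf (drgvr_law \<beta> p n) \<Longrightarrow> verts g \<subseteq> {1..n}"
  unfolding drgvr_law_eq_vertex_chain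
  using vertex_chain_support by (fastforce dest: verts_independent_graph)

lemma drgvr_law_tendsto_0:
  assumes "(\<lambda>n. drgvr_prob \<beta> p n (A n)) \<longlonglongrightarrow> 0"
    and "(\<lambda>n. drgvr_prob \<beta> p n (B n)) \<longlonglongrightarrow> 0"
    and sub: "eventually (\<lambda>n. \<forall>g. verts g \<subseteq> {1..n} \<longrightarrow> g \<in> C n \<longrightarrow> g \<in> A n \<or> g \<in> B n) sequentially"
  shows "(\<lambda>n. drgvr_prob \<beta> p n (C n)) \<longlonglongrightarrow> 0"
proof (rule tendsto_sandwich[where f = "\<lambda>_. 0" and h = "\<lambda>n. drgvr_prob \<beta> p n (A n)
    + drgvr_prob \<beta> p n (B n)"])
  show "(\<lambda>n. drgvr_prob \<beta> p n (A n) + drgvr_prob \<beta> p n (B n)) \<longlonglongrightarrow> 0"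
    using tendsto_add[OF assms(1,2)] by simp
  show "eventually (\<lambda>n. drgvr_prob \<beta> p n (C n) \<le>
      drgvr_prob \<beta> p n (A n) + drgvr_prob \<beta> p n (B n)) sequentially"
    using sub
  proof eventually_elim
    case (elim n)
    let ?P = "drgvr_prob \<beta> p n"
    have "?P (C n) = ?P (C n \<inter> set_pmf (drgvr_law \<beta> p n))" by (rule measure_Int_set_pmf[symmetric])
    also have "\<dots> \<le> ?P (A n \<union> B n)"
    proof (rule measure_pmf.finite_measure_mono)
      show "C n \<inter> set_pmf (drgvr_law \<beta> p n) \<subseteq> A n \<union> B n"
      proof
        fix g assume g: "g \<in> C n \<inter> set_pmf (drgvr_law \<beta> p n)"
        then have "verts g \<subseteq> {1..n}" by (intro drgvr_law_support[of g \<beta> p n]) simp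
        then show "g \<in> A n \<union> B n" using elim g by blast
      qed
    qed simp
    also have "\<dots> \<le> ?P (A n) + ?P (B n)" by (rule measure_Un_le) simp_all
    finally show ?case .
  qed
qed simp_all

context drgvr_params
begin

text \<open>By \<open>deg_level_le_iff\<close>, a deviation above \<open>e\<close> means that some
  vertex reaches level \<open>l + e\<close> or that none reaches level \<open>l - e\<close>.\<close>

lemma max_deg_concentration:
  assumes upper: "\<And>x. l < x \<Longrightarrow> (\<lambda>n. drgvr_prob \<beta> p n
      {g. \<exists>v\<in>verts g. deg_ceil x n \<le> dg g v}) \<longlonglongrightarrow> 0"
    and lower: "\<And>x. x < l \<Longrightarrow> (\<lambda>n. drgvr_prob \<beta> p n
      {g. \<forall>v\<in>verts g. dg g v < deg_ceil x n}) \<longlonglongrightarrow> 0"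
    and e: "0 < e"
  shows "(\<lambda>n. drgvr_prob \<beta> p n
    {g. e < \<bar>(ln (ln (real n)))\<^sup>2 / ln (real n) * real (max_deg dg g)
             - ln (ln (real n)) - ln (ln (ln (real n))) - l\<bar>}) \<longlonglongrightarrow> 0"
proof (rule drgvr_law_tendsto_0[OF upper[of "l + e"] lower[of "l - e"]])
  show "eventually (\<lambda>n. \<forall>g. verts g \<subseteq> {1..n} \<longrightarrow>
    g \<in> {g. e < \<bar>(ln (ln (real n)))\<^sup>2 / ln (real n) * real (max_deg dg g)
             - ln (ln (real n)) - ln (ln (ln (real n))) - l\<bar>} \<longrightarrow>
    g \<in> {g. \<exists>v\<in>verts g. deg_ceil (l + e) n \<le> dg g v} \<or>
    g \<in> {g. \<forall>v\<in>verts g. dg g v < deg_ceil (l - e) n}) sequentially"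
    using eventually_ln_gt_1
  proof (eventually_elim, intro allI impI)
    fix n g
    assume n: "1 < ln (real n)" and V: "verts g \<subseteq> {1..n}"
      and dev: "g \<in> {g. e < \<bar>(ln (ln (real n)))\<^sup>2 / ln (real n) * real (max_deg dg g)
             - ln (ln (real n)) - ln (ln (ln (real n))) - l\<bar>}"
    have fin: "finite (verts g)" using V by (rule finite_subset) simp
    show "g \<in> {g. \<exists>v\<in>verts g. deg_ceil (l + e) n \<le> dg g v} \<or>
      g \<in> {g. \<forall>v\<in>verts g. dg g v < deg_ceil (l - e) n}"
    proof (rule ccontr)
      assume "\<not> ?thesis"
      then have no: "\<forall>v\<in>verts g. \<not> deg_ceil (l + e) n \<le> dg g v"
        and ex: "\<exists>v\<in>verts g. deg_ceil (l - e) n \<le> dg g v" by (auto simp: not_less)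
      obtain v where v: "v \<in> verts g" "deg_ceil (l - e) n \<le> dg g v" using ex by blast
      have "max_deg dg g \<in> dg g ` verts g" unfolding max_deg_def using fin v by (intro Max_in) auto
      then have "\<not> deg_ceil (l + e) n \<le> max_deg dg g" using no by auto
      moreover have "deg_ceil (l - e) n \<le> max_deg dg g" by (rule maximizers_of_high_degree(4)[where dg = dg, OF fin v])
      ultimately show False
        using dev e unfolding deg_ceil_le_iff deg_level_le_iff[OF n] by auto
    qed
  qed
qed (use e in auto)

text \<open>If some vertex reaches level \<open>x\<close> but none satisfying \<open>R\<close> does,
  then every maximizer avoids \<open>R\<close>.\<close>

lemma maximizers_location:
  assumes "(\<lambda>n. drgvr_prob \<beta> p n {g. \<forall>v\<in>verts g. dg g v < deg_ceil x n}) \<longlonglongrightarrow> 0"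
    and "(\<lambda>n. drgvr_prob \<beta> p n {g. \<exists>v\<in>verts g. R n v \<and> deg_ceil x n \<le> dg g v}) \<longlonglongrightarrow> 0"
    and "eventually (\<lambda>n. \<forall>g. finite (maximizers dg g) \<longrightarrow> maximizers dg g \<noteq> {} \<longrightarrow>
      (\<forall>v\<in>maximizers dg g. v \<in> {1..n} \<and> \<not> R n v) \<longrightarrow> g \<notin> C n) sequentially"
  shows "(\<lambda>n. drgvr_prob \<beta> p n (C n)) \<longlonglongrightarrow> 0"
proof (rule drgvr_law_tendsto_0[OF assms(1,2)])
  show "eventually (\<lambda>n. \<forall>g. verts g \<subseteq> {1..n} \<longrightarrow> g \<in> C n \<longrightarrow>
    g \<in> {g. \<forall>v\<in>verts g. dg g v < deg_ceil x n} \<or>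
    g \<in> {g. \<exists>v\<in>verts g. R n v \<and> deg_ceil x n \<le> dg g v}) sequentially"
    using assms(3)
  proof (eventually_elim, intro allI impI)
    fix n g
    assume *: "\<forall>g. finite (maximizers dg g) \<longrightarrow> maximizers dg g \<noteq> {} \<longrightarrow>
      (\<forall>v\<in>maximizers dg g. v \<in> {1..n} \<and> \<not> R n v) \<longrightarrow> g \<notin> C n"
      and V: "verts g \<subseteq> {1..n}" and g: "g \<in> C n"
    show "g \<in> {g. \<forall>v\<in>verts g. dg g v < deg_ceil x n} \<or>
        g \<in> {g. \<exists>v\<in>verts g. R n v \<and> deg_ceil x n \<le> dg g v}"
    proof (rule ccontr)
      assume neg: "\<not> ?thesis"
      have fin: "finite (verts g)" using V by (rule finite_subset) simp
      obtain v where v: "v \<in> verts g" "deg_ceil x n \<le> dg g v" using neg by (auto simp: not_less)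
      note m = maximizers_of_high_degree[where dg = dg, OF fin v]
      have "v \<in> {1..n} \<and> \<not> R n v" if "v \<in> maximizers dg g" for v
      proof -
        have "v \<in> verts g" "deg_ceil x n \<le> dg g v" using that m(4) by (auto simp: maximizers_def)
        then show ?thesis using neg V by auto
      qed
      then show False using * m(1,2) g by blast
    qed
  qed
qed

text \<open>As \<open>deg_plus \<le> dg \<le> deg_sum\<close>, existence is inherited from
  \<open>deg_plus\<close>, and absence, in \<open>no_high_mono\<close>, from \<open>deg_sum\<close>;
  this is why the two degrees share their limits.\<close>

lemma exists_high:
  assumes "dg \<in> {deg_sum, deg_plus}" "x < 1 + ln c"
  shows "(\<lambda>n. drgvr_prob \<beta> p n {g. \<forall>v\<in>verts g. dg g v < deg_ceil x n}) \<longlonglongrightarrow> 0"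
proof -
  have le: "deg_plus g v \<le> dg g v" for g v using assms(1) by (auto simp: deg_sum_def)
  note lim = exists_high_deg_plus[OF assms(2)]
  show ?thesis
  proof (rule drgvr_law_tendsto_0[OF lim lim], rule always_eventually, intro allI impI disjI1)
    fix n g assume "g \<in> {g. \<forall>v\<in>verts g. dg g v < deg_ceil x n}"
    then have "dg g v < deg_ceil x n" if "v \<in> verts g" for v using that by blast
    then have "deg_plus g v < deg_ceil x n" if "v \<in> verts g" for v
      using le[of g v] that by (meson le_less_trans)
    then show "g \<in> {g. \<forall>v\<in>verts g. deg_plus g v < deg_ceil x n}" by blast
  qed
qed

lemma no_high_mono:
  assumes "dg \<in> {deg_sum, deg_plus}"
    and lim: "(\<lambda>n. drgvr_prob \<beta> p n {g. \<exists>v\<in>verts g. R n v \<and> deg_ceil x n \<le> deg_sum g v}) \<longlonglongrightarrow> 0"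
  shows "(\<lambda>n. drgvr_prob \<beta> p n {g. \<exists>v\<in>verts g. R n v \<and> deg_ceil x n \<le> dg g v}) \<longlonglongrightarrow> 0"
proof -
  have le: "dg g v \<le> deg_sum g v" for g v using assms(1) by (auto simp: deg_sum_def)
  show ?thesis
  proof (rule drgvr_law_tendsto_0[OF lim lim], rule always_eventually, intro allI impI disjI1)
    fix n g assume "g \<in> {g. \<exists>v\<in>verts g. R n v \<and> deg_ceil x n \<le> dg g v}"
    then obtain v where "v \<in> verts g" "R n v" "deg_ceil x n \<le> dg g v" by blast
    moreover from this have "deg_ceil x n \<le> deg_sum g v" using le[of g v] by simp
    ultimately show "g \<in> {g. \<exists>v\<in>verts g. R n v \<and> deg_ceil x n \<le> deg_sum g v}" by blast
  qed
qed

lemma min_maximizer_log: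
  assumes "dg \<in> {deg_sum, deg_plus}" "0 < e"
  shows "(\<lambda>n. drgvr_prob \<beta> p n
    {g. e < \<bar>ln (real (Min (maximizers dg g))) / ln (real n) - 1\<bar>}) \<longlonglongrightarrow> 0"
\<comment> \<open>Any level below \<open>1 + ln c\<close> would do, for instance
  \<open>ln c\<close>, because the early vertices miss every level.\<close>
proof (rule maximizers_location[OF exists_high[OF assms(1), of "ln c"] no_high_mono[OF assms(1) no_high_deg_sum_early[of "1 - e"]]])
  show "eventually (\<lambda>n. \<forall>g. finite (maximizers dg g) \<longrightarrow> maximizers dg g \<noteq> {} \<longrightarrow>
    (\<forall>v\<in>maximizers dg g. v \<in> {1..n} \<and> \<not> real v \<le> real n powr (1 - e)) \<longrightarrow>
    g \<notin> {g. e < \<bar>ln (real (Min (maximizers dg g))) / ln (real n) - 1\<bar>}) sequentially"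
    using eventually_ln_gt_1 eventually_gt_at_top[of 0]
  proof (eventually_elim, intro allI impI)
    fix n g
    assume n: "1 < ln (real n)" "0 < n" and m: "finite (maximizers dg g)" "maximizers dg g \<noteq> {}"
      and loc: "\<forall>v\<in>maximizers dg g. v \<in> {1..n} \<and> \<not> real v \<le> real n powr (1 - e)"
    define w where "w = Min (maximizers dg g)"
    have "w \<in> maximizers dg g" unfolding w_def using m by (rule Min_in)
    then have w: "1 \<le> w" "w \<le> n" "real n powr (1 - e) < real w" using loc by auto
    have L: "0 < ln (real n)" using n(1) by linarith
    have le: "ln (real w) \<le> ln (real n)" using w by simp
    have gt: "(1 - e) * ln (real n) < ln (real w)"
    proof -
      have "ln (real n powr (1 - e)) < ln (real w)" using w n by (subst ln_less_cancel_iff) auto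
      then show ?thesis using n by (simp add: ln_powr)
    qed
    have "1 - e < ln (real w) / ln (real n)" unfolding pos_less_divide_eq[OF L] by (rule gt)
    moreover have "ln (real w) / ln (real n) \<le> 1" unfolding pos_divide_le_eq[OF L] using le by simp
    ultimately show "g \<notin> {g. e < \<bar>ln (real (Min (maximizers dg g))) / ln (real n) - 1\<bar>}"
      by (simp add: w_def)
  qed
qed (use assms in auto)

lemma max_maximizer_late:
  assumes "dg \<in> {deg_sum, deg_plus}" "0 < \<delta>"
  shows "(\<lambda>n. drgvr_prob \<beta> p n
    {g. \<not> real (Max (maximizers dg g)) \<le> \<delta> * real n}) \<longlonglongrightarrow> 0"
proof -
  obtain x where x: "x < 1 + ln c" "(\<lambda>n. drgvr_prob \<beta> p n
    {g. \<exists>v\<in>verts g. \<delta> * real n < real v \<and> deg_ceil x n \<le> deg_sum g v}) \<longlonglongrightarrow> 0"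
    using no_high_deg_sum_late[OF assms(2)] by blast
  show ?thesis
    by (rule maximizers_location[OF exists_high[OF assms(1) x(1)] no_high_mono[OF assms(1) x(2)]])
       (auto intro!: always_eventually dest: Max_in simp: not_less)
qed

lemma min_maximizer_deg_minus:
  assumes "0 < e"
  shows "(\<lambda>n. drgvr_prob \<beta> p n
    {g. e < \<bar>real (Min (maximizers deg_minus g)) / real n - 1\<bar>}) \<longlonglongrightarrow> 0"
proof -
  \<comment> \<open>Capped at \<open>1 / 2\<close> because \<open>no_high_deg_minus_early\<close>
    asks for \<open>\<delta> < 1\<close>, while \<open>e\<close> may be large.\<close>
  define \<delta> where "\<delta> = min e (1 / 2)"
  have \<delta>: "0 < \<delta>" "\<delta> < 1" "\<delta> \<le> e" using assms by (auto simp: \<delta>_def)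
  obtain x where x: "x < 1 + ln \<beta>" "(\<lambda>n. drgvr_prob \<beta> p n
    {g. \<exists>v\<in>verts g. real v \<le> (1 - \<delta>) * real n \<and> deg_ceil x n \<le> deg_minus g v}) \<longlonglongrightarrow> 0"
    using no_high_deg_minus_early[OF \<delta>(1,2)] by blast
  show ?thesis
  proof (rule maximizers_location[OF exists_high_deg_minus[OF x(1)] x(2)])
    show "eventually (\<lambda>n. \<forall>g. finite (maximizers deg_minus g) \<longrightarrow> maximizers deg_minus g \<noteq> {} \<longrightarrow>
      (\<forall>v\<in>maximizers deg_minus g. v \<in> {1..n} \<and> \<not> real v \<le> (1 - \<delta>) * real n) \<longrightarrow>
      g \<notin> {g. e < \<bar>real (Min (maximizers deg_minus g)) / real n - 1\<bar>}) sequentially"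
      using eventually_gt_at_top[of 0]
    proof (eventually_elim, intro allI impI)
      fix n :: nat and g
      assume n: "0 < n" and m: "finite (maximizers deg_minus g)" "maximizers deg_minus g \<noteq> {}"
        and loc: "\<forall>v\<in>maximizers deg_minus g. v \<in> {1..n} \<and> \<not> real v \<le> (1 - \<delta>) * real n"
      define w where "w = Min (maximizers deg_minus g)"
      have "w \<in> maximizers deg_minus g" unfolding w_def using m by (rule Min_in)
      then have w: "w \<le> n" "(1 - \<delta>) * real n < real w" using loc by auto
      then have "1 - \<delta> < real w / real n" "real w / real n \<le> 1"
        using n by (simp_all add: pos_less_divide_eq pos_divide_le_eq)
      then show "g \<notin> {g. e < \<bar>real (Min (maximizers deg_minus g)) / real n - 1\<bar>}"
        using \<delta>(3) by (simp add: w_def)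
    qed
  qed
qed

end

lemma (in DRGVR) tendsto_in_prob_graph:
  assumes "\<And>e. 0 < e \<Longrightarrow>
    (\<lambda>n. drgvr_prob \<beta> (1 / 2 + \<epsilon>) n {g. e < \<bar>F n g - l\<bar>}) \<longlonglongrightarrow> 0"
  shows "tendsto_in_prob M (\<lambda>n \<omega>. F n (G n \<omega>)) l"
  unfolding tendsto_in_prob_def
proof (intro conjI allI impI)
  show "(\<lambda>\<omega>. F n (G n \<omega>)) \<in> borel_measurable M" for n
    by (rule measurable_compose[OF G_measurable]) simp
  fix e :: real assume "0 < e"
  from assms[OF this] show "(\<lambda>n. prob {\<omega> \<in> space M. e < \<bar>F n (G n \<omega>) - l\<bar>}) \<longlonglongrightarrow> 0"
    using distr_G[of _ "{g. e < \<bar>F _ g - l\<bar>}"] by simp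
qed

theorem theorem1p11:
  fixes M :: "'a measure" and \<beta> \<epsilon> p :: real
    and \<xi> :: "nat \<Rightarrow> 'a \<Rightarrow> bool" and G :: "nat \<Rightarrow> 'a \<Rightarrow> ngraph"
  assumes "\<beta> > 0" and "0 < \<epsilon>" and "\<epsilon> < 1 / 2" and "p = 1 / 2 + \<epsilon>"
    and "DRGVR M \<beta> \<epsilon> \<xi> G"
  shows "(\<forall>d\<in>{deg_sum, deg_plus}.
           tendsto_in_prob M
             (\<lambda>n \<omega>. (ln (ln (real n)))\<^sup>2 / ln (real n) * real (max_deg d (G n \<omega>))
                     - ln (ln (real n)) - ln (ln (ln (real n))))
             (1 + ln (\<beta> * p / (1 - p)))) \<and>
         tendsto_in_prob M
           (\<lambda>n \<omega>. (ln (ln (real n)))\<^sup>2 / ln (real n) * real (max_deg deg_minus (G n \<omega>))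
                   - ln (ln (real n)) - ln (ln (ln (real n))))
           (1 + ln \<beta>) \<and>
         (\<forall>d\<in>{deg_sum, deg_plus}.
           tendsto_in_prob M
             (\<lambda>n \<omega>. ln (real (Min (maximizers d (G n \<omega>)))) / ln (real n)) 1) \<and>
         (\<forall>d\<in>{deg_sum, deg_plus}. \<forall>\<delta>::real. 0 < \<delta> \<and> \<delta> < 1 \<longrightarrow>
           (\<lambda>n. measure M {\<omega> \<in> space M. real (Max (maximizers d (G n \<omega>))) \<le> \<delta> * real n})
             \<longlonglongrightarrow> 1) \<and>
         tendsto_in_prob M
           (\<lambda>n \<omega>. real (Min (maximizers deg_minus (G n \<omega>))) / real n) 1"
proof -
  interpret DRGVR M \<beta> \<epsilon> \<xi> G by fact
  interpret drgvr_params p \<beta> by unfold_locales (use assms in auto)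
  note c = c_def[symmetric]
  show ?thesis
  proof (intro conjI ballI allI impI)
    fix dg assume dg: "dg \<in> {deg_sum, deg_plus}"
    have upper: "(\<lambda>n. drgvr_prob \<beta> p n {g. \<exists>v\<in>verts g. deg_ceil x n \<le> dg g v}) \<longlonglongrightarrow> 0"
      if "1 + ln c < x" for x
      using no_high_mono[OF dg, of "\<lambda>_ _. True" x] no_high_deg_sum[OF that] by simp
    show "tendsto_in_prob M (\<lambda>n \<omega>. (ln (ln (real n)))\<^sup>2 / ln (real n) * real (max_deg dg (G n \<omega>))
        - ln (ln (real n)) - ln (ln (ln (real n)))) (1 + ln (\<beta> * p / (1 - p)))"
      unfolding c
      by (rule tendsto_in_prob_graph, unfold assms(4)[symmetric], rule max_deg_concentration)
         (use upper exists_high[OF dg] in auto)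
    show "tendsto_in_prob M (\<lambda>n \<omega>. ln (real (Min (maximizers dg (G n \<omega>)))) / ln (real n)) 1"
      by (rule tendsto_in_prob_graph, unfold assms(4)[symmetric], rule min_maximizer_log[OF dg])
    fix \<delta> :: real assume \<delta>: "0 < \<delta> \<and> \<delta> < 1"
    have "prob {\<omega> \<in> space M. real (Max (maximizers dg (G n \<omega>))) \<le> \<delta> * real n} =
        1 - drgvr_prob \<beta> p n {g. \<not> real (Max (maximizers dg g)) \<le> \<delta> * real n}" for n
    proof -
      have "prob {\<omega> \<in> space M. real (Max (maximizers dg (G n \<omega>))) \<le> \<delta> * real n} =
          drgvr_prob \<beta> p n {g. real (Max (maximizers dg g)) \<le> \<delta> * real n}"
        using distr_G[of n "{g. real (Max (maximizers dg g)) \<le> \<delta> * real n}"] assms(4) by simp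
      also have "\<dots> = 1 - drgvr_prob \<beta> p n (UNIV - {g. real (Max (maximizers dg g)) \<le> \<delta> * real n})"
        using measure_pmf.prob_compl[of "{g. real (Max (maximizers dg g)) \<le> \<delta> * real n}" "drgvr_law \<beta> p n"] by simp
      also have "UNIV - {g. real (Max (maximizers dg g)) \<le> \<delta> * real n} = {g. \<not> real (Max (maximizers dg g)) \<le> \<delta> * real n}"
        by auto
      finally show ?thesis .
    qed
    then show "(\<lambda>n. prob {\<omega> \<in> space M. real (Max (maximizers dg (G n \<omega>))) \<le> \<delta> * real n}) \<longlonglongrightarrow> 1"
      using tendsto_diff[OF tendsto_const[of 1] max_maximizer_late[OF dg]] \<delta> by simp
  next
    show "tendsto_in_prob M (\<lambda>n \<omega>. (ln (ln (real n)))\<^sup>2 / ln (real n) * real (max_deg deg_minus (G n \<omega>))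
        - ln (ln (real n)) - ln (ln (ln (real n)))) (1 + ln \<beta>)"
      by (rule tendsto_in_prob_graph, unfold assms(4)[symmetric], rule max_deg_concentration)
         (use no_high_deg_minus exists_high_deg_minus in auto)
    show "tendsto_in_prob M (\<lambda>n \<omega>. real (Min (maximizers deg_minus (G n \<omega>))) / real n) 1"
      by (rule tendsto_in_prob_graph, unfold assms(4)[symmetric], rule min_maximizer_deg_minus)
  qed
qed

end
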